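(* Let $M$ be a separable metric space containing a Lipschitz retract (of $M$) which is Lipschitz equivalent to the closed unit ball of $c_0$, and suppose that $M$ is an absolute Lipschitz retract. Then $\mathcal{F}(M)\simeq \mathcal{F}(c_0)$. In particular, if $K$ is an infinite compact metric space, then $\mathcal{F}(C(K))\simeq \mathcal{F}(c_0)$.
   Context: For a pointed metric space $(M,d,0)$, $Lip_0(M)$ is the Banach space of all real-valued Lipschitz functions $f$ on $M$ with $f(0)=0$, with norm $\|f\|_{Lip}=\sup_{x\ne y}\frac{|f(x)-f(y)|}{d(x,y)}$. The Lipschitz-free space $\mathcal{F}(M)$ is the norm closure in $Lip_0(M)^*$ of the linear span of the evaluation functionals $\delta_x: f\mapsto f(x)$, $x\in M$. Different choices of base point give isometrically isomorphic spaces, so the base point need not be specified. $\simeq$ denotes linear isomorphism of Banach spaces. $c_0$ is the real Banach space of null sequences with the sup norm; $C(K)$ is the Banach space of real continuous functions on $K$ with the sup norm; Banach spaces and their subsets are regarded as metric spaces with the norm distance. A subset $F$ of a metric space $M$ is a Lipschitz retract of $M$ if there is a Lipschitz map from $M$ onto $F$ which is the identity on $F$. A metric space is an absolute Lipschitz retract if it is a Lipschitz retract of every metric space containing it (isometrically). Two metric spaces are Lipschitz equivalent if there is a bi-Lipschitz map from one onto the other. *)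

theory Defs
  imports "HOL-Analysis.Analysis"
begin

section \<open>Lipschitz-free spaces\<close>

text \<open>
  Real-valued functions on a carrier set \<open>S\<close> are represented by total functions that vanish
  off \<open>S\<close>. This makes the representation unique and keeps it closed under the pointwise
  linear operations. Functionals on \<open>Lip0 M a\<close> are treated in the same way.
\<close>

definition Lip0 :: "'a metric \<Rightarrow> 'a \<Rightarrow> ('a \<Rightarrow> real) set" where
  "Lip0 M a = {f. Lipschitz_continuous_map M euclidean_metric f \<and> f a = 0 \<and>
                  (\<forall>x. x \<notin> mspace M \<longrightarrow> f x = 0)}"

text \<open>
  The pairs with \<open>x = y\<close> contribute \<open>0 / 0 = 0\<close>. They do not change the supremum, except that
  they give a one-point space the norm \<open>0\<close> rather than the supremum of the empty set.
\<close>

definition Lip_norm :: "'a metric \<Rightarrow> ('a \<Rightarrow> real) \<Rightarrow> real" where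
  "Lip_norm M f = (SUP (x, y) \<in> mspace M \<times> mspace M. \<bar>f x - f y\<bar> / mdist M x y)"

definition Lip0_dual :: "'a metric \<Rightarrow> 'a \<Rightarrow> (('a \<Rightarrow> real) \<Rightarrow> real) set" where
  "Lip0_dual M a = {\<phi>.
     (\<forall>f \<in> Lip0 M a. \<forall>g \<in> Lip0 M a. \<phi> (\<lambda>x. f x + g x) = \<phi> f + \<phi> g) \<and>
     (\<forall>c. \<forall>f \<in> Lip0 M a. \<phi> (\<lambda>x. c * f x) = c * \<phi> f) \<and>
     (\<exists>B. \<forall>f \<in> Lip0 M a. \<bar>\<phi> f\<bar> \<le> B * Lip_norm M f) \<and>
     (\<forall>f. f \<notin> Lip0 M a \<longrightarrow> \<phi> f = 0)}"

definition dual_norm :: "'a metric \<Rightarrow> 'a \<Rightarrow> (('a \<Rightarrow> real) \<Rightarrow> real) \<Rightarrow> real" where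
  "dual_norm M a \<phi> = (SUP f \<in> {f \<in> Lip0 M a. Lip_norm M f \<le> 1}. \<bar>\<phi> f\<bar>)"

definition evaluation :: "'a metric \<Rightarrow> 'a \<Rightarrow> 'a \<Rightarrow> ('a \<Rightarrow> real) \<Rightarrow> real" where
  "evaluation M a x = (\<lambda>f. if f \<in> Lip0 M a then f x else 0)"

definition evaluation_span :: "'a metric \<Rightarrow> 'a \<Rightarrow> (('a \<Rightarrow> real) \<Rightarrow> real) set" where
  "evaluation_span M a =
     {(\<lambda>f. \<Sum>x\<in>A. c x * evaluation M a x f) | A c. finite A \<and> A \<subseteq> mspace M}"

definition free_space :: "'a metric \<Rightarrow> 'a \<Rightarrow> (('a \<Rightarrow> real) \<Rightarrow> real) set" where
  "free_space M a = {\<phi> \<in> Lip0_dual M a.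
     \<forall>e>0. \<exists>\<psi> \<in> evaluation_span M a. dual_norm M a (\<lambda>f. \<phi> f - \<psi> f) < e}"

text \<open>
  Linear isomorphism of normed spaces whose elements are real-valued functions with pointwise
  operations, each given by its carrier and its norm.
\<close>

definition linearly_isomorphic ::
  "('i \<Rightarrow> real) set \<Rightarrow> (('i \<Rightarrow> real) \<Rightarrow> real) \<Rightarrow> ('j \<Rightarrow> real) set \<Rightarrow> (('j \<Rightarrow> real) \<Rightarrow> real) \<Rightarrow> bool"
where
  "linearly_isomorphic V nV W nW \<longleftrightarrow> (\<exists>T. bij_betw T V W \<and>
     (\<forall>u \<in> V. \<forall>v \<in> V. T (\<lambda>i. u i + v i) = (\<lambda>j. T u j + T v j)) \<and>
     (\<forall>c. \<forall>v \<in> V. T (\<lambda>i. c * v i) = (\<lambda>j. c * T v j)) \<and>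
     (\<exists>B. \<forall>v \<in> V. nW (T v) \<le> B * nV v) \<and>
     (\<exists>B. \<forall>v \<in> V. nV v \<le> B * nW (T v)))"

definition free_isomorphic :: "'a metric \<Rightarrow> 'a \<Rightarrow> 'b metric \<Rightarrow> 'b \<Rightarrow> bool" where
  "free_isomorphic M a N b \<longleftrightarrow>
     linearly_isomorphic (free_space M a) (dual_norm M a) (free_space N b) (dual_norm N b)"


section \<open>The spaces \<open>c\<^sub>0\<close> and \<open>C(K)\<close>\<close>

text \<open>
  The locale \<open>Metric_space\<close> requires distances to be nonnegative off the carrier as well, hence
  the case distinction.
\<close>

definition linf_carrier :: "'i set \<Rightarrow> ('i \<Rightarrow> real) set" where
  "linf_carrier S = {f. bounded (f ` S) \<and> (\<forall>i. i \<notin> S \<longrightarrow> f i = 0)}"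

definition linf_dist :: "'i set \<Rightarrow> ('i \<Rightarrow> real) \<Rightarrow> ('i \<Rightarrow> real) \<Rightarrow> real" where
  "linf_dist S f g = (if f \<in> linf_carrier S \<and> g \<in> linf_carrier S
                      then (SUP i\<in>S. \<bar>f i - g i\<bar>) else 0)"

definition linf :: "'i set \<Rightarrow> ('i \<Rightarrow> real) metric" where
  "linf S = metric (linf_carrier S, linf_dist S)"

definition c0 :: "(nat \<Rightarrow> real) metric" where
  "c0 = submetric (linf UNIV) {x. x \<longlonglongrightarrow> 0}"

definition c0_unit_ball :: "(nat \<Rightarrow> real) metric" where
  "c0_unit_ball = submetric c0 (mcball_of c0 (\<lambda>n. 0) 1)"

definition continuous_functions :: "'k metric \<Rightarrow> ('k \<Rightarrow> real) metric" where
  "continuous_functions K =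
     submetric (linf (mspace K)) {f. continuous_map (mtopology_of K) euclideanreal f}"

lemma linf_bdd:
  assumes "f \<in> linf_carrier S" "g \<in> linf_carrier S"
  shows "bdd_above ((\<lambda>i. \<bar>f i - g i\<bar>) ` S)"
proof -
  obtain A B where "\<And>i. i \<in> S \<Longrightarrow> \<bar>f i\<bar> \<le> A" "\<And>i. i \<in> S \<Longrightarrow> \<bar>g i\<bar> \<le> B"
    using assms unfolding bounded_iff linf_carrier_def by fastforce
  then have "\<bar>f i - g i\<bar> \<le> A + B" if "i \<in> S" for i
    using that by (smt (verit))
  then show ?thesis by (auto simp: bdd_above_def)
qed

lemma linf_dist_upper:
  assumes "f \<in> linf_carrier S" "g \<in> linf_carrier S" "i \<in> S"
  shows "\<bar>f i - g i\<bar> \<le> linf_dist S f g"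
  using cSUP_upper[OF assms(3) linf_bdd[OF assms(1,2)]] assms by (simp add: linf_dist_def)

lemma linf_dist_least:
  assumes "S \<noteq> {}" "f \<in> linf_carrier S" "g \<in> linf_carrier S"
    and "\<And>i. i \<in> S \<Longrightarrow> \<bar>f i - g i\<bar> \<le> B"
  shows "linf_dist S f g \<le> B"
  using assms by (simp add: linf_dist_def cSUP_least)

lemma Metric_space_linf:
  assumes "S \<noteq> {}"
  shows "Metric_space (linf_carrier S) (linf_dist S)"
proof
  obtain s where s: "s \<in> S" using assms by blast
  show nonneg: "0 \<le> linf_dist S f g" for f g
  proof (cases "f \<in> linf_carrier S \<and> g \<in> linf_carrier S")
    case True
    then show ?thesis using linf_dist_upper[of f S g s] s by linarith
  qed (auto simp: linf_dist_def)
  show "linf_dist S f g = linf_dist S g f" for f g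
    by (auto simp: linf_dist_def abs_minus_commute)
  show "linf_dist S f g = 0 \<longleftrightarrow> f = g" if fg: "f \<in> linf_carrier S" "g \<in> linf_carrier S" for f g
  proof
    assume "linf_dist S f g = 0"
    then have "f i = g i" if "i \<in> S" for i
      using linf_dist_upper[OF fg that] by simp
    then show "f = g" using fg by (force simp: linf_carrier_def)
  next
    assume "f = g"
    then show "linf_dist S f g = 0"
      using linf_dist_least[OF assms fg, of 0] nonneg[of f g] by simp
  qed
  show "linf_dist S f h \<le> linf_dist S f g + linf_dist S g h"
    if fgh: "f \<in> linf_carrier S" "g \<in> linf_carrier S" "h \<in> linf_carrier S" for f g h
  proof (rule linf_dist_least[OF assms fgh(1,3)])
    fix i assume "i \<in> S"
    from linf_dist_upper[OF fgh(1,2) this] linf_dist_upper[OF fgh(2,3) this]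
    show "\<bar>f i - h i\<bar> \<le> linf_dist S f g + linf_dist S g h" by linarith
  qed
qed

lemma mspace_linf [simp]: "S \<noteq> {} \<Longrightarrow> mspace (linf S) = linf_carrier S"
  by (simp add: linf_def Metric_space.mspace_metric Metric_space_linf)

lemma mdist_linf [simp]: "S \<noteq> {} \<Longrightarrow> mdist (linf S) = linf_dist S"
  by (simp add: linf_def Metric_space.mdist_metric Metric_space_linf)

lemma mspace_c0: "mspace c0 = {x. x \<longlonglongrightarrow> 0}"
  by (auto simp: c0_def linf_carrier_def convergent_imp_bounded)

lemma mdist_c0:
  "x \<in> mspace c0 \<Longrightarrow> y \<in> mspace c0 \<Longrightarrow> mdist c0 x y = (SUP n. \<bar>x n - y n\<bar>)"
  by (simp add: c0_def linf_dist_def)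

lemma mspace_continuous_functions:
  assumes "compact_space (mtopology_of K)" "mspace K \<noteq> {}"
  shows "mspace (continuous_functions K) =
    {f. continuous_map (mtopology_of K) euclideanreal f \<and> (\<forall>x. x \<notin> mspace K \<longrightarrow> f x = 0)}"
proof -
  have "bounded (f ` mspace K)" if "continuous_map (mtopology_of K) euclideanreal f" for f
  proof -
    have "compactin euclideanreal (f ` topspace (mtopology_of K))"
      using assms(1) that image_compactin unfolding compact_space_def by blast
    then show ?thesis by (simp add: compact_imp_bounded)
  qed
  then show ?thesis using assms(2) by (auto simp: continuous_functions_def linf_carrier_def)
qed

lemma mdist_continuous_functions:
  assumes "mspace K \<noteq> {}" "f \<in> mspace (continuous_functions K)" "g \<in> mspace (continuous_functions K)"
  shows "mdist (continuous_functions K) f g = (SUP x\<in>mspace K. \<bar>f x - g x\<bar>)"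
  using assms by (simp add: continuous_functions_def linf_dist_def)


section \<open>Lipschitz retracts and Lipschitz equivalence\<close>

definition Lipschitz_retract :: "'a metric \<Rightarrow> 'a set \<Rightarrow> bool" where
  "Lipschitz_retract M F \<longleftrightarrow> F \<subseteq> mspace M \<and>
     (\<exists>r. Lipschitz_continuous_map M (submetric M F) r \<and> r ` mspace M = F \<and> (\<forall>x\<in>F. r x = x))"

definition Lipschitz_equivalent :: "'a metric \<Rightarrow> 'b metric \<Rightarrow> bool" where
  "Lipschitz_equivalent M N \<longleftrightarrow> (\<exists>f c C. f ` mspace M = mspace N \<and> 0 < c \<and>
     (\<forall>x \<in> mspace M. \<forall>y \<in> mspace M. c * mdist M x y \<le> mdist N (f x) (f y) \<and>
                                   mdist N (f x) (f y) \<le> C * mdist M x y))"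

definition isometric_embedding :: "'a metric \<Rightarrow> 'b metric \<Rightarrow> ('a \<Rightarrow> 'b) \<Rightarrow> bool" where
  "isometric_embedding M N i \<longleftrightarrow> i \<in> mspace M \<rightarrow> mspace N \<and>
     (\<forall>x \<in> mspace M. \<forall>y \<in> mspace M. mdist N (i x) (i y) = mdist M x y)"

text \<open>
  HOL cannot quantify over the type of the points of the ambient space. The definition takes
  ambient spaces with points in \<open>'a \<Rightarrow> real\<close>, a type large enough to contain the space
  \<open>linf (mspace M)\<close>, into which \<open>M\<close> embeds isometrically. The lemma
  \<open>absolute_Lipschitz_retract_any\<close> shows that nothing is lost: \<open>M\<close> is then a Lipschitz retract
  of every metric space containing it, over every type.
\<close>

definition absolute_Lipschitz_retract :: "'a metric \<Rightarrow> bool" where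
  "absolute_Lipschitz_retract M \<longleftrightarrow>
     (\<forall>(N :: ('a \<Rightarrow> real) metric) i.
        isometric_embedding M N i \<longrightarrow> Lipschitz_retract N (i ` mspace M))"

lemma McShane_extension:
  fixes N :: "'b metric" and f :: "'b \<Rightarrow> real"
  assumes A: "A \<subseteq> mspace N" "A \<noteq> {}"
    and f: "\<And>a b. a \<in> A \<Longrightarrow> b \<in> A \<Longrightarrow> \<bar>f a - f b\<bar> \<le> mdist N a b"
  obtains F where "\<And>a. a \<in> A \<Longrightarrow> F a = f a"
    and "\<And>x y. x \<in> mspace N \<Longrightarrow> y \<in> mspace N \<Longrightarrow> \<bar>F x - F y\<bar> \<le> mdist N x y"
proof
  interpret N: Metric_space "mspace N" "mdist N" by simp
  define F where "F x = (INF a\<in>A. f a + mdist N x a)" for x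
  obtain a0 where a0: "a0 \<in> A" using A by blast
  have bdd: "bdd_below ((\<lambda>a. f a + mdist N x a) ` A)" if x: "x \<in> mspace N" for x
  proof -
    have "f a0 - mdist N x a0 \<le> f a + mdist N x a" if "a \<in> A" for a
      using f[OF a0 that] N.triangle''[of a0 x a] A a0 that x by (force simp: abs_le_iff)
    then show ?thesis by (auto simp: bdd_below_def)
  qed
  show "F a = f a" if a: "a \<in> A" for a
  proof (rule antisym)
    have aN: "a \<in> mspace N" using a A by blast
    show "F a \<le> f a"
      unfolding F_def using cINF_lower[OF bdd[OF aN] a] aN by simp
    show "f a \<le> F a"
      unfolding F_def
    proof (rule cINF_greatest[OF A(2)])
      fix b assume "b \<in> A"
      then show "f a \<le> f b + mdist N a b" using f[OF a, of b] by linarith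
    qed
  qed
  have half: "F x \<le> F y + mdist N x y" if xy: "x \<in> mspace N" "y \<in> mspace N" for x y
  proof -
    have "F x - mdist N x y \<le> F y"
      unfolding F_def[of y]
    proof (rule cINF_greatest[OF A(2)])
      fix b assume b: "b \<in> A"
      have "F x \<le> f b + mdist N x b"
        unfolding F_def by (rule cINF_lower[OF bdd[OF xy(1)] b])
      moreover have "mdist N x b \<le> mdist N x y + mdist N y b"
        using N.triangle[of x y b] xy b A by blast
      ultimately show "F x - mdist N x y \<le> f b + mdist N y b" by linarith
    qed
    then show ?thesis by linarith
  qed
  show "\<bar>F x - F y\<bar> \<le> mdist N x y" if "x \<in> mspace N" "y \<in> mspace N" for x y
    using half[OF that] half[OF that(2,1)] N.commute[of x y] by linarith
qed

lemma absolute_Lipschitz_retract_any: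
  fixes M :: "'a metric" and N :: "'b metric"
  assumes ALR: "absolute_Lipschitz_retract M" and i: "isometric_embedding M N i"
  shows "Lipschitz_retract N (i ` mspace M)"
proof -
  interpret M: Metric_space "mspace M" "mdist M" by simp
  interpret N: Metric_space "mspace N" "mdist N" by simp
  have "mspace M \<noteq> {}"
  proof
    assume empty: "mspace M = {}"
    have "isometric_embedding M (linf (UNIV :: 'a set)) (\<lambda>_ _. 0)"
      by (simp add: isometric_embedding_def empty)
    then have "Lipschitz_retract (linf (UNIV :: 'a set)) {}"
      using ALR empty by (metis absolute_Lipschitz_retract_def image_empty)
    then have "linf_carrier (UNIV :: 'a set) = {}"
      by (auto simp: Lipschitz_retract_def)
    moreover have "(\<lambda>_. 0) \<in> linf_carrier (UNIV :: 'a set)"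
      by (auto simp: linf_carrier_def bounded_iff)
    ultimately show False by blast
  qed
  then obtain p where p: "p \<in> mspace M" by blast
  let ?S = "mspace M"
  define k where "k x = (\<lambda>y. if y \<in> ?S then mdist M x y - mdist M p y else 0)" for x
  have iN: "i x \<in> mspace N" if "x \<in> ?S" for x
    using i that by (auto simp: isometric_embedding_def)
  have di: "mdist N (i x) (i y) = mdist M x y" if "x \<in> ?S" "y \<in> ?S" for x y
    using i that by (auto simp: isometric_embedding_def)
  have kS: "k x \<in> linf_carrier ?S" if x: "x \<in> ?S" for x
  proof -
    have "\<bar>k x y\<bar> \<le> mdist M x p" if "y \<in> ?S" for y
      using M.mdist_reverse_triangle[of x y p] M.commute[of y p] x p that by (simp add: k_def)
    then show ?thesis by (auto simp: linf_carrier_def bounded_iff k_def)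
  qed
  have dk: "linf_dist ?S (k x) (k y) = mdist M x y" if xy: "x \<in> ?S" "y \<in> ?S" for x y
  proof (rule antisym)
    show "linf_dist ?S (k x) (k y) \<le> mdist M x y"
    proof (rule linf_dist_least)
      show "\<bar>k x z - k y z\<bar> \<le> mdist M x y" if "z \<in> ?S" for z
        using M.mdist_reverse_triangle[of x z y] M.commute[of z y] xy that by (simp add: k_def)
    qed (use p xy kS in auto)
    show "mdist M x y \<le> linf_dist ?S (k x) (k y)"
      using linf_dist_upper[OF kS[OF xy(1)] kS[OF xy(2)] xy(2)] xy by (simp add: k_def)
  qed
  have ne: "?S \<noteq> {}" using p by blast
  have "isometric_embedding M (linf ?S) k"
    using kS dk ne by (auto simp: isometric_embedding_def)
  then have "Lipschitz_retract (linf ?S) (k ` ?S)"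
    using ALR by (simp add: absolute_Lipschitz_retract_def)
  then obtain r where r: "Lipschitz_continuous_map (linf ?S) (submetric (linf ?S) (k ` ?S)) r"
      and rk: "\<And>x. x \<in> ?S \<Longrightarrow> r (k x) = k x"
    by (auto simp: Lipschitz_retract_def)
  have "\<exists>F. (\<forall>x\<in>?S. F (i x) = k x y) \<and>
            (\<forall>u\<in>mspace N. \<forall>v\<in>mspace N. \<bar>F u - F v\<bar> \<le> mdist N u v)" if y: "y \<in> ?S" for y
  proof -
    define f where "f u = k (inv_into ?S i u) y" for u
    have inj: "inj_on i ?S"
      by (rule inj_onI) (metis di M.zero N.mdist_zero iN)
    have fi: "f (i x) = k x y" if "x \<in> ?S" for x
      by (simp add: f_def inj that)
    have "\<bar>f u - f v\<bar> \<le> mdist N u v" if uv: "u \<in> i ` ?S" "v \<in> i ` ?S" for u v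
    proof -
      obtain a b where ab: "a \<in> ?S" "b \<in> ?S" "u = i a" "v = i b" using uv by blast
      then show ?thesis
        using linf_dist_upper[OF kS[OF ab(1)] kS[OF ab(2)] y] by (simp add: fi di dk)
    qed
    moreover have "i ` ?S \<subseteq> mspace N" "i ` ?S \<noteq> {}" using iN p by auto
    ultimately obtain F where "\<And>u. u \<in> i ` ?S \<Longrightarrow> F u = f u"
        "\<And>u v. u \<in> mspace N \<Longrightarrow> v \<in> mspace N \<Longrightarrow> \<bar>F u - F v\<bar> \<le> mdist N u v"
      using McShane_extension[of "i ` ?S" N f] by blast
    then show ?thesis using fi by (metis imageI)
  qed
  then obtain F where Fi: "\<And>x y. y \<in> ?S \<Longrightarrow> x \<in> ?S \<Longrightarrow> F y (i x) = k x y"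
      and FL: "\<And>y u v. y \<in> ?S \<Longrightarrow> u \<in> mspace N \<Longrightarrow> v \<in> mspace N \<Longrightarrow> \<bar>F y u - F y v\<bar> \<le> mdist N u v"
    by metis
  define G where "G u = (\<lambda>y. if y \<in> ?S then F y u else 0)" for u
  have GS: "G u \<in> linf_carrier ?S" if u: "u \<in> mspace N" for u
  proof -
    have "\<bar>G u y\<bar> \<le> mdist N u (i p)" if y: "y \<in> ?S" for y
      using FL[OF y u iN[OF p]] Fi[OF y p] y by (simp add: G_def k_def)
    then show ?thesis by (auto simp: linf_carrier_def bounded_iff G_def)
  qed
  have Gi: "G (i x) = k x" if "x \<in> ?S" for x
    using Fi that by (auto simp: G_def k_def)
  have GL: "linf_dist ?S (G u) (G v) \<le> mdist N u v" if "u \<in> mspace N" "v \<in> mspace N" for u v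
    by (rule linf_dist_least[OF ne GS GS]) (use FL that in \<open>auto simp: G_def\<close>)
  have rS: "r w \<in> k ` ?S" if "w \<in> linf_carrier ?S" for w
    using Lipschitz_continuous_map_image[OF r] that ne by auto
  obtain B where B: "0 < B" "\<And>v w. v \<in> linf_carrier ?S \<Longrightarrow> w \<in> linf_carrier ?S \<Longrightarrow>
      linf_dist ?S (r v) (r w) \<le> B * linf_dist ?S v w"
    using r ne by (auto simp: Lipschitz_continuous_map_pos)
  define h where "h w = inv_into ?S k w" for w
  have h: "h w \<in> ?S" "k (h w) = w" if "w \<in> k ` ?S" for w
    using that by (auto simp: h_def inv_into_into f_inv_into_f)
  define R where "R u = i (h (r (G u)))" for u
  have RS: "R u \<in> i ` ?S" if "u \<in> mspace N" for u
    using h(1)[OF rS[OF GS[OF that]]] by (auto simp: R_def)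
  have Ri: "R (i x) = i x" if x: "x \<in> ?S" for x
  proof -
    have "h (k x) = x"
      using h[of "k x"] dk[of "h (k x)" x] dk[OF x x] x by (metis M.zero image_eqI)
    then show ?thesis by (simp add: R_def Gi rk x)
  qed
  have RL: "mdist N (R u) (R v) \<le> B * mdist N u v" if uv: "u \<in> mspace N" "v \<in> mspace N" for u v
  proof -
    note hu = h[OF rS[OF GS[OF uv(1)]]] and hv = h[OF rS[OF GS[OF uv(2)]]]
    have "mdist N (R u) (R v) = linf_dist ?S (r (G u)) (r (G v))"
      using dk[OF hu(1) hv(1)] di[OF hu(1) hv(1)] hu(2) hv(2) by (simp add: R_def)
    also have "\<dots> \<le> B * linf_dist ?S (G u) (G v)" by (rule B(2)[OF GS GS]) (use uv in auto)
    also have "\<dots> \<le> B * mdist N u v" using GL[OF uv] B(1) by simp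
    finally show ?thesis .
  qed
  show ?thesis
    unfolding Lipschitz_retract_def
  proof (intro conjI exI[of _ R])
    show "i ` ?S \<subseteq> mspace N" using iN by blast
    have iS: "i ` ?S \<subseteq> mspace N" using iN by blast
    have 1: "R \<in> mspace N \<rightarrow> i ` ?S" by (rule funcsetI) (rule RS)
    have 2: "R \<in> mspace N \<rightarrow> mspace N"
      by (rule funcsetI) (rule subsetD[OF iS RS])
    show "Lipschitz_continuous_map N (submetric N (i ` ?S)) R"
      unfolding Lipschitz_continuous_map_into_submetric
      unfolding Lipschitz_continuous_map_def
      by (intro conjI 1 2 exI[of _ B] ballI RL)
    have "i x \<in> R ` mspace N" if "x \<in> ?S" for x
      using imageI[OF iN[OF that], of R] by (simp only: Ri[OF that])
    then show "R ` mspace N = i ` ?S"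
      using RS by (intro equalityI image_subsetI)
    show "\<forall>x\<in>i ` ?S. R x = x" by (simp add: Ri)
  qed
qed

end

theory Submission
  imports Defs
begin

text \<open>
  All isomorphisms and projections are constructed on the side of the Lipschitz functions, by
  operators whose output at each point is a finite linear combination of values of the input.
  The adjoint of such an operator maps finite combinations of evaluations to finite combinations of
  evaluations, hence one free space into the other.

  Let \<open>P\<close> be the space of Lipschitz functions on the unit ball of \<open>c\<^sub>0\<close> that vanish at \<open>0\<close>,
  and \<open>P\<^sup>\<infinity>\<close> its countable \<open>l\<^sub>\<infinity>\<close>-sum. By Pelczynski's decomposition
  method, a space \<open>X\<close> that is complemented in \<open>P\<close> and has \<open>P\<^sup>\<infinity>\<close> as a complemented
  subspace is isomorphic to \<open>P\<^sup>\<infinity>\<close>. Disjoint small balls inside the unit ball show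
  that \<open>P\<^sup>\<infinity>\<close> is complemented in \<open>P\<close>, and a partition of unity subordinate to dyadic
  annuli shows that the functions on \<open>c\<^sub>0\<close> are complemented in \<open>P\<^sup>\<infinity>\<close>. By Aharoni's
  theorem a separable absolute Lipschitz retract \<open>M\<close> is Lipschitz equivalent to a retract of
  \<open>c\<^sub>0\<close>, so that the functions on \<open>M\<close> are complemented in those on \<open>c\<^sub>0\<close>.

  A Lipschitz retraction of the bounded functions on \<open>K\<close> onto \<open>C(K)\<close> is obtained as a supremum
  of inf-convolutions \<open>inf\<^sub>y (f y + n d(x, y))\<close>, where large \<open>n\<close> is penalized according to
  the distance of \<open>f\<close> from the continuous functions.
\<close>

section \<open>Complemented spaces and the decomposition method\<close>

text \<open>An isomorphism between the duals \<open>Lip0\<close> need not come from the free spaces,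
  so every operator has to be weak-star continuous. Using finitely many values for each output point
  is a form of this that composes and adds without any limit argument. The sup-sum of copies of P is
  the dual of the l1-sum of copies of the free space of the ball. Arguing on the function side
  replaces that completion by a condition on each component. Finiteness also shapes the partitions:
  at every point only boundedly many pieces are active.

  Changing the base point changes a Lipschitz function only by a constant. All composition operators
  therefore subtract one value, and the maps between metric spaces may move base points.

  For C(K) two further facts have to be supplied: separability, by rational cones over finite nets,
  and a Lipschitz copy of the unit ball of c0 onto which C(K) retracts. The copy consists of
  triangular bumps along a sequence that converges geometrically to an accumulation point p:
  continuity at p forces exactly that the heights form a null sequence.\<close>

definition point_functional :: "(('i \<Rightarrow> real) \<Rightarrow> real) \<Rightarrow> bool" where
  "point_functional \<phi> \<longleftrightarrow> (\<exists>A c. finite A \<and> (\<forall>f. \<phi> f = (\<Sum>i\<in>A. c i * f i)))"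

lemma point_functional_zero: "point_functional (\<lambda>f. 0)"
  unfolding point_functional_def by (intro exI[of _ "{}"]) simp

lemma point_functional_eval: "point_functional (\<lambda>f. f i)"
  unfolding point_functional_def by (intro exI[of _ "{i}"] exI[of _ "\<lambda>_. 1"]) simp

lemma point_functional_scale:
  assumes "point_functional \<phi>" shows "point_functional (\<lambda>f. c * \<phi> f)"
proof -
  from assms obtain A d where "finite A" "\<And>f. \<phi> f = (\<Sum>i\<in>A. d i * f i)"
    unfolding point_functional_def by blast
  then show ?thesis unfolding point_functional_def
    by (intro exI[of _ A] exI[of _ "\<lambda>i. c * d i"]) (simp add: sum_distrib_left mult.assoc)
qed

lemma point_functional_add:
  assumes "point_functional \<phi>" "point_functional \<psi>" shows "point_functional (\<lambda>f. \<phi> f + \<psi> f)"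
proof -
  from assms obtain A c B d where *: "finite A" "\<And>f. \<phi> f = (\<Sum>i\<in>A. c i * f i)"
      "finite B" "\<And>f. \<psi> f = (\<Sum>i\<in>B. d i * f i)"
    unfolding point_functional_def by blast
  have "\<phi> f + \<psi> f = (\<Sum>i\<in>A \<union> B. ((if i \<in> A then c i else 0) + (if i \<in> B then d i else 0)) * f i)" for f
  proof -
    have "(\<Sum>i\<in>A. c i * f i) = (\<Sum>i\<in>A \<union> B. (if i \<in> A then c i else 0) * f i)"
      by (rule sum.mono_neutral_cong_left) (use * in auto)
    moreover have "(\<Sum>i\<in>B. d i * f i) = (\<Sum>i\<in>A \<union> B. (if i \<in> B then d i else 0) * f i)"
      by (rule sum.mono_neutral_cong_left) (use * in auto)
    ultimately show ?thesis by (simp add: * distrib_right sum.distrib)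
  qed
  then show ?thesis unfolding point_functional_def using * by (meson finite_UnI)
qed

lemma point_functional_diff:
  assumes "point_functional \<phi>" "point_functional \<psi>" shows "point_functional (\<lambda>f. \<phi> f - \<psi> f)"
  using point_functional_add[OF assms(1) point_functional_scale[OF assms(2), of "-1"]] by simp

lemma point_functional_sum:
  "finite A \<Longrightarrow> (\<And>j. j \<in> A \<Longrightarrow> point_functional (\<phi> j)) \<Longrightarrow> point_functional (\<lambda>f. \<Sum>j\<in>A. \<phi> j f)"
  by (induction A rule: finite_induct) (auto intro: point_functional_zero point_functional_add)

definition point_finite :: "(('i \<Rightarrow> real) \<Rightarrow> 'j \<Rightarrow> real) \<Rightarrow> bool" where
  "point_finite T \<longleftrightarrow> (\<forall>j. point_functional (\<lambda>f. T f j))"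

lemma point_functional_comp:
  assumes "point_functional \<phi>" "point_finite T" shows "point_functional (\<lambda>f. \<phi> (T f))"
proof -
  from assms(1) obtain A c where "finite A" "\<And>f. \<phi> f = (\<Sum>i\<in>A. c i * f i)"
    unfolding point_functional_def by blast
  then show ?thesis
    using assms(2) by (auto simp: point_finite_def intro!: point_functional_sum point_functional_scale)
qed

text \<open>Linearity comes for free from point-finiteness, so \<open>operator\<close> has no
  linearity clause.\<close>

lemma point_finite_add:
  assumes "point_finite T" shows "T (\<lambda>i. f i + g i) = (\<lambda>j. T f j + T g j)"
proof
  fix j
  from assms obtain A c where "\<And>f. T f j = (\<Sum>i\<in>A. c i * f i)"
    unfolding point_finite_def point_functional_def by blast
  then show "T (\<lambda>i. f i + g i) j = T f j + T g j" by (simp add: distrib_left sum.distrib)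
qed

lemma point_finite_scale:
  assumes "point_finite T" shows "T (\<lambda>i. c * f i) = (\<lambda>j. c * T f j)"
proof
  fix j
  from assms obtain A d where "\<And>f. T f j = (\<Sum>i\<in>A. d i * f i)"
    unfolding point_finite_def point_functional_def by blast
  then show "T (\<lambda>i. c * f i) j = c * T f j" by (simp add: sum_distrib_left ac_simps)
qed

lemma point_finite_diff:
  assumes "point_finite T" shows "T (\<lambda>i. f i - g i) = (\<lambda>j. T f j - T g j)"
  using point_finite_add[OF assms, of f "\<lambda>i. -1 * g i"] point_finite_scale[OF assms, of "-1" g] by simp

text \<open>A normed space of functions is given by its family of closed balls around \<open>0\<close>.\<close>

definition ball_family :: "(real \<Rightarrow> ('i \<Rightarrow> real) set) \<Rightarrow> bool" where
  "ball_family P \<longleftrightarrow>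
     (\<forall>r s f g. 0 \<le> r \<longrightarrow> 0 \<le> s \<longrightarrow> f \<in> P r \<longrightarrow> g \<in> P s \<longrightarrow> (\<lambda>i. f i + g i) \<in> P (r + s)) \<and>
     (\<forall>c r f. 0 \<le> r \<longrightarrow> f \<in> P r \<longrightarrow> (\<lambda>i. c * f i) \<in> P (\<bar>c\<bar> * r)) \<and>
     (\<forall>r s. 0 \<le> r \<longrightarrow> r \<le> s \<longrightarrow> P r \<subseteq> P s)"

definition whole_space :: "(real \<Rightarrow> ('i \<Rightarrow> real) set) \<Rightarrow> ('i \<Rightarrow> real) set" where
  "whole_space P = (\<Union>r\<in>{0..}. P r)"

text \<open>\<open>K\<close> is any bound, not the norm. Quantifying over all radii keeps the
  definition free of a norm and includes the radius 0.\<close>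

definition operator ::
  "(real \<Rightarrow> ('i \<Rightarrow> real) set) \<Rightarrow> (real \<Rightarrow> ('j \<Rightarrow> real) set) \<Rightarrow> real \<Rightarrow> (('i \<Rightarrow> real) \<Rightarrow> 'j \<Rightarrow> real) \<Rightarrow> bool"
where
  "operator P Q K T \<longleftrightarrow> 0 \<le> K \<and> point_finite T \<and> (\<forall>r\<ge>0. \<forall>f\<in>P r. T f \<in> Q (K * r))"

lemma operator_whole_space: "operator P Q K T \<Longrightarrow> f \<in> whole_space P \<Longrightarrow> T f \<in> whole_space Q"
  by (force simp: operator_def whole_space_def)

lemma operator_comp:
  assumes "operator P Q K T" "operator Q U L S" shows "operator P U (L * K) (\<lambda>f. S (T f))"
  unfolding operator_def
proof (intro conjI allI impI ballI)
  show "0 \<le> L * K" using assms by (simp add: operator_def)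
  have "point_functional (\<lambda>f. S (T f) j)" for j
    by (rule point_functional_comp[of "\<lambda>g. S g j" T])
       (use assms in \<open>auto simp: operator_def point_finite_def\<close>)
  then show "point_finite (\<lambda>f. S (T f))" by (simp add: point_finite_def)
  fix r :: real and f assume "0 \<le> r" "f \<in> P r"
  then have "T f \<in> Q (K * r)" "0 \<le> K * r" using assms by (auto simp: operator_def)
  then show "S (T f) \<in> U (L * K * r)" using assms by (auto simp: operator_def mult.assoc)
qed

lemma operator_id: "operator P P 1 (\<lambda>f. f)"
  by (simp add: operator_def point_finite_def point_functional_eval)

text \<open>Used to bring two operators to a common bound, as \<open>operator_case_sum\<close> and
  \<open>operator_sup_sum\<close> demand.\<close>

lemma operator_mono:
  assumes "ball_family Q" "operator P Q K T" "K \<le> L" shows "operator P Q L T"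
  unfolding operator_def
proof (intro conjI allI impI ballI)
  fix r :: real and f assume r: "0 \<le> r" "f \<in> P r"
  then have "T f \<in> Q (K * r)" "0 \<le> K * r" "K * r \<le> L * r"
    using assms by (auto simp: operator_def mult_right_mono)
  then show "T f \<in> Q (L * r)" using assms(1) unfolding ball_family_def by blast
qed (use assms in \<open>auto simp: operator_def\<close>)

lemma operator_add:
  assumes "ball_family Q" "operator P Q K T" "operator P Q L S"
  shows "operator P Q (K + L) (\<lambda>f j. T f j + S f j)"
  unfolding operator_def
proof (intro conjI allI impI ballI)
  show "point_finite (\<lambda>f j. T f j + S f j)"
    using assms(2,3) point_functional_add[of "\<lambda>f. T f j" "\<lambda>f. S f j" for j]
    by (simp add: operator_def point_finite_def)
  fix r :: real and f assume r: "0 \<le> r" "f \<in> P r"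
  then have "T f \<in> Q (K * r)" "0 \<le> K * r" "S f \<in> Q (L * r)" "0 \<le> L * r"
    using assms by (auto simp: operator_def)
  then have "(\<lambda>j. T f j + S f j) \<in> Q (K * r + L * r)"
    using assms(1) unfolding ball_family_def by blast
  then show "(\<lambda>j. T f j + S f j) \<in> Q ((K + L) * r)" by (simp add: distrib_right)
qed (use assms in \<open>auto simp: operator_def\<close>)

lemma operator_diff:
  assumes "ball_family Q" "operator P Q K T" "operator P Q L S"
  shows "operator P Q (K + L) (\<lambda>f j. T f j - S f j)"
proof -
  have "operator P Q L (\<lambda>f j. -1 * S f j)"
    unfolding operator_def
  proof (intro conjI allI impI ballI)
    show "point_finite (\<lambda>f j. -1 * S f j)"
      using assms(3) point_functional_scale[of "\<lambda>f. S f j" "-1" for j]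
      by (simp add: operator_def point_finite_def)
    fix r :: real and f assume r: "0 \<le> r" "f \<in> P r"
    then have "S f \<in> Q (L * r)" "0 \<le> L * r" using assms by (auto simp: operator_def)
    then have "(\<lambda>j. -1 * S f j) \<in> Q (\<bar>-1\<bar> * (L * r))"
      using assms(1) unfolding ball_family_def by blast
    then show "(\<lambda>j. -1 * S f j) \<in> Q (L * r)" by simp
  qed (use assms in \<open>auto simp: operator_def\<close>)
  from operator_add[OF assms(1,2) this] show ?thesis by simp
qed

text \<open>\<open>E\<close> embeds \<open>P\<close> isomorphically, and \<open>E\<close> after
  \<open>R\<close> is a bounded projection of \<open>Q\<close> onto the image. Keeping both maps
  avoids having to speak about subspaces.\<close>

definition complemented ::
  "(real \<Rightarrow> ('i \<Rightarrow> real) set) \<Rightarrow> (real \<Rightarrow> ('j \<Rightarrow> real) set) \<Rightarrow> bool" where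
  "complemented P Q \<longleftrightarrow> (\<exists>E R K L. operator P Q K E \<and> operator Q P L R \<and>
     (\<forall>f\<in>whole_space P. R (E f) = f))"

definition isomorphic ::
  "(real \<Rightarrow> ('i \<Rightarrow> real) set) \<Rightarrow> (real \<Rightarrow> ('j \<Rightarrow> real) set) \<Rightarrow> bool" where
  "isomorphic P Q \<longleftrightarrow> (\<exists>T S K L. operator P Q K T \<and> operator Q P L S \<and>
     (\<forall>f\<in>whole_space P. S (T f) = f) \<and> (\<forall>g\<in>whole_space Q. T (S g) = g))"

lemma complemented_trans:
  assumes "complemented P Q" "complemented Q U" shows "complemented P U"
proof -
  from assms(1) obtain E R K L where 1: "operator P Q K E" "operator Q P L R"
    "\<And>f. f \<in> whole_space P \<Longrightarrow> R (E f) = f" unfolding complemented_def by blast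
  from assms(2) obtain E' R' K' L' where 2: "operator Q U K' E'" "operator U Q L' R'"
    "\<And>f. f \<in> whole_space Q \<Longrightarrow> R' (E' f) = f" unfolding complemented_def by blast
  have "R (R' (E' (E f))) = f" if "f \<in> whole_space P" for f
    using that 1 2 operator_whole_space[OF 1(1)] by simp
  then show ?thesis
    using operator_comp[OF 1(1) 2(1)] operator_comp[OF 2(2) 1(2)] unfolding complemented_def by blast
qed

lemma isomorphic_trans:
  assumes "isomorphic P Q" "isomorphic Q U" shows "isomorphic P U"
proof -
  from assms(1) obtain T S K L where 1: "operator P Q K T" "operator Q P L S"
    "\<And>f. f \<in> whole_space P \<Longrightarrow> S (T f) = f" "\<And>f. f \<in> whole_space Q \<Longrightarrow> T (S f) = f"
    unfolding isomorphic_def by blast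
  from assms(2) obtain T' S' K' L' where 2: "operator Q U K' T'" "operator U Q L' S'"
    "\<And>f. f \<in> whole_space Q \<Longrightarrow> S' (T' f) = f" "\<And>f. f \<in> whole_space U \<Longrightarrow> T' (S' f) = f"
    unfolding isomorphic_def by blast
  have "S (S' (T' (T f))) = f" if "f \<in> whole_space P" for f
    using that 1 2 operator_whole_space[OF 1(1)] by simp
  moreover have "T' (T (S (S' f))) = f" if "f \<in> whole_space U" for f
    using that 1 2 operator_whole_space[OF 2(2)] by simp
  ultimately show ?thesis
    using operator_comp[OF 1(1) 2(1)] operator_comp[OF 2(2) 1(2)] unfolding isomorphic_def by blast
qed

lemma isomorphic_sym: "isomorphic P Q \<Longrightarrow> isomorphic Q P"
  unfolding isomorphic_def by blast

section \<open>Countable sup-sums, direct sums and absorption of summands\<close>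

definition sup_sum :: "(real \<Rightarrow> ('i \<Rightarrow> real) set) \<Rightarrow> real \<Rightarrow> (nat \<times> 'i \<Rightarrow> real) set" where
  "sup_sum P r = {f. \<forall>n. (\<lambda>i. f (n, i)) \<in> P r}"

definition direct_sum ::
  "(real \<Rightarrow> ('i \<Rightarrow> real) set) \<Rightarrow> (real \<Rightarrow> ('j \<Rightarrow> real) set) \<Rightarrow> real \<Rightarrow> ('i + 'j \<Rightarrow> real) set" where
  "direct_sum P Q r = {h. (\<lambda>i. h (Inl i)) \<in> P r \<and> (\<lambda>j. h (Inr j)) \<in> Q r}"

lemma ball_family_sup_sum: "ball_family P \<Longrightarrow> ball_family (sup_sum P)"
  by (simp add: ball_family_def sup_sum_def subset_iff)

lemma operator_sup_sum:
  assumes "\<And>n. operator P Q K (T n)"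
  shows "operator P (sup_sum Q) K (\<lambda>f (n, j). T n f j)"
  unfolding operator_def
proof (intro conjI allI impI ballI)
  have "point_functional (\<lambda>f. case k of (n, j) \<Rightarrow> T n f j)" for k
    by (cases k) (use assms in \<open>auto simp: operator_def point_finite_def\<close>)
  then show "point_finite (\<lambda>f (n, j). T n f j)" by (simp add: point_finite_def)
  fix r :: real and f assume "0 \<le> r" "f \<in> P r"
  then have "T n f \<in> Q (K * r)" for n using assms[of n] by (simp add: operator_def)
  then show "(\<lambda>(n, j). T n f j) \<in> sup_sum Q (K * r)" by (simp add: sup_sum_def)
qed (use assms in \<open>auto simp: operator_def\<close>)

lemma operator_component: "operator (sup_sum P) P 1 (\<lambda>f i. f (n, i))"
  by (simp add: operator_def sup_sum_def point_finite_def point_functional_eval)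

lemma operator_case_sum:
  assumes "operator P X K S" "operator P Y K T"
  shows "operator P (direct_sum X Y) K (\<lambda>f. case_sum (S f) (T f))"
proof -
  have "point_functional (\<lambda>f. case_sum (S f) (T f) k)" for k
    using assms by (cases k) (simp_all add: operator_def point_finite_def)
  then show ?thesis using assms by (simp add: operator_def direct_sum_def point_finite_def)
qed

lemma operator_Inl: "operator (direct_sum X Y) X 1 (\<lambda>f i. f (Inl i))"
  and operator_Inr: "operator (direct_sum X Y) Y 1 (\<lambda>f i. f (Inr i))"
  by (simp_all add: operator_def direct_sum_def point_finite_def point_functional_eval)

text \<open>Two sequences of components are interleaved, the left one at the even places and the
  right one at the odd places.\<close>

lemma sup_sum_doubled: "isomorphic (direct_sum (sup_sum P) (sup_sum P)) (sup_sum P)"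
proof -
  let ?T = "\<lambda>f (n, i). if even n then f (Inl (n div 2, i)) else f (Inr (n div 2, i))"
  let ?S = "\<lambda>f. case_sum (\<lambda>(n, i). f (2 * n, i)) (\<lambda>(n, i). f (2 * n + 1, i))"
  have "operator (direct_sum (sup_sum P) (sup_sum P)) P 1
         (\<lambda>f i. if even n then f (Inl (n div 2, i)) else f (Inr (n div 2, i)))" for n
    by (cases "even n")
       (simp_all add: operator_def direct_sum_def sup_sum_def point_finite_def point_functional_eval)
  then have "operator (direct_sum (sup_sum P) (sup_sum P)) (sup_sum P) 1 ?T"
    by (rule operator_sup_sum)
  moreover have "operator (sup_sum P) (direct_sum (sup_sum P) (sup_sum P)) 1 ?S"
    by (intro operator_case_sum operator_sup_sum operator_component)
  moreover have "?S (?T f) = f" for f :: "nat \<times> 'a + nat \<times> 'a \<Rightarrow> real"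
    by (rule ext) (auto split: sum.split)
  moreover have "?T (?S f) = f" for f :: "nat \<times> 'a \<Rightarrow> real"
    by (rule ext) auto
  ultimately show ?thesis unfolding isomorphic_def by blast
qed

text \<open>The Eilenberg swindle: the complement of \<open>X\<close> in each copy of \<open>P\<close> is kept, and the copies
  of \<open>X\<close> are shifted by one to make room for one more.\<close>

lemma sup_sum_absorbs:
  assumes X: "ball_family X" and P: "ball_family P" and c: "complemented X P"
  shows "isomorphic (direct_sum X (sup_sum P)) (sup_sum P)"
proof -
  from c obtain E R K L where E: "operator X P K E" and R: "operator P X L R"
    and RE: "\<And>f. f \<in> whole_space X \<Longrightarrow> R (E f) = f"
    unfolding complemented_def by blast
  have ER: "operator P P (K * L) (\<lambda>z. E (R z))" by (rule operator_comp[OF R E])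
  have pE: "point_finite E" and pR: "point_finite R" using E R by (auto simp: operator_def)
  have RER: "R (E (R z)) = R z" if "z \<in> whole_space P" for z
    using RE operator_whole_space[OF R that] by blast
  note lin = point_finite_add[OF pE] point_finite_add[OF pR] point_finite_diff[OF pE] point_finite_diff[OF pR]
  \<comment> \<open>The projection onto the kernel of \<open>R\<close> along the image of
    \<open>E\<close>. Each copy of \<open>P\<close> is the sum of these two parts, and
    \<open>R\<close> and \<open>co\<close> read them off.\<close>
  define co where "co z = (\<lambda>i. z i - E (R z) i)" for z
  have co: "operator P P (1 + K * L) co"
    unfolding co_def by (rule operator_diff[OF P operator_id ER])
  have Rco: "R (co z) = (\<lambda>_. 0)" if "z \<in> whole_space P" for z
    by (simp add: co_def lin RER[OF that])
  let ?z = "\<lambda>h (n::nat) i. h (Inr (n, i))"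
  define w where "w n h = (case n of 0 \<Rightarrow> \<lambda>i. E (\<lambda>j. h (Inl j)) i + co (?z h 0) i
                             | Suc m \<Rightarrow> \<lambda>i. E (R (?z h m)) i + co (?z h (Suc m)) i)" for n h
  have w0: "w 0 = (\<lambda>h i. E (\<lambda>j. h (Inl j)) i + co (?z h 0) i)"
    and wS: "w (Suc m) = (\<lambda>h i. E (R (?z h m)) i + co (?z h (Suc m)) i)" for m
    by (simp_all add: w_def fun_eq_iff)
  have z: "operator (direct_sum X (sup_sum P)) P 1 (\<lambda>h. ?z h n)" for n
    using operator_comp[OF operator_Inr operator_component] by simp
  have KL: "0 \<le> K" "0 \<le> L" "0 \<le> K * L" using E R by (auto simp: operator_def)
  have w: "operator (direct_sum X (sup_sum P)) P (K + K * L + (1 + K * L)) (w n)" for n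
  proof (cases n)
    case 0
    have 1: "operator (direct_sum X (sup_sum P)) P (K * 1 + (1 + K * L) * 1)
              (\<lambda>h i. E (\<lambda>j. h (Inl j)) i + co (?z h 0) i)"
      by (rule operator_add[OF P operator_comp[OF operator_Inl E] operator_comp[OF z co]])
    show ?thesis unfolding 0 w0 by (rule operator_mono[OF P 1]) (use KL in simp)
  next
    case (Suc m)
    have 1: "operator (direct_sum X (sup_sum P)) P (K * L * 1 + (1 + K * L) * 1)
              (\<lambda>h i. E (R (?z h m)) i + co (?z h (Suc m)) i)"
      by (rule operator_add[OF P operator_comp[OF z ER] operator_comp[OF z co]])
    show ?thesis unfolding Suc wS by (rule operator_mono[OF P 1]) (use KL in simp)
  qed
  let ?T = "\<lambda>h (n, i). w n h i"
  have T: "operator (direct_sum X (sup_sum P)) (sup_sum P) (K + K * L + (1 + K * L)) ?T"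
    by (rule operator_sup_sum) (rule w)
  let ?v = "\<lambda>g (n::nat) i. g (n, i)"
  \<comment> \<open>The inverse shift: component \<open>n\<close> takes its kernel part from copy
    \<open>n\<close> and its image part from copy \<open>n + 1\<close>. The image part of copy 0 is
    left over and becomes the summand \<open>X\<close>.\<close>
  define u where "u g n = (\<lambda>i. co (?v g n) i + E (R (?v g (Suc n))) i)" for g n
  have u: "operator (sup_sum P) P ((1 + K * L) * 1 + K * L * 1) (\<lambda>g. u g n)" for n
    unfolding u_def
    by (rule operator_add[OF P operator_comp[OF operator_component co] operator_comp[OF operator_component ER]])
  let ?S = "\<lambda>g. case_sum (R (?v g 0)) (\<lambda>(n, i). u g n i)"
  have S: "operator (sup_sum P) (direct_sum X (sup_sum P)) (L + ((1 + K * L) * 1 + K * L * 1)) ?S"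
  proof (rule operator_case_sum)
    have "operator (sup_sum P) X (L * 1) (\<lambda>g. R (?v g 0))"
      by (rule operator_comp[OF operator_component R])
    then show "operator (sup_sum P) X (L + ((1 + K * L) * 1 + K * L * 1)) (\<lambda>g. R (?v g 0))"
      by (rule operator_mono[OF X]) (use KL in auto)
    show "operator (sup_sum P) (sup_sum P) (L + ((1 + K * L) * 1 + K * L * 1)) (\<lambda>g (n, i). u g n i)"
      by (rule operator_sup_sum, rule operator_mono[OF P u]) (use KL in auto)
  qed
  have "?S (?T h) = h" if h: "h \<in> whole_space (direct_sum X (sup_sum P))" for h
  proof -
    have zP: "?z h n \<in> whole_space P" for n by (rule operator_whole_space[OF z h])
    have xX: "(\<lambda>j. h (Inl j)) \<in> whole_space X" by (rule operator_whole_space[OF operator_Inl h])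
    have R0: "R (w 0 h) = (\<lambda>j. h (Inl j))" by (simp add: w0 wS lin Rco[OF zP] RE[OF xX])
    have RS: "R (w (Suc m) h) = R (?z h m)" for m
      by (simp add: w0 wS lin Rco[OF zP] RER[OF zP])
    have "u (?T h) n = ?z h n" for n
    proof (cases n)
      case 0
      have "u (?T h) 0 = (\<lambda>i. co (w 0 h) i + E (R (w (Suc 0) h)) i)" by (simp add: u_def)
      also have "\<dots> = ?z h 0" unfolding co_def R0 RS by (simp add: w0 wS co_def)
      finally show ?thesis by (simp add: 0)
    next
      case (Suc m)
      have "u (?T h) (Suc m) = (\<lambda>i. co (w (Suc m) h) i + E (R (w (Suc (Suc m)) h)) i)" by (simp add: u_def)
      also have "\<dots> = ?z h (Suc m)" unfolding co_def RS by (simp add: w0 wS co_def)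
      finally show ?thesis by (simp add: Suc)
    qed
    moreover have "R (\<lambda>i. w 0 h i) = (\<lambda>j. h (Inl j))" using R0 by simp
    ultimately show ?thesis by (intro ext) (auto simp: split_def split: sum.split)
  qed
  moreover have "?T (?S g) = g" if g: "g \<in> whole_space (sup_sum P)" for g
  proof -
    have vP: "?v g n \<in> whole_space P" for n by (rule operator_whole_space[OF operator_component g])
    have Ru: "R (u g n) = R (?v g (Suc n))" for n
      by (simp add: u_def lin Rco[OF vP] RER[OF vP])
    have "w n (?S g) = ?v g n" for n
    proof (cases n)
      case 0
      have "w 0 (?S g) = (\<lambda>i. E (R (?v g 0)) i + co (u g 0) i)" by (simp add: w0 wS)
      also have "\<dots> = ?v g 0" unfolding co_def Ru by (simp add: u_def co_def)
      finally show ?thesis by (simp add: 0)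
    next
      case (Suc m)
      have "w (Suc m) (?S g) = (\<lambda>i. E (R (u g m)) i + co (u g (Suc m)) i)" by (simp add: w0 wS)
      also have "\<dots> = ?v g (Suc m)" unfolding co_def Ru by (simp add: u_def co_def)
      finally show ?thesis by (simp add: Suc)
    qed
    then show ?thesis by (intro ext) auto
  qed
  ultimately show ?thesis using T S unfolding isomorphic_def by blast
qed

text \<open>Write X as Y + Z with Y the kernel of \<open>R\<close>. Then X = Y + Z is isomorphic to
  Y + Z + Z = X + Z. The complement Y is never formed: it is handled as the part y - E (R y) of
  y.\<close>

lemma doubled_summand_absorbed:
  assumes X: "ball_family X" and Z: "ball_family Z"
    and c: "complemented Z X" and d: "isomorphic (direct_sum Z Z) Z"
  shows "isomorphic X (direct_sum X Z)"
proof -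
  from c obtain E R K L where E: "operator Z X K E" and R: "operator X Z L R"
    and RE: "\<And>f. f \<in> whole_space Z \<Longrightarrow> R (E f) = f"
    unfolding complemented_def by blast
  from d obtain p q A B where p: "operator (direct_sum Z Z) Z A p" and q: "operator Z (direct_sum Z Z) B q"
    and qp: "\<And>f. f \<in> whole_space (direct_sum Z Z) \<Longrightarrow> q (p f) = f"
    and pq: "\<And>f. f \<in> whole_space Z \<Longrightarrow> p (q f) = f"
    unfolding isomorphic_def by blast
  have pE: "point_finite E" and pR: "point_finite R" using E R by (auto simp: operator_def)
  note lin = point_finite_add[OF pE] point_finite_add[OF pR] point_finite_diff[OF pE] point_finite_diff[OF pR]
  have pos: "0 \<le> K" "0 \<le> L" "0 \<le> A" "0 \<le> B" using E R p q by (auto simp: operator_def)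
  \<comment> \<open>\<open>l\<close> and \<open>r\<close> are the two halves into which
    \<open>q\<close> splits the Z-part of \<open>y\<close>.\<close>
  define l where "l y = (\<lambda>i. q (R y) (Inl i))" for y
  define r where "r y = (\<lambda>i. q (R y) (Inr i))" for y
  have qR: "operator X (direct_sum Z Z) (B * L) (\<lambda>y. q (R y))" by (rule operator_comp[OF R q])
  have l: "operator X Z (1 * (B * L)) l" and r: "operator X Z (1 * (B * L)) r"
    unfolding l_def r_def by (rule operator_comp[OF qR operator_Inl], rule operator_comp[OF qR operator_Inr])
  have ER: "operator X X (K * L) (\<lambda>x. E (R x))" by (rule operator_comp[OF R E])
  \<comment> \<open>The Z-part of \<open>y\<close> is replaced by its left half; the right half
    leaves as the second summand.\<close>
  define s where "s y = (\<lambda>i. (y i - E (R y) i) + E (l y) i)" for y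
  let ?c = "1 + K * L + K * (1 * (B * L))"
  have s: "operator X X ?c s"
    unfolding s_def
    by (rule operator_add[OF X operator_diff[OF X operator_id ER] operator_comp[OF l E]])
  let ?S = "\<lambda>y. case_sum (s y) (r y)"
  have S: "operator X (direct_sum X Z) (?c + 1 * (B * L)) ?S"
    by (rule operator_case_sum; rule operator_mono) (use X Z s r pos in auto)
  \<comment> \<open>The Z-part of the first summand is paired with the second summand, ready to be
    fused by \<open>p\<close>.\<close>
  define t where "t h = case_sum (R (\<lambda>i. h (Inl i))) (\<lambda>i. h (Inr i))" for h :: "'a + 'b \<Rightarrow> real"
  have t: "operator (direct_sum X Z) (direct_sum Z Z) (L + 1) t"
    unfolding t_def
    by (rule operator_case_sum; rule operator_mono)
       (use Z operator_comp[OF operator_Inl R] operator_Inr pos in auto)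
  define T where "T h = (\<lambda>i. (h (Inl i) - E (R (\<lambda>i. h (Inl i))) i) + E (p (t h)) i)" for h
  have T: "operator (direct_sum X Z) X (1 + K * L * 1 + K * (A * (L + 1))) T"
    unfolding T_def
    by (rule operator_add[OF X operator_diff[OF X operator_Inl operator_comp[OF operator_Inl ER]]
          operator_comp[OF operator_comp[OF t p] E]])
  have "T (?S y) = y" if y: "y \<in> whole_space X" for y
  proof -
    have Rs: "R (s y) = l y"
      using RE[OF operator_whole_space[OF R y]] RE[OF operator_whole_space[OF l y]] by (simp add: s_def lin)
    have "t (?S y) = q (R y)" by (intro ext) (simp add: t_def Rs l_def r_def split: sum.split)
    then have "p (t (?S y)) = R y" using pq[OF operator_whole_space[OF R y]] by simp
    then show ?thesis by (simp add: T_def Rs) (simp add: s_def)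
  qed
  moreover have "?S (T h) = h" if h: "h \<in> whole_space (direct_sum X Z)" for h
  proof -
    have th: "t h \<in> whole_space (direct_sum Z Z)" by (rule operator_whole_space[OF t h])
    have x: "(\<lambda>i. h (Inl i)) \<in> whole_space X" by (rule operator_whole_space[OF operator_Inl h])
    have RT: "R (T h) = p (t h)"
      using RE[OF operator_whole_space[OF R x]] RE[OF operator_whole_space[OF p th]] by (simp add: T_def lin)
    have lr: "l (T h) = R (\<lambda>i. h (Inl i))" "r (T h) = (\<lambda>i. h (Inr i))"
      by (simp_all only: l_def r_def RT qp[OF th]) (simp_all add: t_def)
    have "s (T h) = (\<lambda>i. h (Inl i))"
      unfolding s_def RT lr by (simp add: T_def)
    then show ?thesis by (intro ext) (simp add: lr split: sum.split)
  qed
  ultimately show ?thesis using T S unfolding isomorphic_def by blast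
qed

text \<open>The common middle term is the direct sum of \<open>X\<close> and
  \<open>sup_sum P\<close>. It is \<open>X\<close> because \<open>sup_sum P\<close> is its own
  double, and it is \<open>sup_sum P\<close> by the swindle.\<close>

theorem decomposition_method:
  assumes "ball_family X" "ball_family P" "complemented X P" "complemented (sup_sum P) X"
  shows "isomorphic X (sup_sum P)"
proof -
  have "isomorphic X (direct_sum X (sup_sum P))"
    by (rule doubled_summand_absorbed[OF assms(1) ball_family_sup_sum[OF assms(2)] assms(4) sup_sum_doubled])
  then show ?thesis by (rule isomorphic_trans[OF _ sup_sum_absorbs[OF assms(1-3)]])
qed

section \<open>Operators between spaces of Lipschitz functions\<close>

definition lip_ball :: "'a metric \<Rightarrow> 'a \<Rightarrow> real \<Rightarrow> ('a \<Rightarrow> real) set" where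
  "lip_ball M a r = {f. f a = 0 \<and> (\<forall>x. x \<notin> mspace M \<longrightarrow> f x = 0) \<and>
     (\<forall>x\<in>mspace M. \<forall>y\<in>mspace M. \<bar>f x - f y\<bar> \<le> r * mdist M x y)}"

lemma lip_ballD:
  assumes "f \<in> lip_ball M a r"
  shows "f a = 0" "x \<notin> mspace M \<Longrightarrow> f x = 0"
    "x \<in> mspace M \<Longrightarrow> y \<in> mspace M \<Longrightarrow> \<bar>f x - f y\<bar> \<le> r * mdist M x y"
  using assms by (auto simp: lip_ball_def)

lemma ball_family_lip_ball: "ball_family (lip_ball M a)"
  unfolding ball_family_def
proof (intro conjI allI impI subsetI)
  fix r s :: real and f g assume fg: "f \<in> lip_ball M a r" "g \<in> lip_ball M a s"
  have "\<bar>(f x + g x) - (f y + g y)\<bar> \<le> (r + s) * mdist M x y" if "x \<in> mspace M" "y \<in> mspace M" for x y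
    using lip_ballD(3)[OF fg(1) that] lip_ballD(3)[OF fg(2) that] by (simp add: distrib_right)
  then show "(\<lambda>i. f i + g i) \<in> lip_ball M a (r + s)" using fg by (auto simp: lip_ball_def)
next
  fix c r :: real and f assume f: "f \<in> lip_ball M a r"
  have "\<bar>c * f x - c * f y\<bar> \<le> \<bar>c\<bar> * r * mdist M x y" if "x \<in> mspace M" "y \<in> mspace M" for x y
  proof -
    have "\<bar>c * f x - c * f y\<bar> = \<bar>c\<bar> * \<bar>f x - f y\<bar>" by (simp add: right_diff_distrib[symmetric] abs_mult)
    then show ?thesis using mult_left_mono[OF lip_ballD(3)[OF f that], of "\<bar>c\<bar>"] by (simp add: mult.assoc)
  qed
  then show "(\<lambda>i. c * f i) \<in> lip_ball M a (\<bar>c\<bar> * r)" using f by (auto simp: lip_ball_def)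
next
  fix r s :: real and f assume rs: "r \<le> s" and f: "f \<in> lip_ball M a r"
  have "\<bar>f x - f y\<bar> \<le> s * mdist M x y" if "x \<in> mspace M" "y \<in> mspace M" for x y
    using lip_ballD(3)[OF f that] mult_right_mono[OF rs, of "mdist M x y"] by simp
  then show "f \<in> lip_ball M a s" using f by (auto simp: lip_ball_def)
qed

lemma lip_ball_mono: "0 \<le> r \<Longrightarrow> r \<le> s \<Longrightarrow> f \<in> lip_ball M a r \<Longrightarrow> f \<in> lip_ball M a s"
  using ball_family_lip_ball[of M a] unfolding ball_family_def by blast

lemma lip_ball_scale: "0 \<le> r \<Longrightarrow> f \<in> lip_ball M a r \<Longrightarrow> (\<lambda>x. c * f x) \<in> lip_ball M a (\<bar>c\<bar> * r)"
  using ball_family_lip_ball[of M a] unfolding ball_family_def by blast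

text \<open>One inequality for each pair of points replaces the supremum in \<open>Lip_norm\<close>;
  the underlying space is still \<open>Lip0\<close>.\<close>

lemma whole_space_lip_ball:
  assumes "a \<in> mspace M" shows "whole_space (lip_ball M a) = Lip0 M a"
proof (intro set_eqI iffI)
  fix f assume "f \<in> whole_space (lip_ball M a)"
  then show "f \<in> Lip0 M a"
    by (auto simp: whole_space_def lip_ball_def Lip0_def Lipschitz_continuous_map_def dist_real_def)
next
  fix f assume f: "f \<in> Lip0 M a"
  then obtain B where "B > 0" "\<And>x y. x \<in> mspace M \<Longrightarrow> y \<in> mspace M \<Longrightarrow> \<bar>f x - f y\<bar> \<le> B * mdist M x y"
    by (auto simp: Lip0_def Lipschitz_continuous_map_pos dist_real_def)
  with f have "f \<in> lip_ball M a B" by (auto simp: lip_ball_def Lip0_def)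
  then show "f \<in> whole_space (lip_ball M a)" using \<open>B > 0\<close> by (auto simp: whole_space_def intro!: bexI[of _ B])
qed

lemma lip_ball_subset_Lip0: "a \<in> mspace M \<Longrightarrow> 0 \<le> r \<Longrightarrow> f \<in> lip_ball M a r \<Longrightarrow> f \<in> Lip0 M a"
  by (auto simp: whole_space_lip_ball[symmetric] whole_space_def)

lemma Lip_norm_quotient_le:
  assumes "f \<in> lip_ball M a r" "0 \<le> r" "p \<in> mspace M \<times> mspace M"
  shows "(case p of (x, y) \<Rightarrow> \<bar>f x - f y\<bar> / mdist M x y) \<le> r"
proof -
  obtain x y where p: "p = (x, y)" "x \<in> mspace M" "y \<in> mspace M" using assms(3) by auto
  show ?thesis
  \<comment> \<open>On the diagonal the quotient is 0 by the convention for division by 0, and 0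
    \<le> r finishes this case.\<close>
  proof (cases "mdist M x y = 0")
    case False
    then have "mdist M x y > 0" by (simp add: less_le)
    then show ?thesis using lip_ballD(3)[OF assms(1) p(2,3)] by (simp add: p divide_le_eq)
  qed (use assms p in auto)
qed

lemma Lip_norm_le:
  assumes "a \<in> mspace M" "f \<in> lip_ball M a r" "0 \<le> r" shows "Lip_norm M f \<le> r"
  unfolding Lip_norm_def by (rule cSUP_least) (use assms Lip_norm_quotient_le[OF assms(2,3)] in auto)

lemma in_lip_ball_Lip_norm:
  assumes a: "a \<in> mspace M" and f: "f \<in> Lip0 M a"
  shows "0 \<le> Lip_norm M f" "f \<in> lip_ball M a (Lip_norm M f)"
proof -
  obtain r where r: "0 \<le> r" "f \<in> lip_ball M a r"
    using f by (auto simp: whole_space_lip_ball[OF a, symmetric] whole_space_def)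
  have bdd: "bdd_above ((\<lambda>(x, y). \<bar>f x - f y\<bar> / mdist M x y) ` (mspace M \<times> mspace M))"
    using Lip_norm_quotient_le[OF r(2,1)] by (auto simp: bdd_above_def)
  have le: "\<bar>f x - f y\<bar> / mdist M x y \<le> Lip_norm M f" if "x \<in> mspace M" "y \<in> mspace M" for x y
    unfolding Lip_norm_def using cSUP_upper[OF _ bdd, of "(x, y)"] that by simp
  from le[OF a a] show "0 \<le> Lip_norm M f" by simp
  have "\<bar>f x - f y\<bar> \<le> Lip_norm M f * mdist M x y" if xy: "x \<in> mspace M" "y \<in> mspace M" for x y
  proof (cases "mdist M x y = 0")
    case True
    then show ?thesis using lip_ballD(3)[OF r(2) xy] by simp
  next
    case False
    then have "mdist M x y > 0" by (simp add: less_le)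
    then show ?thesis using le[OF xy] by (simp add: divide_le_eq)
  qed
  then show "f \<in> lip_ball M a (Lip_norm M f)" using r(2) by (simp add: lip_ball_def)
qed

section \<open>Functionals, evaluations and adjoints\<close>

lemma dual_bound:
  assumes "a \<in> mspace M" "\<phi> \<in> Lip0_dual M a"
  obtains B where "B \<ge> 0" "\<And>f r. 0 \<le> r \<Longrightarrow> f \<in> lip_ball M a r \<Longrightarrow> \<bar>\<phi> f\<bar> \<le> B * r"
proof -
  from assms(2) obtain B where B: "\<And>f. f \<in> Lip0 M a \<Longrightarrow> \<bar>\<phi> f\<bar> \<le> B * Lip_norm M f"
    unfolding Lip0_dual_def by blast
  show thesis
  proof
    fix f r assume r: "0 \<le> r" "f \<in> lip_ball M a r"
    have f: "f \<in> Lip0 M a" by (rule lip_ball_subset_Lip0[OF assms(1) r])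
    have "\<bar>\<phi> f\<bar> \<le> B * Lip_norm M f" by (rule B[OF f])
    \<comment> \<open>The constant provided by \<open>Lip0_dual\<close> may be negative if all norms
      are 0, hence the absolute value.\<close>
    also have "\<dots> \<le> \<bar>B\<bar> * Lip_norm M f"
      using in_lip_ball_Lip_norm(1)[OF assms(1) f] by (simp add: mult_right_mono)
    also have "\<dots> \<le> \<bar>B\<bar> * r" using Lip_norm_le[OF assms(1) r(2,1)] by (simp add: mult_left_mono)
    finally show "\<bar>\<phi> f\<bar> \<le> \<bar>B\<bar> * r" .
  qed simp
qed

lemma unit_ball_eq:
  "a \<in> mspace M \<Longrightarrow> {f \<in> Lip0 M a. Lip_norm M f \<le> 1} = lip_ball M a 1"
  using Lip_norm_le[of a M _ 1] in_lip_ball_Lip_norm[of a M] lip_ball_mono[of "Lip_norm M _" 1]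
    lip_ball_subset_Lip0[of a M 1] by fastforce

lemma zero_in_lip_ball: "0 \<le> r \<Longrightarrow> (\<lambda>_. 0) \<in> lip_ball M a r"
  by (simp add: lip_ball_def)

text \<open>By homogeneity, since f / r lies in the unit ball. The division is the reason for r >
  0.\<close>

lemma abs_le_dual_norm:
  assumes a: "a \<in> mspace M" and \<phi>: "\<phi> \<in> Lip0_dual M a" and r: "0 < r" and f: "f \<in> lip_ball M a r"
  shows "\<bar>\<phi> f\<bar> \<le> r * dual_norm M a \<phi>"
proof -
  obtain B where B: "\<And>f r. 0 \<le> r \<Longrightarrow> f \<in> lip_ball M a r \<Longrightarrow> \<bar>\<phi> f\<bar> \<le> B * r"
    using dual_bound[OF a \<phi>] by metis
  have bdd: "bdd_above ((\<lambda>f. \<bar>\<phi> f\<bar>) ` lip_ball M a 1)"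
    using B[of 1] by (auto simp: bdd_above_def)
  have "(\<lambda>i. (1 / r) * f i) \<in> lip_ball M a (\<bar>1 / r\<bar> * r)"
    by (rule lip_ball_scale) (use r f in auto)
  moreover have "\<bar>1 / r\<bar> * r = 1" using r by simp
  ultimately have "(\<lambda>i. (1 / r) * f i) \<in> lip_ball M a 1" by (simp only:)
  then have "\<bar>\<phi> (\<lambda>i. (1 / r) * f i)\<bar> \<le> dual_norm M a \<phi>"
    unfolding dual_norm_def unit_ball_eq[OF a] by (rule cSUP_upper[OF _ bdd])
  moreover have "\<phi> (\<lambda>i. (1 / r) * f i) = (1 / r) * \<phi> f"
    using \<phi> lip_ball_subset_Lip0[OF a _ f] r unfolding Lip0_dual_def by (simp del: times_divide_eq_left)
  ultimately show ?thesis using r by (simp add: abs_mult divide_le_eq mult.commute)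
qed

lemma dual_norm_least:
  assumes "a \<in> mspace M" "\<And>f. f \<in> lip_ball M a 1 \<Longrightarrow> \<bar>\<phi> f\<bar> \<le> B" shows "dual_norm M a \<phi> \<le> B"
  unfolding dual_norm_def unit_ball_eq[OF assms(1)]
  by (rule cSUP_least) (use assms zero_in_lip_ball[of 1 M a] in auto)

lemma evaluation_spanE:
  assumes "\<psi> \<in> evaluation_span M a"
  obtains \<phi> where "point_functional \<phi>" "\<psi> = (\<lambda>f. if f \<in> Lip0 M a then \<phi> f else 0)"
proof -
  obtain A c where A: "finite A" and \<psi>: "\<psi> = (\<lambda>f. \<Sum>x\<in>A. c x * evaluation M a x f)"
    using assms unfolding evaluation_span_def by blast
  show thesis
  proof
    show "point_functional (\<lambda>f. \<Sum>x\<in>A. c x * f x)" using A unfolding point_functional_def by blast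
    show "\<psi> = (\<lambda>f. if f \<in> Lip0 M a then (\<Sum>x\<in>A. c x * f x) else 0)"
      by (rule ext) (simp add: \<psi> evaluation_def)
  qed
qed

text \<open>Point functionals may use points off the carrier. These are dropped, because members of
  \<open>Lip0\<close> vanish there.\<close>

lemma evaluation_spanI:
  assumes "point_functional \<phi>"
  shows "(\<lambda>f. if f \<in> Lip0 M a then \<phi> f else 0) \<in> evaluation_span M a"
proof -
  obtain A c where A: "finite A" and \<phi>: "\<And>f. \<phi> f = (\<Sum>x\<in>A. c x * f x)"
    using assms unfolding point_functional_def by blast
  have "(\<Sum>x\<in>A. c x * f x) = (\<Sum>x\<in>A \<inter> mspace M. c x * f x)" if "f \<in> Lip0 M a" for f
    by (rule sum.mono_neutral_right) (use A that in \<open>auto simp: Lip0_def\<close>)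
  then have "(\<lambda>f. if f \<in> Lip0 M a then \<phi> f else 0) =
      (\<lambda>f. \<Sum>x\<in>A \<inter> mspace M. c x * evaluation M a x f)"
    by (intro ext) (simp add: \<phi> evaluation_def)
  then show ?thesis unfolding evaluation_span_def using A by blast
qed

lemma Lip0_add: "a \<in> mspace M \<Longrightarrow> f \<in> Lip0 M a \<Longrightarrow> g \<in> Lip0 M a \<Longrightarrow> (\<lambda>x. f x + g x) \<in> Lip0 M a"
  and Lip0_scale: "a \<in> mspace M \<Longrightarrow> f \<in> Lip0 M a \<Longrightarrow> (\<lambda>x. c * f x) \<in> Lip0 M a"
proof -
  assume a: "a \<in> mspace M" and "f \<in> Lip0 M a"
  note W = whole_space_lip_ball[OF a, symmetric] whole_space_def
  from \<open>f \<in> _\<close> obtain r where r: "0 \<le> r" "f \<in> lip_ball M a r" by (auto simp: W)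
  show "(\<lambda>x. c * f x) \<in> Lip0 M a"
    using ball_family_lip_ball[of M a] r unfolding ball_family_def
    by (intro lip_ball_subset_Lip0[OF a, of "\<bar>c\<bar> * r"]) auto
  assume "g \<in> Lip0 M a"
  then obtain s where s: "0 \<le> s" "g \<in> lip_ball M a s" by (auto simp: W)
  show "(\<lambda>x. f x + g x) \<in> Lip0 M a"
    using ball_family_lip_ball[of M a] r s unfolding ball_family_def
    by (intro lip_ball_subset_Lip0[OF a, of "r + s"]) auto
qed

lemma Lip0_dual_diff:
  assumes "\<phi> \<in> Lip0_dual M a" "\<psi> \<in> Lip0_dual M a"
  shows "(\<lambda>f. \<phi> f - \<psi> f) \<in> Lip0_dual M a"
proof -
  obtain B where B: "\<And>f. f \<in> Lip0 M a \<Longrightarrow> \<bar>\<phi> f\<bar> \<le> B * Lip_norm M f"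
    using assms(1) unfolding Lip0_dual_def by blast
  obtain C where C: "\<And>f. f \<in> Lip0 M a \<Longrightarrow> \<bar>\<psi> f\<bar> \<le> C * Lip_norm M f"
    using assms(2) unfolding Lip0_dual_def by blast
  have "\<bar>\<phi> f - \<psi> f\<bar> \<le> (B + C) * Lip_norm M f" if "f \<in> Lip0 M a" for f
    using B[OF that] C[OF that] by (simp add: distrib_right)
  then show ?thesis using assms unfolding Lip0_dual_def
    by (auto simp: right_diff_distrib)
qed

lemma evaluation_in_dual:
  assumes a: "a \<in> mspace M" and x: "x \<in> mspace M" shows "evaluation M a x \<in> Lip0_dual M a"
proof -
  have "\<bar>evaluation M a x f\<bar> \<le> mdist M x a * Lip_norm M f" if f: "f \<in> Lip0 M a" for f
    using lip_ballD(1,3)[OF in_lip_ball_Lip_norm(2)[OF a f]] x a f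
    by (metis diff_zero evaluation_def mult.commute)
  then show ?thesis using Lip0_add[OF a] Lip0_scale[OF a]
    by (auto simp: Lip0_dual_def evaluation_def)
qed

lemma evaluation_span_subset_dual:
  assumes a: "a \<in> mspace M" shows "evaluation_span M a \<subseteq> Lip0_dual M a"
proof
  fix \<psi> assume "\<psi> \<in> evaluation_span M a"
  then obtain A c where A: "finite A" "A \<subseteq> mspace M" and \<psi>: "\<psi> = (\<lambda>f. \<Sum>x\<in>A. c x * evaluation M a x f)"
    unfolding evaluation_span_def by blast
  have e: "evaluation M a x \<in> Lip0_dual M a" if "x \<in> A" for x using evaluation_in_dual[OF a] A that by blast
  have "\<exists>B. \<forall>x\<in>A. \<forall>f \<in> Lip0 M a. \<bar>evaluation M a x f\<bar> \<le> B x * Lip_norm M f"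
    using e unfolding Lip0_dual_def by (intro bchoice) blast
  then obtain B where B: "\<And>x f. x \<in> A \<Longrightarrow> f \<in> Lip0 M a \<Longrightarrow> \<bar>evaluation M a x f\<bar> \<le> B x * Lip_norm M f"
    by blast
  have "\<bar>\<psi> f\<bar> \<le> (\<Sum>x\<in>A. \<bar>c x\<bar> * B x) * Lip_norm M f" if f: "f \<in> Lip0 M a" for f
  proof -
    have "\<bar>\<psi> f\<bar> \<le> (\<Sum>x\<in>A. \<bar>c x * evaluation M a x f\<bar>)" unfolding \<psi> by (rule sum_abs)
    also have "\<dots> \<le> (\<Sum>x\<in>A. \<bar>c x\<bar> * (B x * Lip_norm M f))"
      by (rule sum_mono) (simp add: abs_mult mult_left_mono B[OF _ f])
    finally show ?thesis by (simp add: sum_distrib_right mult.assoc)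
  qed
  then show "\<psi> \<in> Lip0_dual M a"
    unfolding Lip0_dual_def
  proof (intro CollectI conjI allI ballI impI)
    show "\<exists>B. \<forall>f\<in>Lip0 M a. \<bar>\<psi> f\<bar> \<le> B * Lip_norm M f"
      using \<open>\<And>f. f \<in> Lip0 M a \<Longrightarrow> \<bar>\<psi> f\<bar> \<le> _ * Lip_norm M f\<close> by blast
  qed (use Lip0_add[OF a] Lip0_scale[OF a] in
      \<open>simp_all add: \<psi> evaluation_def distrib_left sum.distrib sum_distrib_left mult.left_commute\<close>)
qed

text \<open>The adjoint of \<open>S\<close>, cut off to 0 outside \<open>Lip0 N b\<close> because
  elements of \<open>Lip0_dual\<close> vanish there. An operator from functions on N to functions on
  M gives a map from the free space of M to that of N.\<close>

definition dual_operator ::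
  "'b metric \<Rightarrow> 'b \<Rightarrow> (('b \<Rightarrow> real) \<Rightarrow> 'a \<Rightarrow> real) \<Rightarrow> (('a \<Rightarrow> real) \<Rightarrow> real) \<Rightarrow> ('b \<Rightarrow> real) \<Rightarrow> real" where
  "dual_operator N b S \<phi> = (\<lambda>g. if g \<in> Lip0 N b then \<phi> (S g) else 0)"

lemma dual_operator_bounds:
  assumes a: "a \<in> mspace M" and b: "b \<in> mspace N"
    and S: "operator (lip_ball N b) (lip_ball M a) K S"
    and \<phi>: "\<phi> \<in> Lip0_dual M a"
  shows "dual_operator N b S \<phi> \<in> Lip0_dual N b"
    and "dual_norm N b (dual_operator N b S \<phi>) \<le> (K + 1) * dual_norm M a \<phi>"
proof -
  have K: "0 \<le> K" and pS: "point_finite S" using S by (auto simp: operator_def)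
  have SL: "S g \<in> Lip0 M a" if "g \<in> Lip0 N b" for g
    using operator_whole_space[OF S] that by (simp add: whole_space_lip_ball a b)
  obtain B where B: "B \<ge> 0" "\<And>f r. 0 \<le> r \<Longrightarrow> f \<in> lip_ball M a r \<Longrightarrow> \<bar>\<phi> f\<bar> \<le> B * r"
    using dual_bound[OF a \<phi>] by metis
  have "\<bar>dual_operator N b S \<phi> g\<bar> \<le> (B * K) * Lip_norm N g" if g: "g \<in> Lip0 N b" for g
  proof -
    note n = in_lip_ball_Lip_norm[OF b g]
    have "S g \<in> lip_ball M a (K * Lip_norm N g)" using S n by (simp add: operator_def)
    from B(2)[OF _ this] show ?thesis using K n g by (simp add: dual_operator_def mult.assoc)
  qed
  then show "dual_operator N b S \<phi> \<in> Lip0_dual N b"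
    using \<phi> SL Lip0_add[OF b] Lip0_scale[OF b]
    unfolding Lip0_dual_def
    by (auto simp: dual_operator_def point_finite_add[OF pS] point_finite_scale[OF pS])
  show "dual_norm N b (dual_operator N b S \<phi>) \<le> (K + 1) * dual_norm M a \<phi>"
  proof (rule dual_norm_least[OF b])
    fix g assume g: "g \<in> lip_ball N b 1"
    have "S g \<in> lip_ball M a (K * 1)" using S g unfolding operator_def by (metis zero_le_one)
    \<comment> \<open>K may be 0, while \<open>abs_le_dual_norm\<close> asks for a positive
      radius.\<close>
    then have "S g \<in> lip_ball M a (K + 1)" using K by (auto intro: lip_ball_mono[of K])
    from abs_le_dual_norm[OF a \<phi> _ this] K lip_ball_subset_Lip0[OF b _ g]
    show "\<bar>dual_operator N b S \<phi> g\<bar> \<le> (K + 1) * dual_norm M a \<phi>" by (simp add: dual_operator_def)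
  qed
qed

text \<open>Here point-finiteness pays off: the adjoint sends finite combinations of evaluations to
  such combinations, and continuity carries this over to their norm closure. An approximation up to
  e / (K + 1) becomes one up to e.\<close>

lemma dual_operator_free_space:
  assumes a: "a \<in> mspace M" and b: "b \<in> mspace N"
    and S: "operator (lip_ball N b) (lip_ball M a) K S"
    and \<phi>: "\<phi> \<in> free_space M a"
  shows "dual_operator N b S \<phi> \<in> free_space N b"
  unfolding free_space_def
proof (intro CollectI conjI allI impI)
  have \<phi>D: "\<phi> \<in> Lip0_dual M a" using \<phi> by (simp add: free_space_def)
  then show "dual_operator N b S \<phi> \<in> Lip0_dual N b" by (rule dual_operator_bounds[OF a b S])
  have K: "0 \<le> K" and pS: "point_finite S" using S by (auto simp: operator_def)
  have SL: "S g \<in> Lip0 M a" if "g \<in> Lip0 N b" for g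
    using operator_whole_space[OF S] that by (simp add: whole_space_lip_ball a b)
  fix e :: real assume "0 < e"
  then have "0 < e / (K + 1)" using K by simp
  then obtain \<psi> where \<psi>: "\<psi> \<in> evaluation_span M a" "dual_norm M a (\<lambda>f. \<phi> f - \<psi> f) < e / (K + 1)"
    using \<phi> unfolding free_space_def by blast
  have \<psi>D: "\<psi> \<in> Lip0_dual M a" using \<psi> evaluation_span_subset_dual[OF a] by blast
  have "(\<lambda>g. dual_operator N b S \<phi> g - dual_operator N b S \<psi> g) = dual_operator N b S (\<lambda>f. \<phi> f - \<psi> f)"
    by (auto simp: dual_operator_def)
  then have "dual_norm N b (\<lambda>g. dual_operator N b S \<phi> g - dual_operator N b S \<psi> g) \<le> (K + 1) * dual_norm M a (\<lambda>f. \<phi> f - \<psi> f)"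
    using dual_operator_bounds(2)[OF a b S Lip0_dual_diff[OF \<phi>D \<psi>D]] by simp
  also have "\<dots> < e" using \<psi>(2) K by (simp add: pos_less_divide_eq mult.commute)
  finally have 1: "dual_norm N b (\<lambda>g. dual_operator N b S \<phi> g - dual_operator N b S \<psi> g) < e" .
  from \<psi>(1) obtain \<Psi> where \<Psi>: "point_functional \<Psi>" "\<psi> = (\<lambda>f. if f \<in> Lip0 M a then \<Psi> f else 0)"
    by (rule evaluation_spanE)
  have "dual_operator N b S \<psi> = (\<lambda>g. if g \<in> Lip0 N b then \<Psi> (S g) else 0)"
    using SL by (auto simp: dual_operator_def \<Psi>)
  then have "dual_operator N b S \<psi> \<in> evaluation_span N b"
    using evaluation_spanI[OF point_functional_comp[OF \<Psi>(1) pS]] by simp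
  with 1 show "\<exists>\<psi>\<in>evaluation_span N b. dual_norm N b (\<lambda>g. dual_operator N b S \<phi> g - \<psi> g) < e" by blast
qed

text \<open>Adjoints reverse the order of composition, so a left inverse of \<open>T\<close> on
  functions yields a right inverse of its adjoint. Arguments outside \<open>Lip0\<close> agree
  because both sides vanish there.\<close>

lemma dual_operator_inverse:
  assumes a: "a \<in> mspace M" and b: "b \<in> mspace N"
    and S: "operator (lip_ball N b) (lip_ball M a) K S"
    and T: "operator (lip_ball M a) (lip_ball N b) L T"
    and ST: "\<And>f. f \<in> whole_space (lip_ball M a) \<Longrightarrow> S (T f) = f"
    and \<phi>: "\<phi> \<in> free_space M a"
  shows "dual_operator M a T (dual_operator N b S \<phi>) = \<phi>"
proof
  fix f
  show "dual_operator M a T (dual_operator N b S \<phi>) f = \<phi> f"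
  proof (cases "f \<in> Lip0 M a")
    case True
    then have "T f \<in> Lip0 N b" using operator_whole_space[OF T] by (simp add: whole_space_lip_ball a b)
    then show ?thesis using True ST by (simp add: dual_operator_def whole_space_lip_ball a)
  next
    case False
    then show ?thesis using \<phi> by (simp add: dual_operator_def free_space_def Lip0_dual_def)
  qed
qed

lemma free_isomorphic_if_isomorphic:
  assumes a: "a \<in> mspace M" and b: "b \<in> mspace N"
    and iso: "isomorphic (lip_ball M a) (lip_ball N b)"
  shows "free_isomorphic M a N b"
proof -
  from iso obtain T S K L where T: "operator (lip_ball M a) (lip_ball N b) K T"
    and S: "operator (lip_ball N b) (lip_ball M a) L S"
    and ST: "\<And>f. f \<in> whole_space (lip_ball M a) \<Longrightarrow> S (T f) = f"
    and TS: "\<And>g. g \<in> whole_space (lip_ball N b) \<Longrightarrow> T (S g) = g"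
    unfolding isomorphic_def by blast
  let ?A = "dual_operator N b S" and ?B = "dual_operator M a T"
  note BA = dual_operator_inverse[OF a b S T ST] and AB = dual_operator_inverse[OF b a T S TS]
  have D: "\<phi> \<in> Lip0_dual M a" if "\<phi> \<in> free_space M a" for \<phi> using that by (simp add: free_space_def)
  have "bij_betw ?A (free_space M a) (free_space N b)"
    by (rule bij_betw_byWitness[of _ ?B])
       (use BA AB dual_operator_free_space[OF a b S] dual_operator_free_space[OF b a T] in auto)
  moreover have "dual_norm N b (?A \<phi>) \<le> (L + 1) * dual_norm M a \<phi>" if "\<phi> \<in> free_space M a" for \<phi>
    using dual_operator_bounds(2)[OF a b S D[OF that]] .
  moreover have "dual_norm M a \<phi> \<le> (K + 1) * dual_norm N b (?A \<phi>)" if "\<phi> \<in> free_space M a" for \<phi>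
    using dual_operator_bounds(2)[OF b a T dual_operator_bounds(1)[OF a b S D[OF that]]] BA[OF _ that] by simp
  moreover have "?A (\<lambda>i. u i + v i) = (\<lambda>j. ?A u j + ?A v j)" "?A (\<lambda>i. c * v i) = (\<lambda>j. c * ?A v j)" for u v c
    by (auto simp: dual_operator_def)
  ultimately show ?thesis unfolding free_isomorphic_def linearly_isomorphic_def
    by (intro exI[of _ ?A]) blast
qed

text \<open>Subtracting \<open>f (h b)\<close> restores the value 0 at the base point, so
  \<open>h\<close> may move base points. The Lipschitz constant is not affected, and the output
  still uses only two values of \<open>f\<close>.\<close>

lemma operator_composition:
  assumes b: "b \<in> mspace N" and C: "0 \<le> C"
    and h: "\<And>x. x \<in> mspace N \<Longrightarrow> h x \<in> mspace M"
      "\<And>x y. x \<in> mspace N \<Longrightarrow> y \<in> mspace N \<Longrightarrow> mdist M (h x) (h y) \<le> C * mdist N x y"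
  shows "operator (lip_ball M a) (lip_ball N b) C (\<lambda>f x. if x \<in> mspace N then f (h x) - f (h b) else 0)"
    (is "operator _ _ _ ?T")
  unfolding operator_def
proof (intro conjI allI impI ballI C)
  have "point_functional (\<lambda>f. ?T f x)" for x
    by (cases "x \<in> mspace N")
       (simp_all add: point_functional_zero point_functional_diff[OF point_functional_eval point_functional_eval])
  then show "point_finite ?T" unfolding point_finite_def by blast
  fix r :: real and f assume r: "0 \<le> r" and f: "f \<in> lip_ball M a r"
  have "\<bar>?T f x - ?T f y\<bar> \<le> C * r * mdist N x y" if xy: "x \<in> mspace N" "y \<in> mspace N" for x y
  proof -
    have "\<bar>?T f x - ?T f y\<bar> \<le> r * mdist M (h x) (h y)" using lip_ballD(3)[OF f h(1)[OF xy(1)] h(1)[OF xy(2)]] xy by simp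
    also have "\<dots> \<le> r * (C * mdist N x y)" by (rule mult_left_mono[OF h(2)[OF xy] r])
    finally show ?thesis by (simp add: ac_simps)
  qed
  then show "?T f \<in> lip_ball N b (C * r)" using b by (auto simp: lip_ball_def)
qed

text \<open>Composition with \<open>q\<close> embeds and composition with \<open>j\<close> projects.
  The two base point corrections cancel up to f a, which is 0.\<close>

lemma complemented_if_Lipschitz_section:
  assumes a: "a \<in> mspace M" and b: "b \<in> mspace N"
    and j: "Lipschitz_continuous_map M N j" and q: "Lipschitz_continuous_map N M q"
    and qj: "\<And>x. x \<in> mspace M \<Longrightarrow> q (j x) = x"
  shows "complemented (lip_ball M a) (lip_ball N b)"
proof -
  have jM: "j x \<in> mspace N" if "x \<in> mspace M" for x using Lipschitz_continuous_map_image[OF j] that by blast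
  have qN: "q x \<in> mspace M" if "x \<in> mspace N" for x using Lipschitz_continuous_map_image[OF q] that by blast
  obtain C where C: "0 < C" "\<And>x y. x \<in> mspace M \<Longrightarrow> y \<in> mspace M \<Longrightarrow> mdist N (j x) (j y) \<le> C * mdist M x y"
    using j by (auto simp: Lipschitz_continuous_map_pos)
  obtain D where D: "0 < D" "\<And>x y. x \<in> mspace N \<Longrightarrow> y \<in> mspace N \<Longrightarrow> mdist M (q x) (q y) \<le> D * mdist N x y"
    using q by (auto simp: Lipschitz_continuous_map_pos)
  let ?E = "\<lambda>f x. if x \<in> mspace N then f (q x) - f (q b) else 0"
  let ?R = "\<lambda>g x. if x \<in> mspace M then g (j x) - g (j a) else 0"
  have E: "operator (lip_ball M a) (lip_ball N b) D ?E"
    by (rule operator_composition[OF b]) (use D qN in auto)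
  have R: "operator (lip_ball N b) (lip_ball M a) C ?R"
    by (rule operator_composition[OF a]) (use C jM in auto)
  have "?R (?E f) = f" if f: "f \<in> whole_space (lip_ball M a)" for f
  proof -
    have "f a = 0" "\<And>x. x \<notin> mspace M \<Longrightarrow> f x = 0" using f by (auto simp: whole_space_def lip_ball_def)
    then show ?thesis using jM a qj by (intro ext) auto
  qed
  then show ?thesis using E R unfolding complemented_def by blast
qed

section \<open>The unit ball of \<open>c\<^sub>0\<close>\<close>

lemma c0_dist_upper:
  "x \<in> mspace c0 \<Longrightarrow> y \<in> mspace c0 \<Longrightarrow> \<bar>x n - y n\<bar> \<le> mdist c0 x y"
  using linf_dist_upper[of x UNIV y n] by (simp add: c0_def)

lemma c0_dist_least:
  "x \<in> mspace c0 \<Longrightarrow> y \<in> mspace c0 \<Longrightarrow> (\<And>n. \<bar>x n - y n\<bar> \<le> r) \<Longrightarrow> mdist c0 x y \<le> r"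
  using linf_dist_least[of UNIV x y r] by (simp add: c0_def)

lemma zero_in_c0: "(\<lambda>_. 0) \<in> mspace c0"
  by (simp add: mspace_c0)

lemma mspace_c0_unit_ball: "mspace c0_unit_ball = {x. x \<longlonglongrightarrow> 0 \<and> (\<forall>n. \<bar>x n\<bar> \<le> 1)}"
proof -
  interpret c0: Metric_space "mspace c0" "mdist c0" by simp
  have "mdist c0 (\<lambda>_. 0) x \<le> 1 \<longleftrightarrow> (\<forall>n. \<bar>x n\<bar> \<le> 1)" if "x \<in> mspace c0" for x
    using c0_dist_upper[OF zero_in_c0 that] c0_dist_least[OF zero_in_c0 that, of 1] by (fastforce intro: order_trans)
  moreover have "x \<in> mspace c0_unit_ball \<longleftrightarrow> x \<in> mspace c0 \<and> mdist c0 (\<lambda>_. 0) x \<le> 1" for x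
    by (auto simp: c0_unit_ball_def mcball_of_def c0.in_mcball zero_in_c0)
  ultimately show ?thesis by (auto simp: mspace_c0)
qed

lemma mdist_c0_unit_ball: "mdist c0_unit_ball = mdist c0"
  by (simp add: c0_unit_ball_def)

lemma c0_unit_ball_subset: "x \<in> mspace c0_unit_ball \<Longrightarrow> x \<in> mspace c0"
  by (simp add: c0_unit_ball_def)

lemma zero_in_c0_unit_ball: "(\<lambda>_. 0) \<in> mspace c0_unit_ball"
  by (simp add: mspace_c0_unit_ball)

definition clip :: "real \<Rightarrow> real \<Rightarrow> real" where
  "clip g t = max (- g) (min g t)"

text \<open>Truncation is nonexpansive jointly in level and argument. This permits a level that
  varies with the point, which is how \<open>magnify\<close> is faded out to 0 at a controlled
  rate.\<close>

lemma clip_diff: "0 \<le> g \<Longrightarrow> 0 \<le> h \<Longrightarrow> \<bar>clip g t - clip h s\<bar> \<le> max \<bar>g - h\<bar> \<bar>t - s\<bar>"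
  by (auto simp: clip_def max_def min_def abs_if)

lemma abs_clip_le: "0 \<le> g \<Longrightarrow> \<bar>clip g t\<bar> \<le> g" "0 \<le> g \<Longrightarrow> \<bar>clip g t\<bar> \<le> \<bar>t\<bar>"
  by (auto simp: clip_def)

lemma clip_eq: "\<bar>t\<bar> \<le> g \<Longrightarrow> clip g t = t"
  by (auto simp: clip_def)

lemma clip_in_c0_unit_ball:
  assumes "x \<longlonglongrightarrow> 0" "0 \<le> g" "g \<le> 1" shows "(\<lambda>i. clip g (x i)) \<in> mspace c0_unit_ball"
proof -
  have "(\<lambda>i. clip g (x i)) \<longlonglongrightarrow> 0"
    by (rule tendsto_0_le[OF assms(1), of _ 1]) (use abs_clip_le(2)[OF assms(2)] in auto)
  then show ?thesis using abs_clip_le(1)[OF assms(2)] assms(3)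
    by (auto simp: mspace_c0_unit_ball intro: order_trans)
qed

section \<open>Disjoint small balls in the unit ball of \<open>c0\<close>\<close>

lemma locally_finite_sum_Lipschitz:
  fixes G :: "'n \<Rightarrow> 'a \<Rightarrow> real"
  assumes N: "\<And>z. z \<in> {x, y} \<Longrightarrow> finite (N z) \<and> card (N z) \<le> m"
    and G0: "\<And>z n. z \<in> {x, y} \<Longrightarrow> n \<notin> N z \<Longrightarrow> G n z = 0"
    and GL: "\<And>n. \<bar>G n x - G n y\<bar> \<le> L"
  shows "\<bar>(\<Sum>n\<in>N x. G n x) - (\<Sum>n\<in>N y. G n y)\<bar> \<le> 2 * real m * L"
proof -
  \<comment> \<open>Only the at most 2 m indices active at \<open>x\<close> or at \<open>y\<close>
    contribute, and each contributes at most \<open>L\<close>.\<close>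
  let ?U = "N x \<union> N y"
  have L: "0 \<le> L" using GL[of undefined] by linarith
  have "(\<Sum>n\<in>N x. G n x) = (\<Sum>n\<in>?U. G n x)" "(\<Sum>n\<in>N y. G n y) = (\<Sum>n\<in>?U. G n y)"
    by (rule sum.mono_neutral_left; use N G0 in auto)+
  then have "\<bar>(\<Sum>n\<in>N x. G n x) - (\<Sum>n\<in>N y. G n y)\<bar> \<le> (\<Sum>n\<in>?U. \<bar>G n x - G n y\<bar>)"
    by (simp add: sum_subtractf[symmetric] sum_abs)
  also have "\<dots> \<le> real (card ?U) * L" using sum_bounded_above[of ?U "\<lambda>n. \<bar>G n x - G n y\<bar>" L] GL by simp
  also have "\<dots> \<le> (2 * real m) * L"
  proof (rule mult_right_mono[OF _ L])
    have "card ?U \<le> card (N x) + card (N y)" by (rule card_Un_le)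
    also have "\<dots> \<le> m + m" using N by (intro add_mono) auto
    finally show "real (card ?U) \<le> 2 * real m" by simp
  qed
  finally show ?thesis .
qed

text \<open>The height 3/4 leaves room on all sides: radius 1/8 stays inside the unit ball, balls of
  radius 1/4 around different centers are disjoint, and none of them contains the base point
  0.\<close>

definition shrunk_ball_center :: "nat \<Rightarrow> nat \<Rightarrow> real" where
  "shrunk_ball_center n = (\<lambda>i. if i = n then 3 / 4 else 0)"

text \<open>The ball of radius \<open>1 / 8\<close> around the center is magnified onto the unit ball. The ball of
  twice that radius contains all points that are not mapped to \<open>0\<close>.\<close>

definition magnify :: "nat \<Rightarrow> (nat \<Rightarrow> real) \<Rightarrow> nat \<Rightarrow> real" where
  "magnify n x = (\<lambda>i. clip (max 0 (min 1 (2 - 8 * mdist c0 x (shrunk_ball_center n))))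
                           (8 * (x i - shrunk_ball_center n i)))"

definition shrink :: "nat \<Rightarrow> (nat \<Rightarrow> real) \<Rightarrow> nat \<Rightarrow> real" where
  "shrink n u = (\<lambda>i. shrunk_ball_center n i + u i / 8)"

lemma shrunk_ball_center_in_c0: "shrunk_ball_center n \<in> mspace c0"
proof -
  have "shrunk_ball_center n \<longlonglongrightarrow> 0"
    by (rule tendsto_eventually) (auto simp: shrunk_ball_center_def eventually_sequentially intro!: exI[of _ "Suc n"])
  then show ?thesis by (simp add: mspace_c0)
qed

lemma magnify_in_c0_unit_ball: "x \<in> mspace c0 \<Longrightarrow> magnify n x \<in> mspace c0_unit_ball"
  unfolding magnify_def using shrunk_ball_center_in_c0[of n]
  by (intro clip_in_c0_unit_ball) (auto simp: mspace_c0 intro!: tendsto_eq_intros)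

lemma magnify_Lipschitz:
  assumes x: "x \<in> mspace c0" and y: "y \<in> mspace c0"
  shows "mdist c0 (magnify n x) (magnify n y) \<le> 8 * mdist c0 x y"
proof (rule c0_dist_least)
  interpret c0: Metric_space "mspace c0" "mdist c0" by simp
  let ?c = "shrunk_ball_center n"
  let ?g = "\<lambda>x. max 0 (min 1 (2 - 8 * mdist c0 x ?c))"
  note c = shrunk_ball_center_in_c0[of n]
  have "\<bar>mdist c0 x ?c - mdist c0 y ?c\<bar> \<le> mdist c0 x y"
    using c0.triangle[OF x y c] c0.triangle[OF y x c] c0.commute[of x y] by linarith
  moreover have "\<bar>max 0 (min 1 (2 - 8 * a)) - max 0 (min 1 (2 - 8 * b))\<bar> \<le> 8 * \<bar>a - b\<bar>" for a b :: real
    by (auto simp: max_def min_def abs_if split: if_splits)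
  ultimately have g: "\<bar>?g x - ?g y\<bar> \<le> 8 * mdist c0 x y" by (meson mult_left_mono order_trans zero_le_numeral)
  fix i
  have m: "\<bar>magnify n x i - magnify n y i\<bar> \<le> max \<bar>?g x - ?g y\<bar> \<bar>8 * (x i - ?c i) - 8 * (y i - ?c i)\<bar>"
    unfolding magnify_def by (rule clip_diff) auto
  have "8 * (x i - ?c i) - 8 * (y i - ?c i) = 8 * (x i - y i)" by (simp add: right_diff_distrib)
  then have "\<bar>8 * (x i - ?c i) - 8 * (y i - ?c i)\<bar> \<le> 8 * mdist c0 x y"
    using c0_dist_upper[OF x y, of i] by (simp only: abs_mult) simp
  with g have "max \<bar>?g x - ?g y\<bar> \<bar>8 * (x i - ?c i) - 8 * (y i - ?c i)\<bar> \<le> 8 * mdist c0 x y"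
    by (rule max.boundedI)
  with m show "\<bar>magnify n x i - magnify n y i\<bar> \<le> 8 * mdist c0 x y" by (rule order_trans)
qed (use magnify_in_c0_unit_ball c0_unit_ball_subset assms in blast)+

lemma magnify_far: "1 / 4 \<le> mdist c0 x (shrunk_ball_center n) \<Longrightarrow> magnify n x = (\<lambda>_. 0)"
  by (simp add: magnify_def clip_def)

text \<open>Up to distance 1/8 from the center the clipping level is 1. There \<open>magnify\<close>
  is the affine inverse of \<open>shrink\<close>.\<close>

lemma magnify_near:
  assumes u: "u \<in> mspace c0_unit_ball"
  shows "shrink n u \<in> mspace c0_unit_ball" "mdist c0 (shrink n u) (shrunk_ball_center n) \<le> 1 / 8"
    "magnify n (shrink n u) = u"
proof -
  let ?x = "shrink n u"
  have u0: "u \<longlonglongrightarrow> 0" and u1: "\<And>i. \<bar>u i\<bar> \<le> 1" using u by (auto simp: mspace_c0_unit_ball)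
  have "?x \<longlonglongrightarrow> 0"
    unfolding shrink_def using shrunk_ball_center_in_c0[of n] u0 by (auto simp: mspace_c0 intro!: tendsto_eq_intros)
  moreover have "\<bar>?x i\<bar> \<le> 1" for i using u1[of i] by (auto simp: shrink_def shrunk_ball_center_def)
  ultimately show x: "?x \<in> mspace c0_unit_ball" by (simp add: mspace_c0_unit_ball)
  show d: "mdist c0 ?x (shrunk_ball_center n) \<le> 1 / 8"
    by (rule c0_dist_least[OF c0_unit_ball_subset[OF x] shrunk_ball_center_in_c0])
       (use u1 in \<open>simp add: shrink_def\<close>)
  have "max 0 (min 1 (2 - 8 * mdist c0 ?x (shrunk_ball_center n))) = 1" using d by simp
  then show "magnify n ?x = u"
    unfolding magnify_def by (simp add: shrink_def clip_eq u1)
qed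

text \<open>Coordinate \<open>n\<close> decides: closeness to center \<open>n\<close> makes x n
  larger than 1/2, closeness to center \<open>m\<close> makes it smaller than 1/4.\<close>

lemma shrunk_balls_disjoint:
  assumes x: "x \<in> mspace c0"
    and "mdist c0 x (shrunk_ball_center n) < 1 / 4" "mdist c0 x (shrunk_ball_center m) < 1 / 4"
  shows "n = m"
proof (rule ccontr)
  assume "n \<noteq> m"
  then show False
    using c0_dist_upper[OF x shrunk_ball_center_in_c0, of n n] c0_dist_upper[OF x shrunk_ball_center_in_c0, of n m] assms(2,3)
    by (simp add: shrunk_ball_center_def)
qed

abbreviation lip_c0_unit_ball :: "real \<Rightarrow> ((nat \<Rightarrow> real) \<Rightarrow> real) set" where
  "lip_c0_unit_ball \<equiv> lip_ball c0_unit_ball (\<lambda>_. 0)"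

text \<open>\<open>E\<close> places component \<open>n\<close> on the n-th small ball and lets it
  fade to 0 nearby; \<open>R\<close> reads a function on each of the small balls.\<close>

lemma sup_sum_complemented_in_lip_c0_unit_ball: "complemented (sup_sum lip_c0_unit_ball) lip_c0_unit_ball"
proof -
  let ?B = "mspace c0_unit_ball" and ?c = shrunk_ball_center
  define N where "N x = {n. mdist c0 x (?c n) < 1 / 4}" for x
  have N: "finite (N x) \<and> card (N x) \<le> 1" if "x \<in> ?B" for x
  proof -
    have "n = m" if "n \<in> N x" "m \<in> N x" for n m
      using that shrunk_balls_disjoint[OF c0_unit_ball_subset[OF \<open>x \<in> ?B\<close>]] by (simp add: N_def)
    then have "\<exists>n. N x \<subseteq> {n}" by blast
    then obtain n where "N x \<subseteq> {n}" by blast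
    then show ?thesis using card_mono[of "{n}" "N x"] finite_subset by fastforce
  qed
  \<comment> \<open>No ball reaches the base point, so \<open>E f\<close> vanishes there.\<close>
  have N0: "N (\<lambda>_. 0) = {}"
  proof -
    have "3 / 4 \<le> mdist c0 (\<lambda>_. 0) (?c n)" for n
      using c0_dist_upper[OF zero_in_c0 shrunk_ball_center_in_c0, of n n] by (simp add: shrunk_ball_center_def)
    then have "1 / 4 \<le> mdist c0 (\<lambda>_. 0) (?c n)" for n by (rule order_trans[rotated]) simp
    then show ?thesis by (auto simp: N_def not_less)
  qed
  define E where "E f x = (if x \<in> ?B then \<Sum>n\<in>N x. f (n, magnify n x) else 0)"
    for f :: "nat \<times> (nat \<Rightarrow> real) \<Rightarrow> real" and x
  \<comment> \<open>16 = 2 * 1 * 8: at most one active ball at each of two points, and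
    \<open>magnify\<close> is 8-Lipschitz.\<close>
  have E: "operator (sup_sum lip_c0_unit_ball) lip_c0_unit_ball 16 E"
    unfolding operator_def
  proof (intro conjI allI impI ballI)
    have "point_functional (\<lambda>f. E f x)" for x
      using N by (cases "x \<in> ?B")
        (auto simp: E_def point_functional_zero intro!: point_functional_sum point_functional_eval)
    then show "point_finite E" by (simp add: point_finite_def)
    fix r :: real and f assume r: "0 \<le> r" and "f \<in> sup_sum lip_c0_unit_ball r"
    then have f: "(\<lambda>u. f (n, u)) \<in> lip_c0_unit_ball r" for n by (simp add: sup_sum_def)
    have "\<bar>E f x - E f y\<bar> \<le> 16 * r * mdist c0_unit_ball x y" if xy: "x \<in> ?B" "y \<in> ?B" for x y
    proof -
      have "\<bar>(\<Sum>n\<in>N x. f (n, magnify n x)) - (\<Sum>n\<in>N y. f (n, magnify n y))\<bar> \<le> 2 * real 1 * (r * (8 * mdist c0 x y))"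
      proof (rule locally_finite_sum_Lipschitz[where G = "\<lambda>n x. f (n, magnify n x)"])
        fix z n assume "z \<in> {x, y}" "n \<notin> N z"
        then show "f (n, magnify n z) = 0"
          using magnify_far[of z n] lip_ballD(1)[OF f] by (simp add: N_def)
      next
        fix n
        have "\<bar>f (n, magnify n x) - f (n, magnify n y)\<bar> \<le> r * mdist c0 (magnify n x) (magnify n y)"
          using lip_ballD(3)[OF f] magnify_in_c0_unit_ball c0_unit_ball_subset xy by (simp add: mdist_c0_unit_ball)
        also have "\<dots> \<le> r * (8 * mdist c0 x y)"
          by (rule mult_left_mono[OF magnify_Lipschitz r]) (use c0_unit_ball_subset xy in auto)
        finally show "\<bar>f (n, magnify n x) - f (n, magnify n y)\<bar> \<le> r * (8 * mdist c0 x y)" .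
      qed (use N xy in auto)
      then show ?thesis using xy by (simp add: E_def mdist_c0_unit_ball mult.assoc)
    qed
    then show "E f \<in> lip_c0_unit_ball (16 * r)"
      using N0 by (simp add: lip_ball_def) (simp add: E_def)
  qed simp
  \<comment> \<open>\<open>shrink n\<close> maps 0 to the center of the n-th ball. The value there
    is subtracted to normalize; on the image of \<open>E\<close> it is already 0.\<close>
  define R where "R n g u = (if u \<in> ?B then g (shrink n u) - g (shrink n (\<lambda>_. 0)) else 0)"
    for n and g :: "(nat \<Rightarrow> real) \<Rightarrow> real" and u
  note h = magnify_near
  have "operator lip_c0_unit_ball lip_c0_unit_ball 1 (R n)" for n
    unfolding R_def
  proof (rule operator_composition[OF zero_in_c0_unit_ball])
    fix u v assume uv: "u \<in> ?B" "v \<in> ?B"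
    have "mdist c0 (shrink n u) (shrink n v) \<le> mdist c0 u v"
    proof (rule c0_dist_least)
      fix i show "\<bar>shrink n u i - shrink n v i\<bar> \<le> mdist c0 u v"
        using c0_dist_upper[of u v i] uv c0_unit_ball_subset by (fastforce simp: shrink_def)
    qed (use h(1) uv c0_unit_ball_subset in auto)
    then show "mdist c0_unit_ball (shrink n u) (shrink n v) \<le> 1 * mdist c0_unit_ball u v"
      by (simp add: mdist_c0_unit_ball)
  qed (use h(1) in auto)
  then have R: "operator lip_c0_unit_ball (sup_sum lip_c0_unit_ball) 1 (\<lambda>g (n, u). R n g u)"
    by (rule operator_sup_sum)
  have "(\<lambda>(n, u). R n (E f) u) = f" if "f \<in> whole_space (sup_sum lip_c0_unit_ball)" for f
  proof -
    from that obtain r where f: "\<And>n. (\<lambda>u. f (n, u)) \<in> lip_c0_unit_ball r"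
      by (auto simp: whole_space_def sup_sum_def)
    have Eh: "E f (shrink n u) = f (n, u)" if u: "u \<in> ?B" for n u
    proof -
      have "n \<in> N (shrink n u)" using h(2)[OF u, of n] by (simp add: N_def)
      then have "N (shrink n u) = {n}"
        using shrunk_balls_disjoint[OF c0_unit_ball_subset[OF h(1)[OF u]]] by (auto simp: N_def)
      then show ?thesis using h(1,3)[OF u] by (simp add: E_def)
    qed
    have "R n (E f) u = f (n, u)" for n u
      using lip_ballD(1,2)[OF f[of n]] zero_in_c0_unit_ball by (simp add: R_def Eh)
    then show ?thesis by auto
  qed
  then show ?thesis using E R unfolding complemented_def by blast
qed

section \<open>A dyadic partition of unity on the half-line\<close>

definition cutoff :: "nat \<Rightarrow> real \<Rightarrow> real" where
  "cutoff k t = max 0 (min 1 (2 - t / 2 ^ k))"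

text \<open>Telescoping differences, whose partial sums are the cutoffs. Weight 0 keeps the entire
  first cutoff, so that the inner ball around 0 is covered as well.\<close>

definition annulus_weight :: "nat \<Rightarrow> real \<Rightarrow> real" where
  "annulus_weight k t = cutoff k t - (case k of 0 \<Rightarrow> 0 | Suc l \<Rightarrow> cutoff l t)"

lemma cutoff_Lipschitz: "\<bar>cutoff k s - cutoff k t\<bar> \<le> \<bar>s - t\<bar> / 2 ^ k"
proof -
  have "\<bar>cutoff k s - cutoff k t\<bar> \<le> \<bar>s / 2 ^ k - t / 2 ^ k\<bar>" by (auto simp: cutoff_def)
  then show ?thesis by (simp add: diff_divide_distrib[symmetric])
qed

text \<open>3 = 1 + 2: the previous cutoff is twice as steep as the current one.\<close>

lemma annulus_weight_Lipschitz: "\<bar>annulus_weight k s - annulus_weight k t\<bar> \<le> 3 * (\<bar>s - t\<bar> / 2 ^ k)"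
proof (cases k)
  case 0
  then show ?thesis using cutoff_Lipschitz[of 0 s t] by (simp add: annulus_weight_def) argo
next
  case (Suc l)
  have "2 * (\<bar>s - t\<bar> / 2 ^ k) = \<bar>s - t\<bar> / 2 ^ l" by (simp add: Suc)
  then show ?thesis using cutoff_Lipschitz[of k s t] cutoff_Lipschitz[of l s t] by (simp add: annulus_weight_def Suc)
qed

lemma abs_annulus_weight_le: "\<bar>annulus_weight k t\<bar> \<le> 1"
  by (auto simp: annulus_weight_def cutoff_def split: nat.split)

lemma cutoff_eq_1: "t \<le> 2 ^ k \<Longrightarrow> cutoff k t = 1"
  by (simp add: cutoff_def divide_le_eq)

lemma cutoff_eq_0: "2 ^ Suc k \<le> t \<Longrightarrow> cutoff k t = 0"
proof -
  assume "2 ^ Suc k \<le> t"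
  then have "2 \<le> t / 2 ^ k" by (simp add: le_divide_eq)
  then show ?thesis by (simp add: cutoff_def)
qed

lemma annulus_weight_nonzero:
  assumes "annulus_weight k t \<noteq> 0"
  shows "t < 2 ^ Suc k" "k = Suc l \<Longrightarrow> 2 ^ l < t"
proof -
  show "t < 2 ^ Suc k"
  proof (rule ccontr)
    assume t: "\<not> t < 2 ^ Suc k"
    have "cutoff l t = 0" if "k = Suc l" for l
    proof (rule cutoff_eq_0)
      have "(2::real) ^ Suc l \<le> 2 ^ Suc k" using that by (intro power_increasing) auto
      then show "2 ^ Suc l \<le> t" using t by linarith
    qed
    then show False using assms t cutoff_eq_0[of k t] by (auto simp: annulus_weight_def split: nat.splits)
  qed
  assume k: "k = Suc l"
  show "2 ^ l < t"
  proof (rule ccontr)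
    assume t: "\<not> 2 ^ l < t"
    have "(2::real) ^ l \<le> 2 ^ k" unfolding k by (intro power_increasing) auto
    then have "cutoff k t = 1" "cutoff l t = 1" using t by (auto intro!: cutoff_eq_1 simp: not_less intro: order_trans simp del: power_increasing_iff)
    then show False using assms by (simp add: annulus_weight_def k)
  qed
qed

text \<open>If \<open>m\<close> is the first active index then t < 2^(m+1), while an active l + 1
  requires 2^l < t. Hence only \<open>m\<close> and \<open>m + 1\<close> can be active.\<close>

lemma annulus_weight_support: "finite {k. annulus_weight k t \<noteq> 0} \<and> card {k. annulus_weight k t \<noteq> 0} \<le> 2"
proof (cases "{k. annulus_weight k t \<noteq> 0} = {}")
  case False
  define m where "m = (LEAST k. annulus_weight k t \<noteq> 0)"
  have m: "annulus_weight m t \<noteq> 0" unfolding m_def by (rule LeastI_ex) (use False in blast)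
  have "k \<in> {m, Suc m}" if k: "annulus_weight k t \<noteq> 0" for k
  proof -
    have "m \<le> k" unfolding m_def using k by (rule Least_le)
    moreover have "k \<le> Suc m"
    proof (cases k)
      case (Suc l)
      have "(2::real) ^ l < 2 ^ Suc m"
        using annulus_weight_nonzero(1)[OF m] annulus_weight_nonzero(2)[OF k Suc] by linarith
      then show ?thesis using Suc by (simp del: power_Suc)
    qed simp
    ultimately show ?thesis by auto
  qed
  then have *: "{k. annulus_weight k t \<noteq> 0} \<subseteq> {m, Suc m}" by blast
  show ?thesis using finite_subset[OF *] card_mono[OF _ *] by auto
qed (simp only: card.empty, simp)

text \<open>Beyond an \<open>n\<close> with t \<le> 2^n no weight is active, and the partial sum up
  to \<open>n\<close> is the n-th cutoff, which is 1 at \<open>t\<close>.\<close>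

lemma sum_annulus_weight: "(\<Sum>k\<in>{k. annulus_weight k t \<noteq> 0}. annulus_weight k t) = 1"
proof -
  obtain n where n: "t \<le> 2 ^ n" using real_arch_pow[of 2 t] less_imp_le by auto
  have "(\<Sum>k\<le>m. annulus_weight k t) = cutoff m t" for m
    by (induction m) (auto simp: annulus_weight_def)
  then have "(\<Sum>k\<le>n. annulus_weight k t) = 1" by (simp add: cutoff_eq_1 n)
  moreover have "(\<Sum>k\<in>{k. annulus_weight k t \<noteq> 0}. annulus_weight k t) = (\<Sum>k\<le>n. annulus_weight k t)"
  proof (rule sum.mono_neutral_left)
    have "k \<le> n" if k: "annulus_weight k t \<noteq> 0" for k
    proof (cases k)
      case (Suc l)
      have "(2::real) ^ l < 2 ^ n" using annulus_weight_nonzero(2)[OF k Suc] n by linarith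
      then show ?thesis using Suc by simp
    qed simp
    then show "{k. annulus_weight k t \<noteq> 0} \<subseteq> {..n}" by auto
  qed auto
  ultimately show ?thesis by simp
qed

text \<open>Component \<open>k\<close> records f on the ball of radius 2^(k+1), rescaled to the unit
  ball in a way that preserves Lipschitz constants. The partition of unity glues the records
  together again.\<close>

lemma lip_c0_complemented_in_sup_sum: "complemented (lip_ball c0 (\<lambda>_. 0)) (sup_sum lip_c0_unit_ball)"
proof -
  interpret c0: Metric_space "mspace c0" "mdist c0" by simp
  let ?B = "mspace c0_unit_ball"
  have scaled: "(\<lambda>i. s * u i) \<in> mspace c0" if "u \<in> mspace c0" for s u
    using that tendsto_mult_right_zero[of u sequentially s] by (simp add: mspace_c0)
  define E where "E k f u = (if u \<in> ?B then 1 / 2 ^ Suc k * f (\<lambda>i. 2 ^ Suc k * u i) else 0)"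
    for k and f :: "(nat \<Rightarrow> real) \<Rightarrow> real" and u
  have "operator (lip_ball c0 (\<lambda>_. 0)) lip_c0_unit_ball 1 (E k)" for k
    unfolding operator_def
  proof (intro conjI allI impI ballI)
    have "point_functional (\<lambda>f. E k f u)" for u
      by (cases "u \<in> ?B")
         (simp_all only: E_def if_True if_False point_functional_zero point_functional_scale[OF point_functional_eval])
    then show "point_finite (E k)" by (simp add: point_finite_def)
    fix r :: real and f assume r: "0 \<le> r" and f: "f \<in> lip_ball c0 (\<lambda>_. 0) r"
    have "\<bar>E k f u - E k f v\<bar> \<le> r * mdist c0 u v" if uv: "u \<in> ?B" "v \<in> ?B" for u v
    proof -
      let ?u = "\<lambda>i. 2 ^ Suc k * u i" and ?v = "\<lambda>i. 2 ^ Suc k * v i"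
      note uvc = c0_unit_ball_subset[OF uv(1)] c0_unit_ball_subset[OF uv(2)]
      have "mdist c0 ?u ?v \<le> 2 ^ Suc k * mdist c0 u v"
      proof (rule c0_dist_least)
        fix i
        have "\<bar>?u i - ?v i\<bar> = 2 ^ Suc k * \<bar>u i - v i\<bar>" by (simp add: right_diff_distrib[symmetric] abs_mult)
        then show "\<bar>?u i - ?v i\<bar> \<le> 2 ^ Suc k * mdist c0 u v"
          using c0_dist_upper[OF uvc, of i] by simp
      qed (use scaled uvc in blast)+
      then have "\<bar>f ?u - f ?v\<bar> \<le> r * (2 ^ Suc k * mdist c0 u v)"
        using lip_ballD(3)[OF f scaled[OF uvc(1)] scaled[OF uvc(2)], of "2 ^ Suc k" "2 ^ Suc k"] r
        by (meson mult_left_mono order_trans)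
      then have "1 / 2 ^ Suc k * \<bar>f ?u - f ?v\<bar> \<le> 1 / 2 ^ Suc k * (r * (2 ^ Suc k * mdist c0 u v))"
        by (intro mult_left_mono) auto
      moreover have "\<bar>E k f u - E k f v\<bar> = 1 / 2 ^ Suc k * \<bar>f ?u - f ?v\<bar>"
        using uv by (simp only: E_def if_True right_diff_distrib[symmetric] abs_mult) simp
      ultimately show ?thesis by simp
    qed
    moreover have "E k f (\<lambda>_. 0) = 0" using lip_ballD(1)[OF f] by (simp add: E_def)
    ultimately show "E k f \<in> lip_c0_unit_ball (1 * r)"
      by (simp add: lip_ball_def mdist_c0_unit_ball) (simp add: E_def)
  qed simp
  then have E: "operator (lip_ball c0 (\<lambda>_. 0)) (sup_sum lip_c0_unit_ball) 1 (\<lambda>f (k, u). E k f u)"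
    by (rule operator_sup_sum)
  define nrm where "nrm x = mdist c0 x (\<lambda>_. 0)" for x
  define N where "N x = {k. annulus_weight k (nrm x) \<noteq> 0}" for x
  \<comment> \<open>Clipping makes the rescaled point lie in the unit ball for every
    \<open>x\<close>. Where weight \<open>k\<close> is nonzero, the norm of \<open>x\<close> is
    below 2^(k+1) and clipping does nothing.\<close>
  define t where "t k x = (\<lambda>i. clip 1 (1 / 2 ^ Suc k * x i))" for k and x :: "nat \<Rightarrow> real"
  have tB: "t k x \<in> ?B" if "x \<in> mspace c0" for k x
    unfolding t_def by (rule clip_in_c0_unit_ball) (use scaled[OF that, of "1 / 2 ^ Suc k"] in \<open>simp_all add: mspace_c0\<close>)
  have tL: "mdist c0 (t k x) (t k y) \<le> 1 / 2 ^ Suc k * mdist c0 x y" if xy: "x \<in> mspace c0" "y \<in> mspace c0" for k x y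
  proof (rule c0_dist_least)
    fix i
    have "\<bar>t k x i - t k y i\<bar> \<le> \<bar>1 / 2 ^ Suc k * x i - 1 / 2 ^ Suc k * y i\<bar>"
      using clip_diff[of 1 1 "1 / 2 ^ Suc k * x i" "1 / 2 ^ Suc k * y i"] by (simp only: t_def) simp
    also have "\<dots> = 1 / 2 ^ Suc k * \<bar>x i - y i\<bar>" by (simp only: right_diff_distrib[symmetric] abs_mult) simp
    also have "\<dots> \<le> 1 / 2 ^ Suc k * mdist c0 x y" using c0_dist_upper[OF xy, of i] by (intro mult_left_mono) auto
    finally show "\<bar>t k x i - t k y i\<bar> \<le> 1 / 2 ^ Suc k * mdist c0 x y" .
  qed (use tB xy c0_unit_ball_subset in blast)+
  define F where "F g k x = annulus_weight k (nrm x) * (2 ^ Suc k * g (k, t k x))"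
    for g :: "nat \<times> (nat \<Rightarrow> real) \<Rightarrow> real" and k x
  define R where "R g x = (if x \<in> mspace c0 then \<Sum>k\<in>N x. F g k x else 0)" for g x
  have N: "finite (N x) \<and> card (N x) \<le> 2" for x unfolding N_def by (rule annulus_weight_support)
  \<comment> \<open>28 = 2 * 2 * 7: at most two active indices at each of two points, with each
    summand 7 r-Lipschitz.\<close>
  have R: "operator (sup_sum lip_c0_unit_ball) (lip_ball c0 (\<lambda>_. 0)) 28 R"
    unfolding operator_def
  proof (intro conjI allI impI ballI)
    have "point_functional (\<lambda>f. R f x)" for x
      using N by (cases "x \<in> mspace c0")
        (auto simp: R_def F_def point_functional_zero simp del: power_Suc
          intro!: point_functional_sum point_functional_scale point_functional_eval)
    then show "point_finite R" by (simp add: point_finite_def)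
    fix r :: real and g assume r: "0 \<le> r" and "g \<in> sup_sum lip_c0_unit_ball r"
    then have g: "(\<lambda>u. g (k, u)) \<in> lip_c0_unit_ball r" for k by (simp add: sup_sum_def)
    \<comment> \<open>The slope 3 / 2^k of the weight meets functions of size at most 2^(k+1) r,
      giving 6 r for every \<open>k\<close>. The slope of the function itself adds r. That large
      annuli have flat weights is what makes the bound uniform.\<close>
    have FL: "\<bar>F g k x - F g k y\<bar> \<le> 7 * r * mdist c0 x y" if xy: "x \<in> mspace c0" "y \<in> mspace c0" for k x y
    proof -
      let ?w = "\<lambda>x. annulus_weight k (nrm x)" and ?G = "\<lambda>x. 2 ^ Suc k * g (k, t k x)"
      note txy = tB[OF xy(1), of k] tB[OF xy(2), of k]
      have "\<bar>g (k, t k x)\<bar> \<le> r * mdist c0 (t k x) (\<lambda>_. 0)"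
        using lip_ballD(1)[OF g] lip_ballD(3)[OF g txy(1) zero_in_c0_unit_ball, of k] by (simp add: mdist_c0_unit_ball)
      also have "\<dots> \<le> r * 1"
        by (rule mult_left_mono[OF c0_dist_least r])
           (use txy zero_in_c0 c0_unit_ball_subset in \<open>auto simp: mspace_c0_unit_ball\<close>)
      finally have G: "\<bar>?G x\<bar> \<le> 2 ^ Suc k * r" by (simp add: abs_mult)
      have "\<bar>g (k, t k x) - g (k, t k y)\<bar> \<le> r * (1 / 2 ^ Suc k * mdist c0 x y)"
        using lip_ballD(3)[OF g txy, of k] mult_left_mono[OF tL[OF xy, of k] r] by (simp add: mdist_c0_unit_ball)
      then have "2 ^ Suc k * \<bar>g (k, t k x) - g (k, t k y)\<bar> \<le> 2 ^ Suc k * (r * (1 / 2 ^ Suc k * mdist c0 x y))"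
        by (intro mult_left_mono) auto
      moreover have "\<bar>?G x - ?G y\<bar> = 2 ^ Suc k * \<bar>g (k, t k x) - g (k, t k y)\<bar>"
        by (simp only: right_diff_distrib[symmetric] abs_mult) simp
      ultimately have GL: "\<bar>?G x - ?G y\<bar> \<le> r * mdist c0 x y" by simp
      have "\<bar>nrm x - nrm y\<bar> \<le> mdist c0 x y"
        using c0.triangle[OF xy zero_in_c0] c0.triangle[OF xy(2,1) zero_in_c0] c0.commute[of x y]
        by (simp add: nrm_def)
      then have "3 * (\<bar>nrm x - nrm y\<bar> / 2 ^ k) \<le> 3 * (mdist c0 x y / 2 ^ k)"
        by (intro mult_left_mono divide_right_mono) auto
      then have wL: "\<bar>?w x - ?w y\<bar> \<le> 3 * (mdist c0 x y / 2 ^ k)"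
        using annulus_weight_Lipschitz[of k "nrm x" "nrm y"] by linarith
      have "?w x * ?G x - ?w y * ?G y = (?w x - ?w y) * ?G x + ?w y * (?G x - ?G y)" by (simp add: algebra_simps)
      then have "\<bar>F g k x - F g k y\<bar> \<le> \<bar>?w x - ?w y\<bar> * \<bar>?G x\<bar> + \<bar>?w y\<bar> * \<bar>?G x - ?G y\<bar>"
        unfolding F_def by (metis abs_mult abs_triangle_ineq)
      also have "\<dots> \<le> (3 * (mdist c0 x y / 2 ^ k)) * (2 ^ Suc k * r) + 1 * (r * mdist c0 x y)"
        by (intro add_mono mult_mono wL G GL abs_annulus_weight_le) auto
      also have "\<dots> = 7 * r * mdist c0 x y" by simp
      finally show ?thesis .
    qed
    have "\<bar>R g x - R g y\<bar> \<le> 28 * r * mdist c0 x y" if xy: "x \<in> mspace c0" "y \<in> mspace c0" for x y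
    proof -
      have "\<bar>(\<Sum>k\<in>N x. F g k x) - (\<Sum>k\<in>N y. F g k y)\<bar> \<le> 2 * real 2 * (7 * r * mdist c0 x y)"
        by (rule locally_finite_sum_Lipschitz[where G = "F g"]) (use N FL[OF xy] in \<open>auto simp: N_def F_def\<close>)
      then show ?thesis using xy by (simp add: R_def)
    qed
    moreover have "F g k (\<lambda>_. 0) = 0" for k
      using lip_ballD(1)[OF g] by (simp add: F_def t_def clip_def)
    ultimately show "R g \<in> lip_ball c0 (\<lambda>_. 0) (28 * r)"
      by (simp add: lip_ball_def) (simp add: R_def)
  qed simp
  have "R (\<lambda>(k, u). E k f u) = f" if "f \<in> whole_space (lip_ball c0 (\<lambda>_. 0))" for f
  proof
    fix x
    show "R (\<lambda>(k, u). E k f u) x = f x"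
    proof (cases "x \<in> mspace c0")
      case True
      have "F (\<lambda>(k, u). E k f u) k x = annulus_weight k (nrm x) * f x" if "k \<in> N x" for k
      proof -
        have "nrm x < 2 ^ Suc k" using that annulus_weight_nonzero(1) by (simp add: N_def)
        then have "\<bar>x i\<bar> \<le> 2 ^ Suc k" for i
          using c0_dist_upper[OF True zero_in_c0, of i] by (simp add: nrm_def)
        then have "\<bar>1 / 2 ^ Suc k * x i\<bar> \<le> 1" for i
          by (simp only: abs_mult) (simp add: divide_le_eq)
        then have "t k x = (\<lambda>i. 1 / 2 ^ Suc k * x i)" by (simp only: t_def clip_eq)
        moreover have "(\<lambda>i. 2 ^ Suc k * (1 / 2 ^ Suc k * x i)) = x" by simp
        ultimately show ?thesis using tB[OF True, of k] unfolding F_def E_def by (simp del: power_Suc)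
      qed
      then have "(\<Sum>k\<in>N x. F (\<lambda>(k, u). E k f u) k x) = (\<Sum>k\<in>N x. annulus_weight k (nrm x)) * f x"
        by (simp add: sum_distrib_right)
      then show ?thesis using True sum_annulus_weight[of "nrm x"] by (simp add: R_def N_def)
    next
      case False
      then show ?thesis using that by (auto simp: R_def whole_space_def lip_ball_def)
    qed
  qed
  then show ?thesis using E R unfolding complemented_def by blast
qed

section \<open>Absolute Lipschitz retracts and Aharoni's embedding\<close>

lemma Min_image_diff_le:
  fixes f g :: "'i \<Rightarrow> real"
  assumes "finite A" "A \<noteq> {}" "\<And>i. i \<in> A \<Longrightarrow> \<bar>f i - g i\<bar> \<le> L"
  shows "\<bar>Min (f ` A) - Min (g ` A)\<bar> \<le> L"
proof -
  have half: "Min (f ` A) \<le> Min (g ` A) + L" if "\<And>i. i \<in> A \<Longrightarrow> \<bar>f i - g i\<bar> \<le> L" for f g :: "'i \<Rightarrow> real"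
  proof -
    have "Min (g ` A) \<in> g ` A" using assms(1,2) by (intro Min_in) auto
    then obtain i where i: "i \<in> A" "Min (g ` A) = g i" by auto
    have "Min (f ` A) \<le> f i" using assms(1) i by (intro Min_le) auto
    then show ?thesis using that[OF i(1)] i(2) by linarith
  qed
  show ?thesis using half[of f g] half[of g f] assms(3) by (simp add: abs_minus_commute abs_le_iff)
qed

text \<open>At scale \<open>s\<close> the functions \<open>coord a s n\<close> with \<open>n \<ge> 1\<close> have supports of diameter at most
  \<open>6 s\<close>. The gap between the thresholds \<open>s\<close> and \<open>2 s\<close> makes them point-finite and at the same
  time uniformly large: the first \<open>n\<close> with \<open>d (x, a n) < 2 s\<close> has \<open>coord a s n x \<ge> s\<close>, and
  \<open>d (x, a m) < s\<close> annihilates all \<open>n > m\<close>.\<close>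

definition coord :: "'a metric \<Rightarrow> (nat \<Rightarrow> 'a) \<Rightarrow> real \<Rightarrow> nat \<Rightarrow> 'a \<Rightarrow> real" where
  "coord M a s n x = max 0 (Min ((\<lambda>m. if m = n then 3 * s - mdist M x (a n) else mdist M x (a m) - s) ` {..n}))"

lemma coord_Lipschitz:
  assumes a: "\<And>n. a n \<in> mspace M" and xy: "x \<in> mspace M" "y \<in> mspace M"
  shows "\<bar>coord M a s n x - coord M a s n y\<bar> \<le> mdist M x y"
proof -
  interpret M: Metric_space "mspace M" "mdist M" by simp
  have d: "\<bar>mdist M x (a m) - mdist M y (a m)\<bar> \<le> mdist M x y" for m
    using M.triangle[OF xy a] M.triangle[OF xy(2,1) a] M.commute[of x y] by (simp add: abs_le_iff) (metis add.commute diff_le_eq)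
  let ?f = "\<lambda>x m. if m = n then 3 * s - mdist M x (a n) else mdist M x (a m) - s"
  have "\<bar>?f x m - ?f y m\<bar> \<le> mdist M x y" for m
    using d[of m] by (cases "m = n") auto
  then have "\<bar>Min (?f x ` {..n}) - Min (?f y ` {..n})\<bar> \<le> mdist M x y"
    by (intro Min_image_diff_le) auto
  then show ?thesis unfolding coord_def by linarith
qed

lemma coord_pos:
  assumes "0 < coord M a s n x"
  shows "mdist M x (a n) < 3 * s" "coord M a s n x \<le> 3 * s - mdist M x (a n)"
    "m < n \<Longrightarrow> s < mdist M x (a m)"
proof -
  let ?f = "\<lambda>m. if m = n then 3 * s - mdist M x (a n) else mdist M x (a m) - s"
  have c: "coord M a s n x = Min (?f ` {..n})" using assms by (simp add: coord_def)
  have le: "coord M a s n x \<le> ?f m" if "m \<le> n" for m unfolding c using that by (intro Min_le) auto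
  show "coord M a s n x \<le> 3 * s - mdist M x (a n)" using le[of n] by simp
  then show "mdist M x (a n) < 3 * s" using assms by linarith
  show "s < mdist M x (a m)" if "m < n" using le[of m] assms that by simp
qed

lemma coord_large:
  assumes "mdist M x (a n) < 2 * s" "\<And>m. m < n \<Longrightarrow> 2 * s \<le> mdist M x (a m)"
  shows "s \<le> coord M a s n x"
proof -
  have "s \<le> Min ((\<lambda>m. if m = n then 3 * s - mdist M x (a n) else mdist M x (a m) - s) ` {..n})"
    using assms by (force intro!: Min.boundedI)
  then show ?thesis unfolding coord_def by (rule order_trans[OF _ max.cobounded2])
qed

lemma LIMSEQ_zero_if_finite:
  fixes x :: "nat \<Rightarrow> real"
  assumes "\<And>e. 0 < e \<Longrightarrow> finite {n. e \<le> \<bar>x n\<bar>}" shows "x \<longlonglongrightarrow> 0"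
proof (rule LIMSEQ_I)
  fix e :: real assume "0 < e"
  then obtain N where "\<forall>n\<in>{n. e \<le> \<bar>x n\<bar>}. n < N"
    using assms finite_nat_set_iff_bounded by blast
  then show "\<exists>N. \<forall>n\<ge>N. norm (x n - 0) < e"
    by (intro exI[of _ N]) (metis diff_zero linorder_not_le mem_Collect_eq real_norm_def)
qed

text \<open>The functions \<open>coord\<close> at all dyadic scales are used as coordinates. Each is
  1-Lipschitz, which gives the upper bound; a scale comparable to the distance of two points gives
  the lower bound. The delicate point is that the values form a null sequence.\<close>

theorem Aharoni_embedding:
  assumes sep: "separable_space (mtopology_of M)" and p: "p \<in> mspace M"
  obtains j where "\<And>x. x \<in> mspace M \<Longrightarrow> j x \<in> mspace c0"
    and "\<And>x y. x \<in> mspace M \<Longrightarrow> y \<in> mspace M \<Longrightarrow> mdist c0 (j x) (j y) \<le> mdist M x y"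
    and "\<And>x y. x \<in> mspace M \<Longrightarrow> y \<in> mspace M \<Longrightarrow> mdist M x y \<le> 14 * mdist c0 (j x) (j y)"
proof -
  interpret M: Metric_space "mspace M" "mdist M" by simp
  from sep obtain C where C: "countable C" "C \<subseteq> mspace M" "M.mtopology closure_of C = mspace M"
    unfolding separable_space_def by (auto simp: mtopology_of_def)
  have dense: "\<exists>c\<in>C. mdist M x c < e" if "x \<in> mspace M" "0 < e" for x e
  proof -
    have "x \<in> M.mtopology closure_of C" using that C by simp
    then show ?thesis using that by (force simp: M.metric_closure_of)
  qed
  have Cne: "C \<noteq> {}" using dense[OF p, of 1] by auto
  \<comment> \<open>Index 0 is reserved for \<open>p\<close> and gets no coordinate. Every
    coordinate thus carries the condition s < d (x, p), which kills all scales that are large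
    compared with d (x, p).\<close>
  define a where "a n = (case n of 0 \<Rightarrow> p | Suc m \<Rightarrow> from_nat_into C m)" for n
  have a: "a n \<in> mspace M" for n
    using p C(2) from_nat_into[OF Cne] by (auto simp: a_def split: nat.split)
  have near: "\<exists>n. mdist M x (a n) < e" if "x \<in> mspace M" "0 < e" for x e
  proof -
    from dense[OF that] obtain c where c: "c \<in> C" "mdist M x c < e" by blast
    obtain m where "from_nat_into C m = c" using from_nat_into_surj[OF C(1) c(1)] by blast
    then have "a (Suc m) = c" by (simp add: a_def)
    then show ?thesis using c by blast
  qed
  define s where "s k = 2 powr real_of_int k" for k
  have s_pos: "0 < s k" for k by (simp add: s_def)
  \<comment> \<open>An enumeration of all pairs of an integer scale and an index n \<ge> 1.\<close>
  define e where "e i = (case prod_decode i of (k, n) \<Rightarrow> (int_decode k, Suc n))" for i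
  have e_inj: "inj e"
    by (rule inj_on_inverseI[where g = "\<lambda>(k, n). prod_encode (int_encode k, n - 1)"])
       (simp add: e_def split_def)
  have e_surj: "\<exists>i. e i = (k, n)" if "1 \<le> n" for k n
    using that by (intro exI[of _ "prod_encode (int_encode k, n - 1)"]) (simp add: e_def)
  have e_snd: "1 \<le> snd (e i)" for i by (simp add: e_def split_def)
  define j where "j x i = (case e i of (k, n) \<Rightarrow> coord M a (s k) n x)" for x i
  have jc: "j x \<in> mspace c0" if x: "x \<in> mspace M" for x
  proof -
    have "finite {i. \<epsilon> \<le> \<bar>j x i\<bar>}" if \<epsilon>: "0 < \<epsilon>" for \<epsilon>
    proof -
      \<comment> \<open>A coordinate at scale s is at most 3 s, so a value of at least \<epsilon>
        forces s \<ge> \<epsilon> / 3; the center \<open>p\<close> forces s < d (x, p). Finitely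
        many scales remain, and at each of them a center within s of \<open>x\<close> bounds the
        index.\<close>
      define Ks where "Ks = {\<lfloor>log 2 (\<epsilon> / 3)\<rfloor>..\<lceil>log 2 (mdist M x p)\<rceil>}"
      define m where "m k = (SOME m. mdist M x (a m) < s k)" for k
      have m: "mdist M x (a (m k)) < s k" for k
        unfolding m_def using near[OF x s_pos] by (rule someI_ex)
      have "e i \<in> (SIGMA k:Ks. {..m k})" if i: "\<epsilon> \<le> \<bar>j x i\<bar>" for i
      proof -
        obtain k n where kn: "e i = (k, n)" by (cases "e i")
        have n: "1 \<le> n" using e_snd[of i] kn by simp
        have j: "j x i = coord M a (s k) n x" by (simp add: j_def kn)
        have "0 \<le> j x i" by (simp add: j coord_def)
        then have pos: "0 < coord M a (s k) n x" and ge: "\<epsilon> \<le> coord M a (s k) n x" using i \<epsilon> j by auto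
        note cp = coord_pos[OF pos]
        have "\<epsilon> / 3 \<le> s k" using ge cp(2) M.nonneg[of x "a n"] by linarith
        then have "log 2 (\<epsilon> / 3) \<le> log 2 (s k)" using \<epsilon> by (intro log_mono) auto
        then have 1: "\<lfloor>log 2 (\<epsilon> / 3)\<rfloor> \<le> k" by (simp add: s_def floor_le_iff)
        have sp: "s k < mdist M x p" using cp(3)[of 0] n by (simp add: a_def)
        then have "log 2 (s k) \<le> log 2 (mdist M x p)" using s_pos[of k] by (intro log_mono) auto
        then have 2: "k \<le> \<lceil>log 2 (mdist M x p)\<rceil>" by (simp add: s_def le_ceiling_iff)
        have "n \<le> m k"
          using cp(3)[of "m k"] m[of k] by (meson linorder_not_le order_less_asym)
        then show ?thesis using 1 2 kn by (simp add: Ks_def)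
      qed
      then have "{i. \<epsilon> \<le> \<bar>j x i\<bar>} \<subseteq> e -` (SIGMA k:Ks. {..m k})" by blast
      moreover have "finite (e -` (SIGMA k:Ks. {..m k}))"
        by (rule finite_vimageI[OF _ e_inj]) (simp add: Ks_def)
      ultimately show ?thesis by (rule finite_subset)
    qed
    then show ?thesis by (simp add: mspace_c0 LIMSEQ_zero_if_finite)
  qed
  have upper: "mdist c0 (j x) (j y) \<le> mdist M x y" if xy: "x \<in> mspace M" "y \<in> mspace M" for x y
    by (rule c0_dist_least[OF jc[OF xy(1)] jc[OF xy(2)]])
       (simp add: j_def split_def coord_Lipschitz[OF a xy])
  have lower: "mdist M x y \<le> 14 * mdist c0 (j x) (j y)" if xy: "x \<in> mspace M" "y \<in> mspace M" for x y
  proof (cases "x = y")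
    case True
    then show ?thesis using xy by simp
  next
    case False
    define D where "D = mdist M x y"
    have D: "0 < D" using False xy by (simp add: D_def)
    \<comment> \<open>The scale satisfies 7 s \<le> D < 14 s. As 7 exceeds 6, two points at distance
      D never lie in the support of the same coordinate; rounding to a power of 2 costs the factor 2
      in 14.\<close>
    define k where "k = \<lfloor>log 2 (D / 7)\<rfloor>"
    have "s k \<le> 2 powr log 2 (D / 7)" unfolding s_def k_def by (intro powr_mono) auto
    then have s1: "7 * s k \<le> D" using D by simp
    have "2 powr log 2 (D / 7) < 2 powr (real_of_int k + 1)" unfolding k_def by (intro powr_less_mono) linarith+
    then have s2: "D < 14 * s k" using D by (simp add: powr_add s_def)
    define first where "first x = (LEAST n. mdist M x (a n) < 2 * s k)" for x
    have first: "mdist M z (a (first z)) < 2 * s k" "\<And>m. m < first z \<Longrightarrow> 2 * s k \<le> mdist M z (a m)"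
      if "z \<in> mspace M" for z
    proof -
      have "\<exists>n. mdist M z (a n) < 2 * s k" using near[OF that, of "2 * s k"] s_pos[of k] by simp
      then show "mdist M z (a (first z)) < 2 * s k" unfolding first_def by (rule LeastI_ex)
      show "2 * s k \<le> mdist M z (a m)" if "m < first z" for m
        using not_less_Least[OF that[unfolded first_def]] by simp
    qed
    \<comment> \<open>The coordinate of the first center within 2 s of \<open>u\<close> is at least
      s at \<open>u\<close> and vanishes at \<open>v\<close>.\<close>
    have sep: "s k \<le> mdist c0 (j u) (j v)"
      if uv: "u \<in> mspace M" "v \<in> mspace M" "mdist M u v = D" and n: "1 \<le> first u" for u v
    proof -
      obtain i where i: "e i = (k, first u)" using e_surj[OF n] by blast
      have big: "s k \<le> coord M a (s k) (first u) u" by (rule coord_large) (use first[OF uv(1)] in auto)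
      have "\<not> 0 < coord M a (s k) (first u) v"
      proof
        assume "0 < coord M a (s k) (first u) v"
        from coord_pos(1)[OF this] coord_pos(1)[of M a "s k" "first u" u] big s_pos[of k]
        have "mdist M u (a (first u)) < 3 * s k" "mdist M v (a (first u)) < 3 * s k" by auto
        then have "D < 6 * s k"
          using M.triangle[OF uv(1) a uv(2), of "first u"] M.commute[of v] uv(3) by auto
        then show False using s1 s_pos[of k] by linarith
      qed
      then have "s k \<le> \<bar>j u i - j v i\<bar>" using big by (simp add: j_def i)
      also have "\<dots> \<le> mdist c0 (j u) (j v)" by (rule c0_dist_upper[OF jc[OF uv(1)] jc[OF uv(2)]])
      finally show ?thesis .
    qed
    have "s k \<le> mdist c0 (j x) (j y)"
    proof (cases "1 \<le> first x")
      case True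
      then show ?thesis using sep[OF xy] by (simp add: D_def)
    next
      \<comment> \<open>The first center near \<open>x\<close> is \<open>p\<close>, which has no
        coordinate. Then \<open>y\<close> cannot also be near \<open>p\<close>, since D \<ge> 7 s >
        4 s, and the roles of \<open>x\<close> and \<open>y\<close> are exchanged.\<close>
      case fx: False
      have "1 \<le> first y"
      proof (rule ccontr)
        assume "\<not> 1 \<le> first y"
        then have "first x = 0" "first y = 0" using fx by auto
        then have "mdist M x p < 2 * s k" "mdist M y p < 2 * s k"
          using first(1)[OF xy(1)] first(1)[OF xy(2)] by (simp_all add: a_def)
        then have "D < 4 * s k" using M.triangle[OF xy(1) p xy(2)] M.commute[of y p] by (auto simp: D_def)
        then show False using s1 s_pos[of k] by linarith
      qed
      then show ?thesis
        using sep[OF xy(2,1)] M.commute[of x y] Metric_space.commute[OF Metric_space_mspace_mdist, of c0 "j x" "j y"]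
        by (simp add: D_def)
    qed
    then show ?thesis using s2 by (simp add: D_def)
  qed
  show thesis by (rule that[OF jc upper lower])
qed

section \<open>Extension of Lipschitz maps into \<open>linf\<close> and Lipschitz sections\<close>

lemma linf_extension:
  fixes N :: "'b metric" and \<phi> :: "'b \<Rightarrow> 'i \<Rightarrow> real"
  assumes A: "A \<subseteq> mspace N" "A \<noteq> {}" and S: "S \<noteq> {}" and L: "0 < L"
    and \<phi>: "\<And>a. a \<in> A \<Longrightarrow> \<phi> a \<in> linf_carrier S"
      "\<And>a b. a \<in> A \<Longrightarrow> b \<in> A \<Longrightarrow> linf_dist S (\<phi> a) (\<phi> b) \<le> L * mdist N a b"
  obtains \<Phi> where "Lipschitz_continuous_map N (linf S) \<Phi>" "\<And>a. a \<in> A \<Longrightarrow> \<Phi> a = \<phi> a"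
proof -
  \<comment> \<open>Each coordinate is extended separately after division by \<open>L\<close>. This
    loses nothing, since the sup norm sees one coordinate at a time.\<close>
  have "\<exists>F. (\<forall>a\<in>A. F a = \<phi> a i / L) \<and> (\<forall>x\<in>mspace N. \<forall>y\<in>mspace N. \<bar>F x - F y\<bar> \<le> mdist N x y)"
    if i: "i \<in> S" for i
  proof -
    have "\<bar>\<phi> a i / L - \<phi> b i / L\<bar> \<le> mdist N a b" if ab: "a \<in> A" "b \<in> A" for a b
    proof -
      have "\<bar>\<phi> a i - \<phi> b i\<bar> \<le> L * mdist N a b"
        using linf_dist_upper[OF \<phi>(1)[OF ab(1)] \<phi>(1)[OF ab(2)] i] \<phi>(2)[OF ab] by linarith
      then show ?thesis using L by (simp add: diff_divide_distrib[symmetric] divide_le_eq mult.commute)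
    qed
    then obtain F where "\<And>a. a \<in> A \<Longrightarrow> F a = \<phi> a i / L"
       "\<And>x y. x \<in> mspace N \<Longrightarrow> y \<in> mspace N \<Longrightarrow> \<bar>F x - F y\<bar> \<le> mdist N x y"
      using McShane_extension[OF A, of "\<lambda>a. \<phi> a i / L"] by blast
    then show ?thesis by blast
  qed
  then obtain F where F: "\<And>i a. i \<in> S \<Longrightarrow> a \<in> A \<Longrightarrow> F i a = \<phi> a i / L"
    and FL: "\<And>i x y. i \<in> S \<Longrightarrow> x \<in> mspace N \<Longrightarrow> y \<in> mspace N \<Longrightarrow> \<bar>F i x - F i y\<bar> \<le> mdist N x y"
    by metis
  define \<Phi> where "\<Phi> x = (\<lambda>i. if i \<in> S then L * F i x else 0)" for x
  have \<Phi>L: "\<bar>\<Phi> x i - \<Phi> y i\<bar> \<le> L * mdist N x y" if "i \<in> S" "x \<in> mspace N" "y \<in> mspace N" for i x y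
    using mult_left_mono[OF FL[OF that], of L] L that by (simp add: \<Phi>_def right_diff_distrib[symmetric] abs_mult)
  have \<Phi>A: "\<Phi> a = \<phi> a" if "a \<in> A" for a
  proof
    fix i show "\<Phi> a i = \<phi> a i"
      using F[of i a] \<phi>(1)[OF that] that L by (cases "i \<in> S") (auto simp: \<Phi>_def linf_carrier_def)
  qed
  \<comment> \<open>Boundedness over all coordinates is inherited from a single point of
    \<open>A\<close>, as all extended coordinates have the same Lipschitz constant.\<close>
  obtain a0 where a0: "a0 \<in> A" using A by blast
  have \<Phi>S: "\<Phi> x \<in> linf_carrier S" if x: "x \<in> mspace N" for x
  proof -
    obtain B where B: "\<And>i. i \<in> S \<Longrightarrow> \<bar>\<phi> a0 i\<bar> \<le> B"
      using \<phi>(1)[OF a0] by (auto simp: linf_carrier_def bounded_iff)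
    have "\<bar>\<Phi> x i\<bar> \<le> B + L * mdist N x a0" if i: "i \<in> S" for i
      using \<Phi>L[OF i x, of a0] B[OF i] a0 A(1) \<Phi>A[OF a0] by (simp add: subset_iff)
    then show ?thesis by (auto simp: linf_carrier_def bounded_iff \<Phi>_def)
  qed
  have "Lipschitz_continuous_map N (linf S) \<Phi>"
    unfolding Lipschitz_continuous_map_def using S \<Phi>S \<Phi>L
    by (auto intro!: exI[of _ L] linf_dist_least)
  then show thesis using \<Phi>A that by blast
qed

text \<open>Subtracting the distance to \<open>p\<close> makes the distance functions bounded. The
  difference of the images of x and y attains d (x, y) at the coordinate y.\<close>

lemma Kuratowski_embedding:
  assumes p: "p \<in> mspace M"
  obtains k where "isometric_embedding M (linf (mspace M)) k"
proof -
  interpret M: Metric_space "mspace M" "mdist M" by simp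
  let ?S = "mspace M"
  define k where "k x = (\<lambda>y. if y \<in> ?S then mdist M x y - mdist M p y else 0)" for x
  have ne: "?S \<noteq> {}" using p by blast
  have kS: "k x \<in> linf_carrier ?S" if x: "x \<in> ?S" for x
  proof -
    have "\<bar>k x y\<bar> \<le> mdist M x p" if "y \<in> ?S" for y
      using M.mdist_reverse_triangle[of x y p] M.commute[of y p] x p that by (simp add: k_def)
    then show ?thesis by (auto simp: linf_carrier_def bounded_iff k_def)
  qed
  have "linf_dist ?S (k x) (k y) = mdist M x y" if xy: "x \<in> ?S" "y \<in> ?S" for x y
  proof (rule antisym)
    show "linf_dist ?S (k x) (k y) \<le> mdist M x y"
    proof (rule linf_dist_least[OF ne kS kS])
      show "\<bar>k x z - k y z\<bar> \<le> mdist M x y" if "z \<in> ?S" for z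
        using M.mdist_reverse_triangle[of x z y] M.commute[of z y] xy that by (simp add: k_def)
    qed (use xy in auto)
    show "mdist M x y \<le> linf_dist ?S (k x) (k y)"
      using linf_dist_upper[OF kS[OF xy(1)] kS[OF xy(2)] xy(2)] xy by (simp add: k_def)
  qed
  then show thesis using kS ne by (intro that[of k]) (auto simp: isometric_embedding_def)
qed

lemma Lipschitz_continuous_mapI:
  assumes "\<And>x. x \<in> mspace M \<Longrightarrow> f x \<in> mspace N"
    and "\<And>x y. x \<in> mspace M \<Longrightarrow> y \<in> mspace M \<Longrightarrow> mdist N (f x) (f y) \<le> B * mdist M x y"
  shows "Lipschitz_continuous_map M N f"
  using assms unfolding Lipschitz_continuous_map_def by blast

text \<open>The lower bound says that the inverse of \<open>j\<close> is C-Lipschitz on its image.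
  Viewed as a map into \<open>linf\<close>, this inverse extends to all of N; the retraction of
  \<open>linf\<close> onto the copy of M brings the values back to M.\<close>

lemma absolute_Lipschitz_retract_section:
  fixes M :: "'a metric" and N :: "'b metric"
  assumes ALR: "absolute_Lipschitz_retract M" and p: "p \<in> mspace M" and C: "0 < C"
    and j: "\<And>x. x \<in> mspace M \<Longrightarrow> j x \<in> mspace N"
    and lower: "\<And>x y. x \<in> mspace M \<Longrightarrow> y \<in> mspace M \<Longrightarrow> mdist M x y \<le> C * mdist N (j x) (j y)"
  obtains q where "Lipschitz_continuous_map N M q" "\<And>x. x \<in> mspace M \<Longrightarrow> q (j x) = x"
proof -
  interpret M: Metric_space "mspace M" "mdist M" by simp
  interpret N: Metric_space "mspace N" "mdist N" by simp
  let ?S = "mspace M"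
  have ne: "?S \<noteq> {}" using p by blast
  obtain k where k: "isometric_embedding M (linf ?S) k" using Kuratowski_embedding[OF p] .
  have kS: "k x \<in> linf_carrier ?S" if "x \<in> ?S" for x using k that ne by (auto simp: isometric_embedding_def)
  have dk: "linf_dist ?S (k x) (k y) = mdist M x y" if "x \<in> ?S" "y \<in> ?S" for x y
    using k that ne by (auto simp: isometric_embedding_def)
  have injk: "inj_on k ?S" using dk kS by (intro inj_onI) (metis M.zero)
  have injj: "inj_on j ?S"
  proof (rule inj_onI)
    fix x y assume "x \<in> ?S" "y \<in> ?S" "j x = j y"
    then show "x = y" using lower[of x y] j[of y] M.nonneg[of x y] M.zero[of x y] by simp
  qed
  from ALR k have "Lipschitz_retract (linf ?S) (k ` ?S)" by (simp add: absolute_Lipschitz_retract_def)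
  then obtain r where r: "Lipschitz_continuous_map (linf ?S) (submetric (linf ?S) (k ` ?S)) r"
      and rk: "\<And>x. x \<in> ?S \<Longrightarrow> r (k x) = k x"
    by (auto simp: Lipschitz_retract_def)
  obtain \<Phi> where \<Phi>: "Lipschitz_continuous_map N (linf ?S) \<Phi>"
    "\<And>u. u \<in> j ` ?S \<Longrightarrow> \<Phi> u = k (inv_into ?S j u)"
  proof (rule linf_extension[of "j ` ?S" N ?S C "\<lambda>u. k (inv_into ?S j u)"])
    fix u v assume "u \<in> j ` ?S" "v \<in> j ` ?S"
    then show "linf_dist ?S (k (inv_into ?S j u)) (k (inv_into ?S j v)) \<le> C * mdist N u v"
      using injj by (auto simp: dk lower)
  qed (use j ne C kS injj in auto)
  have rN: "r (\<Phi> u) \<in> k ` ?S" if "u \<in> mspace N" for u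
    using Lipschitz_continuous_map_image[OF \<Phi>(1)] Lipschitz_continuous_map_image[OF r] that by auto
  obtain B where B: "\<And>u v. u \<in> mspace N \<Longrightarrow> v \<in> mspace N \<Longrightarrow> linf_dist ?S (r (\<Phi> u)) (r (\<Phi> v)) \<le> B * mdist N u v"
    using Lipschitz_continuous_map_compose[OF \<Phi>(1) r] ne by (auto simp: Lipschitz_continuous_map_pos)
  define q where "q u = inv_into ?S k (r (\<Phi> u))" for u
  have q: "q u \<in> ?S" "k (q u) = r (\<Phi> u)" if "u \<in> mspace N" for u
    using rN[OF that] by (auto simp: q_def inv_into_into f_inv_into_f)
  show thesis
  proof
    show "Lipschitz_continuous_map N M q"
    proof (rule Lipschitz_continuous_mapI[where B = B])
      fix u v assume uv: "u \<in> mspace N" "v \<in> mspace N"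
      have "mdist M (q u) (q v) = linf_dist ?S (r (\<Phi> u)) (r (\<Phi> v))"
        using dk[OF q(1) q(1), OF uv] q(2) uv by simp
      then show "mdist M (q u) (q v) \<le> B * mdist N u v" using B[OF uv] by simp
    qed (use q in auto)
    show "q (j x) = x" if "x \<in> ?S" for x
      using that injj injk by (simp add: q_def \<Phi>(2) rk)
  qed
qed

section \<open>From embeddings to isomorphic free spaces\<close>

lemma complemented_in_lip_c0:
  assumes "separable_space (mtopology_of M)" "absolute_Lipschitz_retract M" "a \<in> mspace M" "b \<in> mspace c0"
  shows "complemented (lip_ball M a) (lip_ball c0 b)"
proof -
  obtain j where j: "\<And>x. x \<in> mspace M \<Longrightarrow> j x \<in> mspace c0"
    "\<And>x y. x \<in> mspace M \<Longrightarrow> y \<in> mspace M \<Longrightarrow> mdist c0 (j x) (j y) \<le> mdist M x y"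
    "\<And>x y. x \<in> mspace M \<Longrightarrow> y \<in> mspace M \<Longrightarrow> mdist M x y \<le> 14 * mdist c0 (j x) (j y)"
    using Aharoni_embedding[OF assms(1,3)] by blast
  obtain q where "Lipschitz_continuous_map c0 M q" "\<And>x. x \<in> mspace M \<Longrightarrow> q (j x) = x"
    by (rule absolute_Lipschitz_retract_section[OF assms(2,3), where C = 14 and j = j and N = c0]) (use j in auto)
  moreover have "Lipschitz_continuous_map M c0 j"
    by (rule Lipschitz_continuous_mapI[where B = 1]) (use j in auto)
  ultimately show ?thesis using assms(3,4) by (intro complemented_if_Lipschitz_section) auto
qed

text \<open>Applied both to M and to \<open>c0\<close> itself, so that the two are compared through
  the same sup-sum.\<close>

lemma isomorphic_if_between:
  assumes b: "b \<in> mspace c0" and "complemented (lip_ball M a) (lip_ball c0 b)"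
    and "complemented lip_c0_unit_ball (lip_ball M a)"
  shows "isomorphic (lip_ball M a) (sup_sum lip_c0_unit_ball)"
proof (rule decomposition_method)
  \<comment> \<open>The identity of \<open>c0\<close> moves the base point from \<open>b\<close> to
    0.\<close>
  have "complemented (lip_ball c0 b) (lip_ball c0 (\<lambda>_. 0))"
    by (rule complemented_if_Lipschitz_section[where j = "\<lambda>x. x" and q = "\<lambda>x. x"])
       (use b zero_in_c0 Lipschitz_continuous_map_id in auto)
  then show "complemented (lip_ball M a) lip_c0_unit_ball"
    by (rule complemented_trans[OF assms(2) complemented_trans[OF _ complemented_trans[OF
          lip_c0_complemented_in_sup_sum sup_sum_complemented_in_lip_c0_unit_ball]]])
  show "complemented (sup_sum lip_c0_unit_ball) (lip_ball M a)"
    by (rule complemented_trans[OF sup_sum_complemented_in_lip_c0_unit_ball assms(3)])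
qed (rule ball_family_lip_ball)+

text \<open>Coordinatewise truncation is a nonexpansive retraction of \<open>c0\<close> onto its
  unit ball.\<close>

lemma lip_c0_unit_ball_complemented_in_lip_c0:
  assumes "b \<in> mspace c0" shows "complemented lip_c0_unit_ball (lip_ball c0 b)"
proof (rule complemented_if_Lipschitz_section[where j = "\<lambda>x. x" and q = "\<lambda>x i. clip 1 (x i)"])
  show "Lipschitz_continuous_map c0_unit_ball c0 (\<lambda>x. x)"
    by (rule Lipschitz_continuous_mapI[where B = 1]) (auto simp: mdist_c0_unit_ball c0_unit_ball_subset)
  have q: "(\<lambda>i. clip 1 (x i)) \<in> mspace c0_unit_ball" if "x \<in> mspace c0" for x
    using that by (intro clip_in_c0_unit_ball) (auto simp: mspace_c0)
  show "Lipschitz_continuous_map c0 c0_unit_ball (\<lambda>x i. clip 1 (x i))"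
  proof (rule Lipschitz_continuous_mapI[where B = 1, OF q])
    fix x y assume xy: "x \<in> mspace c0" "y \<in> mspace c0"
    have "mdist c0 (\<lambda>i. clip 1 (x i)) (\<lambda>i. clip 1 (y i)) \<le> mdist c0 x y"
    proof (rule c0_dist_least)
      fix i
      show "\<bar>clip 1 (x i) - clip 1 (y i)\<bar> \<le> mdist c0 x y"
        using clip_diff[of 1 1 "x i" "y i"] c0_dist_upper[OF xy, of i] by simp
    qed (use q xy c0_unit_ball_subset in blast)+
    then show "mdist c0_unit_ball (\<lambda>i. clip 1 (x i)) (\<lambda>i. clip 1 (y i)) \<le> 1 * mdist c0 x y"
      by (simp add: mdist_c0_unit_ball)
  qed
  show "(\<lambda>i. clip 1 (x i)) = x" if "x \<in> mspace c0_unit_ball" for x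
    using that by (auto simp: mspace_c0_unit_ball clip_eq)
qed (use assms zero_in_c0_unit_ball in auto)

text \<open>The retract is given by a pair of maps \<open>j\<close>, \<open>q\<close> rather than by
  a subset with an equivalence; such a pair is what the construction in C(K) yields
  directly.\<close>

theorem free_isomorphic_c0:
  assumes "separable_space (mtopology_of M)" "absolute_Lipschitz_retract M"
    and a: "a \<in> mspace M" and b: "b \<in> mspace c0"
    and j: "Lipschitz_continuous_map c0_unit_ball M j" and q: "Lipschitz_continuous_map M c0_unit_ball q"
    and qj: "\<And>x. x \<in> mspace c0_unit_ball \<Longrightarrow> q (j x) = x"
  shows "free_isomorphic M a c0 b"
proof -
  have "complemented lip_c0_unit_ball (lip_ball M a)"
    by (rule complemented_if_Lipschitz_section[OF zero_in_c0_unit_ball a j q qj])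
  then have "isomorphic (lip_ball M a) (sup_sum lip_c0_unit_ball)"
    by (rule isomorphic_if_between[OF b complemented_in_lip_c0[OF assms(1-4)]])
  moreover have "complemented (lip_ball c0 b) (lip_ball c0 b)"
    unfolding complemented_def using operator_id by blast
  then have "isomorphic (lip_ball c0 b) (sup_sum lip_c0_unit_ball)"
    by (rule isomorphic_if_between[OF b _ lip_c0_unit_ball_complemented_in_lip_c0[OF b]])
  ultimately show ?thesis
    by (rule free_isomorphic_if_isomorphic[OF a b isomorphic_trans[OF _ isomorphic_sym]])
qed

lemma free_isomorphic_c0_if_Lipschitz_retract:
  assumes "separable_space (mtopology_of M)" "absolute_Lipschitz_retract M"
    and a: "a \<in> mspace M" and b: "b \<in> mspace c0"
    and F: "Lipschitz_retract M F" and eq: "Lipschitz_equivalent (submetric M F) c0_unit_ball"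
  shows "free_isomorphic M a c0 b"
proof -
  let ?B = c0_unit_ball
  from F obtain r where FM: "F \<subseteq> mspace M" and r: "Lipschitz_continuous_map M (submetric M F) r"
    and rF: "\<And>x. x \<in> F \<Longrightarrow> r x = x"
    by (auto simp: Lipschitz_retract_def)
  have FF: "F \<inter> mspace M = F" using FM by blast
  from eq obtain f c C where f: "f ` F = mspace ?B" and c: "0 < c"
    and bounds: "\<forall>x\<in>F. \<forall>y\<in>F. c * mdist M x y \<le> mdist ?B (f x) (f y) \<and> mdist ?B (f x) (f y) \<le> C * mdist M x y"
    unfolding Lipschitz_equivalent_def mspace_submetric FF mdist_submetric by blast
  have lower: "\<And>x y. x \<in> F \<Longrightarrow> y \<in> F \<Longrightarrow> c * mdist M x y \<le> mdist ?B (f x) (f y)"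
    and upper: "\<And>x y. x \<in> F \<Longrightarrow> y \<in> F \<Longrightarrow> mdist ?B (f x) (f y) \<le> C * mdist M x y"
    using bounds by auto
  \<comment> \<open>The lower Lipschitz bound of \<open>f\<close> makes this inverse Lipschitz, and
    \<open>f\<close> after the retraction undoes it.\<close>
  define j where "j = inv_into F f"
  have j: "j u \<in> F" "f (j u) = u" if "u \<in> mspace ?B" for u
    using that f by (auto simp: j_def inv_into_into f_inv_into_f)
  have "Lipschitz_continuous_map ?B M j"
  proof (rule Lipschitz_continuous_mapI[where B = "1 / c"])
    fix u v assume uv: "u \<in> mspace ?B" "v \<in> mspace ?B"
    have "c * mdist M (j u) (j v) \<le> mdist ?B u v"
      using lower[OF j(1) j(1), OF uv] by (simp add: j(2) uv)
    then show "mdist M (j u) (j v) \<le> 1 / c * mdist ?B u v" using c by (simp add: le_divide_eq mult.commute)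
  qed (use j FM in auto)
  moreover have "Lipschitz_continuous_map M ?B (f \<circ> r)"
  proof (rule Lipschitz_continuous_map_compose[OF r], rule Lipschitz_continuous_mapI[where B = C])
    show "f x \<in> mspace ?B" if "x \<in> mspace (submetric M F)" for x using that f FF by auto
    show "mdist ?B (f x) (f y) \<le> C * mdist (submetric M F) x y"
      if "x \<in> mspace (submetric M F)" "y \<in> mspace (submetric M F)" for x y
      using that upper by auto
  qed
  moreover have "(f \<circ> r) (j u) = u" if "u \<in> mspace ?B" for u
    using j[OF that] rF by simp
  ultimately show ?thesis by (rule free_isomorphic_c0[OF assms(1-4)])
qed

section \<open>The absolute Lipschitz retract \<open>C(K)\<close>\<close>

text \<open>For bounded functions this is uniform continuity. Lipschitz up to an error is the form
  that fits inf-convolutions: the slope becomes \<open>n\<close> and the error becomes the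
  defect.\<close>

definition almost_Lipschitz :: "'a metric \<Rightarrow> ('a \<Rightarrow> real) \<Rightarrow> bool" where
  "almost_Lipschitz K f \<longleftrightarrow> (\<forall>e>0. \<exists>L\<ge>0. \<forall>x\<in>mspace K. \<forall>y\<in>mspace K. \<bar>f x - f y\<bar> \<le> L * mdist K x y + e)"

lemma almost_LipschitzD:
  assumes "almost_Lipschitz K f" "0 < e"
  obtains L where "0 \<le> L" "\<And>x y. x \<in> mspace K \<Longrightarrow> y \<in> mspace K \<Longrightarrow> \<bar>f x - f y\<bar> \<le> L * mdist K x y + e"
proof -
  from assms have "\<exists>L\<ge>0. \<forall>x\<in>mspace K. \<forall>y\<in>mspace K. \<bar>f x - f y\<bar> \<le> L * mdist K x y + e"
    by (simp add: almost_Lipschitz_def)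
  then show thesis using that by auto
qed

lemma almost_Lipschitz_if_Lipschitz:
  assumes "0 \<le> L" "\<And>x y. x \<in> mspace K \<Longrightarrow> y \<in> mspace K \<Longrightarrow> \<bar>f x - f y\<bar> \<le> L * mdist K x y"
  shows "almost_Lipschitz K f"
  unfolding almost_Lipschitz_def
proof (intro allI impI exI[of _ L] conjI ballI)
  fix e :: real and x y assume "0 < e" "x \<in> mspace K" "y \<in> mspace K"
  then show "\<bar>f x - f y\<bar> \<le> L * mdist K x y + e" using assms(2)[of x y] by linarith
qed (rule assms)

lemma almost_Lipschitz_imp_continuous_map:
  assumes "almost_Lipschitz K f"
  shows "continuous_map (mtopology_of K) euclideanreal f"
proof -
  interpret K: Metric_space "mspace K" "mdist K" by simp
  have "\<exists>\<delta>>0. \<forall>y. y \<in> mspace K \<and> mdist K x y < \<delta> \<longrightarrow> dist (f x) (f y) < e"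
    if x: "x \<in> mspace K" and e: "0 < e" for x e
  proof -
    obtain L where L: "0 \<le> L" "\<And>x y. x \<in> mspace K \<Longrightarrow> y \<in> mspace K \<Longrightarrow> \<bar>f x - f y\<bar> \<le> L * mdist K x y + e / 2"
      using almost_LipschitzD[OF assms, of "e / 2"] e by auto
    \<comment> \<open>L + 1 in place of L, since L may be 0.\<close>
    define \<delta> where "\<delta> = e / (2 * (L + 1))"
    have "0 < \<delta>" using L e by (simp add: \<delta>_def)
    moreover have "dist (f x) (f y) < e" if "y \<in> mspace K" "mdist K x y < \<delta>" for y
    proof -
      have "(L + 1) * mdist K x y < e / 2"
        using that(2) L(1) by (simp add: \<delta>_def less_divide_eq algebra_simps)
      moreover have "L * mdist K x y \<le> (L + 1) * mdist K x y" by (simp add: distrib_right)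
      ultimately show ?thesis using L(2)[OF x that(1)] by (simp add: dist_real_def)
    qed
    ultimately show ?thesis by blast
  qed
  then have "continuous_map K.mtopology Met_TC.mtopology f"
    by (subst K.metric_continuous_map[OF Met_TC.Metric_space_axioms]) simp
  then show ?thesis by (simp add: mtopology_of_def)
qed

locale compact_metric =
  fixes K :: "'k metric"
  assumes compact: "compact_space (mtopology_of K)" and nonempty: "mspace K \<noteq> {}"
begin

interpretation K: Metric_space "mspace K" "mdist K" by simp

abbreviation "S \<equiv> mspace K"
abbreviation "d \<equiv> mdist K"
abbreviation "CK \<equiv> continuous_functions K"

lemma continuous_map_bounded:
  assumes "continuous_map (mtopology_of K) euclideanreal f"
  obtains B where "0 < B" "\<And>x. x \<in> S \<Longrightarrow> \<bar>f x\<bar> \<le> B"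
proof -
  have "compactin euclideanreal (f ` topspace (mtopology_of K))"
    using compact assms image_compactin unfolding compact_space_def by blast
  then have "bounded (f ` S)" by (simp add: compact_imp_bounded)
  then show thesis using that by (auto simp: bounded_pos)
qed

text \<open>Below a Lebesgue number \<delta> the oscillation is less than e. At distance \<delta> or
  more the trivial bound 2 B is absorbed by the slope 2 B / \<delta>.\<close>

lemma continuous_map_imp_almost_Lipschitz:
  assumes f: "continuous_map (mtopology_of K) euclideanreal f"
  shows "almost_Lipschitz K f"
  unfolding almost_Lipschitz_def
proof (intro allI impI)
  fix e :: real assume e: "0 < e"
  define U where "U c = {x \<in> S. f x \<in> ball c (e / 2)}" for c
  have "openin (mtopology_of K) {x \<in> topspace (mtopology_of K). f x \<in> ball c (e / 2)}" for c
    by (rule openin_continuous_map_preimage[OF f]) simp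
  then have U: "openin K.mtopology (U c)" for c by (simp add: U_def mtopology_of_def)
  have "\<exists>\<delta>>0. \<forall>x\<in>S. \<exists>V\<in>range U. K.mball x \<delta> \<subseteq> V"
  proof (rule K.lebesgue_number)
    show "compactin K.mtopology S" using compact by (simp add: compact_space_def mtopology_of_def)
    show "S \<subseteq> \<Union> (range U)"
    proof
      fix x assume "x \<in> S"
      then have "x \<in> U (f x)" using e by (simp add: U_def)
      then show "x \<in> \<Union> (range U)" by blast
    qed
  qed (use U in auto)
  then obtain \<delta> where \<delta>: "0 < \<delta>" "\<And>x. x \<in> S \<Longrightarrow> \<exists>c. K.mball x \<delta> \<subseteq> U c" by auto
  obtain B where B: "0 < B" "\<And>x. x \<in> S \<Longrightarrow> \<bar>f x\<bar> \<le> B" using continuous_map_bounded[OF f] by blast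
  have "\<bar>f x - f y\<bar> \<le> 2 * B / \<delta> * d x y + e" if xy: "x \<in> S" "y \<in> S" for x y
  proof (cases "d x y < \<delta>")
    case True
    obtain c where "K.mball x \<delta> \<subseteq> U c" using \<delta>(2)[OF xy(1)] by blast
    moreover have "x \<in> K.mball x \<delta>" "y \<in> K.mball x \<delta>" using xy True \<delta>(1) by auto
    ultimately have "x \<in> U c" "y \<in> U c" by blast+
    then have "dist c (f x) < e / 2" "dist c (f y) < e / 2" by (simp_all add: U_def)
    then have "dist (f x) (f y) < e" by (rule dist_triangle_half_r)
    then have "\<bar>f x - f y\<bar> \<le> e" by (simp add: dist_real_def)
    moreover have "0 \<le> 2 * B / \<delta> * d x y" using B \<delta> by simp
    ultimately show ?thesis by linarith
  next
    case False
    then have "2 * B / \<delta> * \<delta> \<le> 2 * B / \<delta> * d x y" using B \<delta> by (intro mult_left_mono) auto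
    then show ?thesis using B(2)[OF xy(1)] B(2)[OF xy(2)] \<delta>(1) e by (simp add: abs_le_iff)
  qed
  then show "\<exists>L\<ge>0. \<forall>x\<in>S. \<forall>y\<in>S. \<bar>f x - f y\<bar> \<le> L * d x y + e"
    using B \<delta> by (intro exI[of _ "2 * B / \<delta>"]) auto
qed

lemma CK_iff: "f \<in> mspace CK \<longleftrightarrow> almost_Lipschitz K f \<and> (\<forall>x. x \<notin> S \<longrightarrow> f x = 0)"
  using continuous_map_imp_almost_Lipschitz almost_Lipschitz_imp_continuous_map
  by (auto simp: mspace_continuous_functions[OF compact nonempty])

lemma CK_linf: "f \<in> mspace CK \<Longrightarrow> f \<in> linf_carrier S"
  using nonempty by (simp add: continuous_functions_def)

lemma mdist_CK: "mdist CK = linf_dist S"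
  using nonempty by (simp add: continuous_functions_def)

text \<open>The Pasch-Hausdorff envelope, the largest n-Lipschitz function below
  \<open>f\<close>.\<close>

definition inf_conv :: "nat \<Rightarrow> ('k \<Rightarrow> real) \<Rightarrow> 'k \<Rightarrow> real" where
  "inf_conv n f x = (INF y\<in>S. f y + real n * d x y)"

definition defect :: "nat \<Rightarrow> ('k \<Rightarrow> real) \<Rightarrow> real" where
  "defect n f = (SUP x\<in>S. f x - inf_conv n f x)"

text \<open>Lies between the distance of \<open>f\<close> from the continuous functions and twice
  that distance: the envelopes are continuous, and the defect changes by at most 2 D when
  \<open>f\<close> changes by D. Unlike the distance itself it comes with an explicit approximating
  sequence.\<close>

definition limit_defect :: "('k \<Rightarrow> real) \<Rightarrow> real" where
  "limit_defect f = (INF n. defect n f)"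

text \<open>Once the defect is close to its limit, a penalty proportional to the limit is due. It makes
  all later terms irrelevant for the supremum below unless \<open>f\<close> is continuous.\<close>

definition penalty :: "nat \<Rightarrow> ('k \<Rightarrow> real) \<Rightarrow> real" where
  "penalty n f = (case n of 0 \<Rightarrow> 0 | Suc m \<Rightarrow> 3 * max 0 (2 * limit_defect f - defect m f))"

definition continuous_retraction :: "('k \<Rightarrow> real) \<Rightarrow> 'k \<Rightarrow> real" where
  "continuous_retraction f x = (if x \<in> S then SUP n. inf_conv n f x - penalty n f else 0)"

section \<open>Envelopes, defect and retraction of a bounded function\<close>

context
  fixes f :: "'k \<Rightarrow> real"
  assumes f: "f \<in> linf_carrier S"
begin

lemma linf_carrier_bound:
  obtains B where "0 \<le> B" "\<And>x. x \<in> S \<Longrightarrow> \<bar>f x\<bar> \<le> B"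
proof -
  obtain B where B: "\<And>x. x \<in> S \<Longrightarrow> \<bar>f x\<bar> \<le> B"
    using f by (auto simp: linf_carrier_def bounded_iff)
  obtain x where "x \<in> S" using nonempty by blast
  then have "0 \<le> B" using B[of x] by linarith
  then show thesis using that B by blast
qed

lemma inf_conv_bdd: "x \<in> S \<Longrightarrow> bdd_below ((\<lambda>y. f y + real n * d x y) ` S)"
proof -
  obtain B where B: "\<And>x. x \<in> S \<Longrightarrow> \<bar>f x\<bar> \<le> B" using linf_carrier_bound by blast
  have "- B \<le> f y + real n * d x y" if "y \<in> S" for y
    using B[OF that] mult_nonneg_nonneg[OF of_nat_0_le_iff K.nonneg, of n x y] by (simp only: abs_le_iff) linarith
  then show ?thesis by (auto simp: bdd_below_def)
qed

lemma inf_conv_le_term: "x \<in> S \<Longrightarrow> y \<in> S \<Longrightarrow> inf_conv n f x \<le> f y + real n * d x y"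
  unfolding inf_conv_def by (rule cINF_lower[OF inf_conv_bdd])

lemma inf_conv_le: "x \<in> S \<Longrightarrow> inf_conv n f x \<le> f x"
  using inf_conv_le_term[of x x n] by simp

lemma inf_conv_greatest: "(\<And>y. y \<in> S \<Longrightarrow> c \<le> f y + real n * d x y) \<Longrightarrow> c \<le> inf_conv n f x"
  unfolding inf_conv_def by (rule cINF_greatest[OF nonempty])

lemma inf_conv_mono: "n \<le> m \<Longrightarrow> x \<in> S \<Longrightarrow> inf_conv n f x \<le> inf_conv m f x"
proof (rule inf_conv_greatest)
  fix y assume "n \<le> m" "x \<in> S" "y \<in> S"
  moreover from \<open>n \<le> m\<close> have "real n * d x y \<le> real m * d x y" by (intro mult_right_mono) auto
  ultimately show "inf_conv n f x \<le> f y + real m * d x y" using inf_conv_le_term[of x y n] by linarith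
qed

lemma inf_conv_Lipschitz: "x \<in> S \<Longrightarrow> y \<in> S \<Longrightarrow> inf_conv n f x \<le> inf_conv n f y + real n * d x y"
proof -
  assume xy: "x \<in> S" "y \<in> S"
  have "inf_conv n f x - real n * d x y \<le> inf_conv n f y"
  proof (rule inf_conv_greatest)
    fix z assume z: "z \<in> S"
    have "real n * d x z \<le> real n * (d x y + d y z)" by (intro mult_left_mono K.triangle xy z) auto
    then show "inf_conv n f x - real n * d x y \<le> f z + real n * d y z"
      using inf_conv_le_term[OF xy(1) z, of n] by (simp add: distrib_left)
  qed
  then show ?thesis by linarith
qed

lemma defect_bdd: "bdd_above ((\<lambda>x. f x - inf_conv n f x) ` S)"
proof -
  obtain B where B: "\<And>x. x \<in> S \<Longrightarrow> \<bar>f x\<bar> \<le> B" using linf_carrier_bound by blast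
  have "f x - inf_conv n f x \<le> 2 * B" if x: "x \<in> S" for x
  proof -
    have "- B \<le> inf_conv n f x"
    proof (rule inf_conv_greatest)
      fix y assume "y \<in> S"
      then show "- B \<le> f y + real n * d x y"
        using B[of y] mult_nonneg_nonneg[OF of_nat_0_le_iff K.nonneg, of n x y] by (simp del: mult_nonneg_nonneg add: abs_le_iff)
    qed
    then show ?thesis using B[OF x] by linarith
  qed
  then show ?thesis by (auto simp: bdd_above_def)
qed

lemma defect_ge: "x \<in> S \<Longrightarrow> f x - inf_conv n f x \<le> defect n f"
  unfolding defect_def by (rule cSUP_upper[OF _ defect_bdd])

lemma defect_least: "(\<And>x. x \<in> S \<Longrightarrow> f x - inf_conv n f x \<le> c) \<Longrightarrow> defect n f \<le> c"
  unfolding defect_def by (rule cSUP_least[OF nonempty])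

lemma defect_nonneg: "0 \<le> defect n f"
proof -
  obtain x where "x \<in> S" using nonempty by blast
  then show ?thesis using defect_ge[of x n] inf_conv_le[of x n] by linarith
qed

lemma defect_antimono:
  assumes "n \<le> m" shows "defect m f \<le> defect n f"
proof (rule defect_least)
  fix x assume "x \<in> S"
  then show "f x - inf_conv m f x \<le> defect n f"
    using inf_conv_mono[OF assms, of x] defect_ge[of x n] by linarith
qed

lemma limit_defect_le: "limit_defect f \<le> defect n f"
  unfolding limit_defect_def by (rule cINF_lower) (use defect_nonneg in \<open>auto simp: bdd_below_def\<close>)

lemma limit_defect_greatest: "(\<And>n. c \<le> defect n f) \<Longrightarrow> c \<le> limit_defect f"
  unfolding limit_defect_def by (rule cINF_greatest) auto

lemma limit_defect_nonneg: "0 \<le> limit_defect f"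
  by (rule limit_defect_greatest) (rule defect_nonneg)

lemma limit_defect_less: "limit_defect f < c \<Longrightarrow> \<exists>n. defect n f < c"
  using limit_defect_greatest[of c] by (meson linorder_not_le)

lemma penalty_nonneg: "0 \<le> penalty n f"
  by (simp add: penalty_def split: nat.split)

lemma term_le: "x \<in> S \<Longrightarrow> inf_conv n f x - penalty n f \<le> f x"
  using inf_conv_le[of x n] penalty_nonneg[of n] by linarith

lemma continuous_retraction_ge:
  assumes "x \<in> S" shows "inf_conv n f x - penalty n f \<le> continuous_retraction f x"
proof -
  have "bdd_above (range (\<lambda>n. inf_conv n f x - penalty n f))" using term_le[OF assms] by (auto simp: bdd_above_def)
  then show ?thesis using assms by (auto simp: continuous_retraction_def intro: cSUP_upper)
qed

lemma continuous_retraction_least: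
  "x \<in> S \<Longrightarrow> (\<And>n. inf_conv n f x - penalty n f \<le> c) \<Longrightarrow> continuous_retraction f x \<le> c"
  unfolding continuous_retraction_def by (simp add: cSUP_least)

text \<open>If \<open>f\<close> is L-Lipschitz up to e, every envelope of slope n \<ge> L lies
  within e of \<open>f\<close>.\<close>

lemma limit_defect_eq_0_if_continuous:
  assumes "almost_Lipschitz K f" shows "limit_defect f = 0"
proof (rule antisym[OF field_le_epsilon limit_defect_nonneg])
  fix e :: real assume "0 < e"
  then obtain L where L: "0 \<le> L" "\<And>x y. x \<in> S \<Longrightarrow> y \<in> S \<Longrightarrow> \<bar>f x - f y\<bar> \<le> L * d x y + e"
    using almost_LipschitzD[OF assms] by blast
  obtain n where n: "L \<le> real n" using real_arch_simple by blast
  have "defect n f \<le> e"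
  proof (rule defect_least)
    fix x assume x: "x \<in> S"
    have "f x - e \<le> inf_conv n f x"
    proof (rule inf_conv_greatest)
      fix y assume y: "y \<in> S"
      have "L * d x y \<le> real n * d x y" using n by (simp add: mult_right_mono)
      then show "f x - e \<le> f y + real n * d x y" using L(2)[OF x y] by linarith
    qed
    then show "f x - inf_conv n f x \<le> e" by linarith
  qed
  then show "limit_defect f \<le> 0 + e" using limit_defect_le[of n] by linarith
qed

text \<open>All penalties vanish because defects are nonnegative, and the envelopes increase to
  \<open>f\<close> uniformly.\<close>

lemma continuous_retraction_eq:
  assumes 0: "limit_defect f = 0" shows "continuous_retraction f = f"
proof
  fix x
  have pen: "penalty n f = 0" for n
    using defect_nonneg by (simp add: penalty_def 0 split: nat.split)
  show "continuous_retraction f x = f x"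
  proof (cases "x \<in> S")
    case True
    show ?thesis
    proof (rule antisym)
      show "continuous_retraction f x \<le> f x" by (rule continuous_retraction_least[OF True term_le[OF True]])
      show "f x \<le> continuous_retraction f x"
      proof (rule field_le_epsilon)
        fix e :: real assume "0 < e"
        then obtain n where "defect n f < e" using limit_defect_less[of e] 0 by auto
        then show "f x \<le> continuous_retraction f x + e"
          using continuous_retraction_ge[OF True, of n] defect_ge[OF True, of n] pen[of n] by linarith
      qed
    qed
  next
    case False
    then show ?thesis using f by (simp add: continuous_retraction_def linf_carrier_def)
  qed
qed

text \<open>The envelope lies below \<open>f\<close>, so passing to it at \<open>x\<close> costs e
  and returning at \<open>y\<close> costs nothing.\<close>

lemma continuous_if_limit_defect_eq_0:
  assumes "limit_defect f = 0" shows "almost_Lipschitz K f"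
  unfolding almost_Lipschitz_def
proof (intro allI impI)
  fix e :: real assume "0 < e"
  then obtain n where n: "defect n f < e" using limit_defect_less[of e] assms by auto
  have half: "f x \<le> f y + real n * d x y + e" if "x \<in> S" "y \<in> S" for x y
    using inf_conv_Lipschitz[OF that, of n] defect_ge[OF that(1), of n] inf_conv_le[OF that(2), of n] n by linarith
  have "\<bar>f x - f y\<bar> \<le> real n * d x y + e" if "x \<in> S" "y \<in> S" for x y
    using half[OF that] half[OF that(2,1)] K.commute[of x y] by (simp add: abs_le_iff)
  then show "\<exists>L\<ge>0. \<forall>x\<in>S. \<forall>y\<in>S. \<bar>f x - f y\<bar> \<le> L * d x y + e"
    by (intro exI[of _ "real n"]) auto
qed

lemma continuous_retraction_Lipschitz_if_limit_defect_pos: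
  assumes pos: "0 < limit_defect f"
  obtains L where "0 \<le> L"
    "\<And>x y. x \<in> S \<Longrightarrow> y \<in> S \<Longrightarrow> \<bar>continuous_retraction f x - continuous_retraction f y\<bar> \<le> L * d x y"
proof -
  let ?w = "limit_defect f"
  \<comment> \<open>The first index with defect below 2 w still has penalty 0, because the penalty
    looks at the preceding defect. Its term therefore stays less than 2 w below
    \<open>f\<close>.\<close>
  define N where "N = (LEAST n. defect n f < 2 * ?w)"
  have "\<exists>n. defect n f < 2 * ?w" by (rule limit_defect_less) (use pos in simp)
  then have N: "defect N f < 2 * ?w" unfolding N_def by (rule LeastI_ex)
  have pN: "penalty N f = 0"
  proof (cases N)
    case (Suc m)
    then have "\<not> defect m f < 2 * ?w" unfolding N_def by (intro not_less_Least) simp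
    then show ?thesis by (simp add: penalty_def Suc)
  qed (simp add: penalty_def)
  \<comment> \<open>After a defect below 4/3 w the penalty is at least 3 * (2 - 4/3) w = 2 w, which
    pushes the term below that of \<open>N\<close>.\<close>
  obtain M where M: "defect M f < 4 / 3 * ?w" using limit_defect_less[of "4 / 3 * ?w"] pos by auto
  define L where "L = max N M"
  have late: "inf_conv n f x - penalty n f \<le> inf_conv N f x - penalty N f" if n: "L < n" and x: "x \<in> S" for n x
  proof -
    obtain m where m: "n = Suc m" "M \<le> m" using n by (cases n) (auto simp: L_def)
    have "2 * ?w \<le> penalty n f"
      using defect_antimono[OF m(2)] M by (simp add: penalty_def m(1) max_def)
    then show ?thesis using inf_conv_le[OF x, of n] defect_ge[OF x, of N] N pN by linarith
  qed
  have half: "continuous_retraction f x \<le> continuous_retraction f y + real L * d x y" if xy: "x \<in> S" "y \<in> S" for x y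
  proof (rule continuous_retraction_least[OF xy(1)])
    have early: "inf_conv n f x - penalty n f \<le> continuous_retraction f y + real L * d x y" if "n \<le> L" for n
    proof -
      have "real n * d x y \<le> real L * d x y" using that by (intro mult_right_mono) auto
      then show ?thesis using inf_conv_Lipschitz[OF xy, of n] continuous_retraction_ge[OF xy(2), of n] by linarith
    qed
    fix n
    show "inf_conv n f x - penalty n f \<le> continuous_retraction f y + real L * d x y"
    proof (cases "n \<le> L")
      case False
      moreover have "N \<le> L" by (simp add: L_def)
      ultimately show ?thesis using late[of n x] early[of N] xy by linarith
    qed (rule early)
  qed
  show thesis
  proof
    show "\<bar>continuous_retraction f x - continuous_retraction f y\<bar> \<le> real L * d x y" if "x \<in> S" "y \<in> S" for x y
      using half[OF that] half[OF that(2,1)] K.commute[of x y] by (simp add: abs_le_iff)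
  qed simp
qed

lemma continuous_retraction_in_CK: "continuous_retraction f \<in> mspace CK"
proof (cases "limit_defect f = 0")
  case True
  then show ?thesis
    using f by (simp add: CK_iff continuous_retraction_eq continuous_if_limit_defect_eq_0 linf_carrier_def)
next
  case False
  then have "0 < limit_defect f" using limit_defect_nonneg by simp
  then obtain L where "0 \<le> L"
    "\<And>x y. x \<in> S \<Longrightarrow> y \<in> S \<Longrightarrow> \<bar>continuous_retraction f x - continuous_retraction f y\<bar> \<le> L * d x y"
    using continuous_retraction_Lipschitz_if_limit_defect_pos by blast
  then have "almost_Lipschitz K (continuous_retraction f)" by (rule almost_Lipschitz_if_Lipschitz)
  then show ?thesis by (simp add: CK_iff continuous_retraction_def)
qed

end

lemma continuous_retraction_id:
  assumes "f \<in> mspace CK" shows "continuous_retraction f = f"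
proof -
  have "almost_Lipschitz K f" using assms unfolding CK_iff by (rule conjunct1)
  then show ?thesis
    by (intro continuous_retraction_eq limit_defect_eq_0_if_continuous CK_linf assms)
qed

text \<open>Each term is Lipschitz in \<open>f\<close> uniformly in \<open>n\<close>, and suprema
  preserve this. The constant 19 is 1 for the envelope plus 18 for the penalty.\<close>

lemma continuous_retraction_le:
  assumes f: "f \<in> linf_carrier S" and g: "g \<in> linf_carrier S" and x: "x \<in> S"
  shows "continuous_retraction f x \<le> continuous_retraction g x + 19 * linf_dist S f g"
proof (rule continuous_retraction_least[OF f x])
  let ?D = "linf_dist S f g"
  have D: "\<bar>f y - g y\<bar> \<le> ?D" if "y \<in> S" for y by (rule linf_dist_upper[OF f g that])
  have conv1: "inf_conv n f y \<le> inf_conv n g y + ?D" if y: "y \<in> S" for n y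
  proof -
    have "inf_conv n f y - ?D \<le> inf_conv n g y"
    proof (rule inf_conv_greatest[OF g])
      fix z assume z: "z \<in> S"
      show "inf_conv n f y - ?D \<le> g z + real n * d y z" using inf_conv_le_term[OF f y z, of n] D[OF z] by linarith
    qed
    then show ?thesis by linarith
  qed
  have conv2: "inf_conv n g y \<le> inf_conv n f y + ?D" if y: "y \<in> S" for n y
  proof -
    have "inf_conv n g y - ?D \<le> inf_conv n f y"
    proof (rule inf_conv_greatest[OF f])
      fix z assume z: "z \<in> S"
      show "inf_conv n g y - ?D \<le> f z + real n * d y z" using inf_conv_le_term[OF g y z, of n] D[OF z] by linarith
    qed
    then show ?thesis by linarith
  qed
  have def1: "defect n f \<le> defect n g + 2 * ?D" for n
  proof (rule defect_least[OF f])
    fix y assume y: "y \<in> S"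
    show "f y - inf_conv n f y \<le> defect n g + 2 * ?D" using conv2[OF y, of n] D[OF y] defect_ge[OF g y, of n] by linarith
  qed
  have def2: "defect n g \<le> defect n f + 2 * ?D" for n
  proof (rule defect_least[OF g])
    fix y assume y: "y \<in> S"
    show "g y - inf_conv n g y \<le> defect n f + 2 * ?D" using conv1[OF y, of n] D[OF y] defect_ge[OF f y, of n] by linarith
  qed
  have "limit_defect g - 2 * ?D \<le> limit_defect f"
  proof (rule limit_defect_greatest[OF f])
    fix n show "limit_defect g - 2 * ?D \<le> defect n f" using limit_defect_le[OF g, of n] def2[of n] by linarith
  qed
  moreover have "0 \<le> ?D" using D nonempty by force
  \<comment> \<open>18 = 3 * (2 * 2 + 2), as defect and limit defect both move by at most twice the
    distance of the functions.\<close>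
  ultimately have pen: "penalty n g \<le> penalty n f + 18 * ?D" for n
  proof (cases n)
    case (Suc m)
    show ?thesis
      using def1[of m] \<open>limit_defect g - 2 * ?D \<le> limit_defect f\<close> \<open>0 \<le> ?D\<close> by (auto simp: penalty_def max_def Suc)
  qed (simp add: penalty_def)
  fix n
  show "inf_conv n f x - penalty n f \<le> continuous_retraction g x + 19 * ?D"
    using conv1[OF x, of n] pen[of n] continuous_retraction_ge[OF g x, of n] by linarith
qed

lemma continuous_retraction_Lipschitz:
  assumes f: "f \<in> linf_carrier S" and g: "g \<in> linf_carrier S"
  shows "linf_dist S (continuous_retraction f) (continuous_retraction g) \<le> 19 * linf_dist S f g"
proof (rule linf_dist_least[OF nonempty])
  interpret L: Metric_space "linf_carrier S" "linf_dist S" by (rule Metric_space_linf[OF nonempty])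
  fix x assume "x \<in> S"
  then show "\<bar>continuous_retraction f x - continuous_retraction g x\<bar> \<le> 19 * linf_dist S f g"
    using continuous_retraction_le[OF f g] continuous_retraction_le[OF g f] L.commute[of f g] by (simp add: abs_le_iff diff_le_eq add.commute)
qed (use CK_linf continuous_retraction_in_CK f g in auto)

text \<open>The inverse of the embedding extends from the copy of C(K) to a map of the whole ambient
  space into \<open>linf S\<close>; the retraction onto C(K) and the embedding then lead back to the
  copy.\<close>

theorem absolute_Lipschitz_retract_CK: "absolute_Lipschitz_retract CK"
  unfolding absolute_Lipschitz_retract_def
proof (intro allI impI)
  fix N :: "(('k \<Rightarrow> real) \<Rightarrow> real) metric" and i
  assume i: "isometric_embedding CK N i"
  let ?C = "mspace CK"
  interpret C: Metric_space ?C "mdist CK" by (rule Metric_space_mspace_mdist)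
  interpret N: Metric_space "mspace N" "mdist N" by (rule Metric_space_mspace_mdist)
  have iN: "i f \<in> mspace N" if "f \<in> ?C" for f
    using i that unfolding isometric_embedding_def by blast
  have di: "mdist N (i f) (i g) = linf_dist S f g" if "f \<in> ?C" "g \<in> ?C" for f g
    using i that unfolding isometric_embedding_def mdist_CK by blast
  have inj: "inj_on i ?C"
  proof (rule inj_onI)
    fix f g assume fg: "f \<in> ?C" "g \<in> ?C" "i f = i g"
    then have "mdist CK f g = 0" using di[OF fg(1,2)] iN by (simp add: mdist_CK)
    then show "f = g" using fg C.zero by blast
  qed
  have "(\<lambda>_. 0) \<in> ?C" by (simp add: CK_iff almost_Lipschitz_if_Lipschitz[of 0])
  then have ne: "i ` ?C \<noteq> {}" by blast
  obtain \<Phi> where \<Phi>: "Lipschitz_continuous_map N (linf S) \<Phi>" "\<And>u. u \<in> i ` ?C \<Longrightarrow> \<Phi> u = inv_into ?C i u"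
  proof (rule linf_extension[of "i ` ?C" N S 1 "inv_into ?C i"])
    fix u v assume "u \<in> i ` ?C" "v \<in> i ` ?C"
    then show "linf_dist S (inv_into ?C i u) (inv_into ?C i v) \<le> 1 * mdist N u v"
      using inj by (auto simp: di)
  qed (use iN ne nonempty CK_linf inj in auto)
  have \<Phi>S: "\<Phi> u \<in> linf_carrier S" if "u \<in> mspace N" for u
    using Lipschitz_continuous_map_image[OF \<Phi>(1)] that nonempty by auto
  obtain B where B: "0 < B" "\<And>u v. u \<in> mspace N \<Longrightarrow> v \<in> mspace N \<Longrightarrow> linf_dist S (\<Phi> u) (\<Phi> v) \<le> B * mdist N u v"
    using \<Phi>(1) nonempty by (auto simp: Lipschitz_continuous_map_pos)
  define R where "R u = i (continuous_retraction (\<Phi> u))" for u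
  have RC: "continuous_retraction (\<Phi> u) \<in> ?C" if "u \<in> mspace N" for u
    by (rule continuous_retraction_in_CK[OF \<Phi>S[OF that]])
  have Ri: "R (i f) = i f" if "f \<in> ?C" for f
    using that inj by (simp add: R_def \<Phi>(2) continuous_retraction_id)
  have RL: "mdist N (R u) (R v) \<le> 19 * B * mdist N u v" if uv: "u \<in> mspace N" "v \<in> mspace N" for u v
  proof -
    have "mdist N (R u) (R v) \<le> 19 * linf_dist S (\<Phi> u) (\<Phi> v)"
      unfolding R_def di[OF RC[OF uv(1)] RC[OF uv(2)]]
      by (rule continuous_retraction_Lipschitz[OF \<Phi>S \<Phi>S]) (use uv in auto)
    then show ?thesis using B(2)[OF uv] by linarith
  qed
  show "Lipschitz_retract N (i ` ?C)"
    unfolding Lipschitz_retract_def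
  proof (intro conjI exI[of _ R])
    show iC: "i ` ?C \<subseteq> mspace N" using iN by blast
    have RiC: "R u \<in> i ` ?C" if "u \<in> mspace N" for u using RC[OF that] by (simp add: R_def)
    show "Lipschitz_continuous_map N (submetric N (i ` ?C)) R"
      by (rule Lipschitz_continuous_mapI[where B = "19 * B"]) (use RL RiC iC in auto)
    show "R ` mspace N = i ` ?C"
    proof
      show "R ` mspace N \<subseteq> i ` ?C" using RiC by blast
      show "i ` ?C \<subseteq> R ` mspace N" using Ri iN by (metis image_eqI image_subsetI)
    qed
    show "\<forall>x\<in>i ` ?C. R x = x" using Ri by blast
  qed
qed

section \<open>Separability of C(K) by rational cones over finite nets\<close>

lemma CK_approximation:
  assumes f: "f \<in> mspace CK" and e: "0 < e"
    and Y: "\<And>m. finite (Y m)" "\<And>m. Y m \<subseteq> S" "\<And>m x. x \<in> S \<Longrightarrow> \<exists>y\<in>Y m. d x y < 1 / real (Suc m)"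
  shows "\<exists>n m. \<exists>q \<in> (\<Pi>\<^sub>E y\<in>Y m. \<rat>). \<forall>x\<in>S. \<bar>f x - Min ((\<lambda>y. q y + real n * d x y) ` Y m)\<bar> \<le> e"
proof -
  have "almost_Lipschitz K f" using f unfolding CK_iff by (rule conjunct1)
  then obtain L where L: "0 \<le> L" "\<And>x y. x \<in> S \<Longrightarrow> y \<in> S \<Longrightarrow> \<bar>f x - f y\<bar> \<le> L * d x y + e / 4"
    using almost_LipschitzD[of K f "e / 4"] e by auto
  obtain n where n: "L \<le> real n" using real_arch_simple by blast
  obtain m where m: "4 * real n / e \<le> real m" using real_arch_simple by blast
  \<comment> \<open>The net must be fine compared with the slope. The upper estimate spends e / 4 on
    each of the rounding of \<open>q\<close>, the error in \<open>L\<close>, and twice on slope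
    times mesh.\<close>
  have nm: "real n * (1 / real (Suc m)) \<le> e / 4" using m e by (simp add: field_simps)
  have "\<exists>q\<in>\<rat>. f y < q \<and> q < f y + e / 4" for y using Rats_dense_in_real[of "f y" "f y + e / 4"] e by auto
  then obtain q0 where q0: "\<And>y. q0 y \<in> \<rat>" "\<And>y. f y < q0 y" "\<And>y. q0 y < f y + e / 4" by metis
  \<comment> \<open>Restriction to the net makes \<open>q\<close> a member of a countable
    extensional product.\<close>
  define q where "q = restrict q0 (Y m)"
  show ?thesis
  proof (intro exI bexI ballI)
    show "q \<in> (\<Pi>\<^sub>E y\<in>Y m. \<rat>)" using q0(1) by (simp add: q_def)
    fix x assume x: "x \<in> S"
    let ?M = "Min ((\<lambda>y. q y + real n * d x y) ` Y m)"
    obtain y where y: "y \<in> Y m" "d x y < 1 / real (Suc m)" using Y(3)[OF x] by blast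
    have yS: "y \<in> S" using y Y(2) by blast
    have Ld: "L * d x z \<le> real n * d x z" for z using n by (simp add: mult_right_mono)
    have "?M \<le> q y + real n * d x y" using Y(1) y by (intro Min_le) auto
    moreover have "real n * d x y \<le> real n * (1 / real (Suc m))" using y(2) by (intro mult_left_mono) auto
    moreover have "q y < f y + e / 4" using y q0 by (simp add: q_def)
    moreover have "f y \<le> f x + (L * d x y + e / 4)" using L(2)[OF x yS] by (simp add: abs_le_iff)
    ultimately have 1: "?M \<le> f x + e" using nm Ld[of y] by linarith
    \<comment> \<open>No cone cuts deep below \<open>f\<close>, since its slope is at least
      \<open>L\<close> and its apex lies above the graph.\<close>
    have "f x - e / 4 \<le> ?M"
    proof (rule Min.boundedI)
      fix v assume "v \<in> (\<lambda>y. q y + real n * d x y) ` Y m"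
      then obtain z where z: "z \<in> Y m" "v = q z + real n * d x z" by blast
      have zS: "z \<in> S" using z Y(2) by blast
      have "f x \<le> f z + (L * d x z + e / 4)" using L(2)[OF x zS] by linarith
      moreover have "f z < q z" using z q0 by (simp add: q_def)
      ultimately show "f x - e / 4 \<le> v" using Ld[of z] z(2) by linarith
    qed (use Y y in auto)
    then show "\<bar>f x - ?M\<bar> \<le> e" using 1 e by (simp add: abs_le_iff)
  qed
qed

lemma separable_CK: "separable_space (mtopology_of CK)"
proof -
  interpret C: Metric_space "mspace CK" "mdist CK" by (rule Metric_space_mspace_mdist)
  have "K.mtotally_bounded S"
    using K.compactin_imp_mtotally_bounded compact by (simp add: compact_space_def mtopology_of_def)
  then have "\<exists>Y. finite Y \<and> Y \<subseteq> S \<and> S \<subseteq> (\<Union>x\<in>Y. K.mball x (1 / real (Suc m)))" for m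
    by (simp add: K.mtotally_bounded_def)
  then obtain Y where Y: "\<And>m. finite (Y m)" "\<And>m. Y m \<subseteq> S" "\<And>m. S \<subseteq> (\<Union>x\<in>Y m. K.mball x (1 / real (Suc m)))"
    by metis
  have Y3: "\<exists>y\<in>Y m. d x y < 1 / real (Suc m)" if "x \<in> S" for m x
    using Y(3)[of m] that K.commute by fastforce
  have Yne: "Y m \<noteq> {}" for m using Y3 nonempty by blast
  define g where "g n m q x = (if x \<in> S then Min ((\<lambda>y. q y + real n * d x y) ` Y m) else 0)"
    for n m :: nat and q :: "'k \<Rightarrow> real" and x
  define A where "A = (\<Union>n. \<Union>m. g n m ` (\<Pi>\<^sub>E y\<in>Y m. \<rat>))"
  have "countable (\<Pi>\<^sub>E y\<in>Y m. (\<rat> :: real set))" for m using Y(1) by (intro countable_PiE countable_rat) auto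
  then have A: "countable A" by (auto simp: A_def)
  have gC: "g n m q \<in> mspace CK" for n m q
  proof -
    have "\<bar>g n m q x - g n m q y\<bar> \<le> real n * d x y" if xy: "x \<in> S" "y \<in> S" for x y
    proof -
      have "\<bar>(q z + real n * d x z) - (q z + real n * d y z)\<bar> \<le> real n * d x y" if "z \<in> Y m" for z
      proof -
        have z: "z \<in> S" using that Y by blast
        have "\<bar>d x z - d y z\<bar> \<le> d x y"
          using K.mdist_reverse_triangle[of x z y] K.commute xy z by simp
        then have "real n * \<bar>d x z - d y z\<bar> \<le> real n * d x y" by (rule mult_left_mono) simp
        moreover have "\<bar>(q z + real n * d x z) - (q z + real n * d y z)\<bar> = real n * \<bar>d x z - d y z\<bar>"
          by (simp add: abs_mult right_diff_distrib[symmetric])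
        ultimately show ?thesis by simp
      qed
      then have "\<bar>Min ((\<lambda>z. q z + real n * d x z) ` Y m) - Min ((\<lambda>z. q z + real n * d y z) ` Y m)\<bar> \<le> real n * d x y"
        using Y(1) Yne by (intro Min_image_diff_le) auto
      then show ?thesis using xy by (simp add: g_def)
    qed
    then have "almost_Lipschitz K (g n m q)" by (rule almost_Lipschitz_if_Lipschitz[rotated]) auto
    then show ?thesis by (simp add: CK_iff) (simp add: g_def)
  qed
  have AC: "A \<subseteq> mspace CK" using gC by (auto simp: A_def)
  have "f \<in> C.mtopology closure_of A" if f: "f \<in> mspace CK" for f
    unfolding C.metric_closure_of
  proof (intro CollectI conjI f allI impI)
    fix r :: real assume "0 < r"
    obtain n m q where q: "q \<in> (\<Pi>\<^sub>E y\<in>Y m. \<rat>)"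
      "\<forall>x\<in>S. \<bar>f x - Min ((\<lambda>y. q y + real n * d x y) ` Y m)\<bar> \<le> r / 2"
      using CK_approximation[OF f half_gt_zero[OF \<open>0 < r\<close>] Y(1,2) Y3] by blast
    have "mdist CK f (g n m q) \<le> r / 2"
      unfolding mdist_CK
      by (rule linf_dist_least[OF nonempty CK_linf[OF f] CK_linf[OF gC]]) (use q(2) in \<open>simp add: g_def\<close>)
    then have "g n m q \<in> C.mball f r" using f gC \<open>0 < r\<close> by simp
    moreover have "g n m q \<in> A" using q(1) by (auto simp: A_def)
    ultimately show "\<exists>y\<in>A. y \<in> C.mball f r" by blast
  qed
  then have "C.mtopology closure_of A = mspace CK"
    using C.metric_closure_of[of A] by auto
  then show ?thesis using A AC unfolding separable_space_def mtopology_of_def by auto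
qed

section \<open>A Lipschitz copy of the unit ball of \<open>c0\<close> in C(K)\<close>

definition hat :: "(nat \<Rightarrow> real) \<Rightarrow> nat \<Rightarrow> real \<Rightarrow> real" where
  "hat u n t = max 0 (1 - 2 / u n * \<bar>t - u n\<bar>)"

text \<open>At most one bump is active at each \<open>t\<close>, so the sum is finite and the
  heights act independently.\<close>

definition interpolation :: "(nat \<Rightarrow> real) \<Rightarrow> (nat \<Rightarrow> real) \<Rightarrow> real \<Rightarrow> real" where
  "interpolation u a t = (\<Sum>n\<in>{n. hat u n t \<noteq> 0}. a n * hat u n t)"

context
  fixes u :: "nat \<Rightarrow> real"
  assumes u_pos: "\<And>n. 0 < u n" and u_decr: "\<And>n. u (Suc n) \<le> u n / 3"
begin

lemma u_gap: "n < m \<Longrightarrow> u m \<le> u n / 3"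
proof (induction m)
  case (Suc m)
  show ?case
  proof (cases "n = m")
    case False
    then have "u m \<le> u n / 3" using Suc by simp
    then show ?thesis using u_decr[of m] u_pos[of m] by linarith
  qed (use u_decr in simp)
qed simp

lemma hat_support: "hat u n t \<noteq> 0 \<Longrightarrow> u n / 2 < t \<and> t < 3 * u n / 2"
proof -
  assume "hat u n t \<noteq> 0"
  then have "2 / u n * \<bar>t - u n\<bar> < 1"
    unfolding hat_def by (metis diff_gt_0_iff_gt max.absorb1 not_le)
  then have "2 * \<bar>t - u n\<bar> < u n" using u_pos[of n] by (simp add: divide_less_eq)
  then show ?thesis by (auto simp: abs_if split: if_splits)
qed

text \<open>The ratio 1/3 is chosen for this: the support of bump \<open>n\<close> lies strictly
  between u n / 2 and 3 u n / 2, so the next support ends no later than this one begins.\<close>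

lemma hat_disjoint: "hat u n t \<noteq> 0 \<Longrightarrow> hat u m t \<noteq> 0 \<Longrightarrow> n = m"
proof (rule ccontr)
  assume h: "hat u n t \<noteq> 0" "hat u m t \<noteq> 0" and "n \<noteq> m"
  then consider "n < m" | "m < n" by linarith
  then show False
    using u_gap[of n m] u_gap[of m n] hat_support[OF h(1)] hat_support[OF h(2)] by cases auto
qed

lemma hat_support_cases: "{n. hat u n t \<noteq> 0} = {} \<or> (\<exists>n. {n. hat u n t \<noteq> 0} = {n})"
  using hat_disjoint[of _ t] by blast

lemma hat_bounds: "0 \<le> hat u n t" "hat u n t \<le> 1"
  using u_pos[of n] by (auto simp: hat_def)

lemma hat_Lipschitz: "\<bar>hat u n s - hat u n t\<bar> \<le> 2 / u n * \<bar>s - t\<bar>"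
proof -
  have "\<bar>hat u n s - hat u n t\<bar> \<le> \<bar>2 / u n * \<bar>s - u n\<bar> - 2 / u n * \<bar>t - u n\<bar>\<bar>" unfolding hat_def by (auto simp: max_def)
  also have "\<dots> = 2 / u n * \<bar>\<bar>s - u n\<bar> - \<bar>t - u n\<bar>\<bar>"
    unfolding right_diff_distrib[symmetric] abs_mult using u_pos[of n] by simp
  also have "\<dots> \<le> 2 / u n * \<bar>s - t\<bar>" using u_pos[of n] by (intro mult_left_mono) (auto simp: less_imp_le)
  finally show ?thesis .
qed

lemma interpolation_at: "interpolation u a (u n) = a n"
proof -
  have h: "hat u n (u n) = 1" by (simp add: hat_def)
  then have "{k. hat u k (u n) \<noteq> 0} = {n}" using hat_disjoint[of n "u n"] by auto
  then show ?thesis by (simp add: interpolation_def h)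
qed

lemma interpolation_zero: "interpolation u a 0 = 0"
proof -
  have "hat u n 0 = 0" for n using u_pos[of n] by (simp add: hat_def)
  then show ?thesis by (simp add: interpolation_def)
qed

text \<open>A single active bump of height at most 1 makes interpolation nonexpansive from sequences
  in the sup norm to functions.\<close>

lemma interpolation_diff:
  assumes "\<And>n. \<bar>a n - b n\<bar> \<le> r" shows "\<bar>interpolation u a t - interpolation u b t\<bar> \<le> r"
proof -
  have r: "0 \<le> r" using assms[of 0] by linarith
  consider "{n. hat u n t \<noteq> 0} = {}" | n where "{n. hat u n t \<noteq> 0} = {n}" using hat_support_cases by blast
  then show ?thesis
  proof cases
    case 2
    have "\<bar>a n * hat u n t - b n * hat u n t\<bar> = \<bar>a n - b n\<bar> * hat u n t"
      using hat_bounds(1)[of n t] by (simp add: left_diff_distrib[symmetric] abs_mult)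
    also have "\<dots> \<le> r * 1" using assms hat_bounds r by (intro mult_mono) auto
    finally show ?thesis by (simp add: interpolation_def 2)
  qed (simp add: interpolation_def r)
qed

lemma interpolation_finite:
  assumes "\<And>n. N \<le> n \<Longrightarrow> a n = 0"
  shows "interpolation u a t = (\<Sum>n<N. a n * hat u n t)"
proof -
  have fin: "finite {n. hat u n t \<noteq> 0}" using hat_support_cases[of t] by auto
  show ?thesis unfolding interpolation_def
    by (rule sum.mono_neutral_cong[OF _ fin]) (use assms in \<open>auto simp: not_less\<close>)
qed

text \<open>The bumps get steeper without bound, but the heights tend to 0. Dropping those below e /
  2 costs e in total, and finitely many Lipschitz bumps remain.\<close>

lemma interpolation_almost_Lipschitz:
  assumes a: "a \<longlonglongrightarrow> 0" and e: "0 < e"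
  obtains L where "0 \<le> L" "\<And>s t. \<bar>interpolation u a s - interpolation u a t\<bar> \<le> L * \<bar>s - t\<bar> + e"
proof -
  obtain N where N: "\<And>n. N \<le> n \<Longrightarrow> \<bar>a n\<bar> < e / 2" using LIMSEQ_D[OF a, of "e / 2"] e by auto
  define b where "b n = (if n < N then a n else 0)" for n
  define L where "L = (\<Sum>n<N. \<bar>a n\<bar> * (2 / u n))"
  have b: "interpolation u b t = (\<Sum>n<N. a n * hat u n t)" for t
    using interpolation_finite[of N b t] by (simp add: b_def)
  have ab: "\<bar>interpolation u a t - interpolation u b t\<bar> \<le> e / 2" for t
    by (rule interpolation_diff) (use N e in \<open>auto simp: b_def less_imp_le\<close>)
  have bL: "\<bar>interpolation u b s - interpolation u b t\<bar> \<le> L * \<bar>s - t\<bar>" for s t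
  proof -
    have "\<bar>interpolation u b s - interpolation u b t\<bar> \<le> (\<Sum>n<N. \<bar>a n * hat u n s - a n * hat u n t\<bar>)"
      unfolding b by (simp add: sum_subtractf[symmetric] sum_abs)
    also have "\<dots> \<le> (\<Sum>n<N. \<bar>a n\<bar> * (2 / u n * \<bar>s - t\<bar>))"
      by (rule sum_mono) (simp only: right_diff_distrib[symmetric] abs_mult, rule mult_left_mono[OF hat_Lipschitz abs_ge_zero])
    finally show ?thesis by (simp add: L_def sum_distrib_right mult.assoc)
  qed
  show thesis
  proof
    show "0 \<le> L" unfolding L_def using u_pos by (intro sum_nonneg) (simp add: less_imp_le)
    show "\<bar>interpolation u a s - interpolation u a t\<bar> \<le> L * \<bar>s - t\<bar> + e" for s t
      using ab[of s] ab[of t] bL[of s t] by linarith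
  qed
qed

end

text \<open>An infinite compact space has an accumulation point; distances are made to shrink by the
  factor 3 that disjoint bumps require.\<close>

lemma accumulating_sequence:
  assumes "infinite S"
  obtains p x where "p \<in> S" "\<And>n. x n \<in> S" "\<And>n. 0 < d (x n) p" "\<And>n::nat. d (x (Suc n)) p \<le> d (x n) p / 3"
proof -
  have "K.mtopology derived_set_of S \<noteq> {}"
    using K.compact_space_eq_Bolzano_Weierstrass compact assms by (simp add: mtopology_of_def)
  then obtain p where p: "p \<in> S" "\<And>r. 0 < r \<Longrightarrow> \<exists>y\<in>S. y \<noteq> p \<and> d p y < r"
    by (auto simp: K.metric_derived_set_of)
  have "\<exists>x. \<forall>n. (x n \<in> S \<and> 0 < d (x n) p) \<and> d (x (Suc n)) p \<le> d (x n) p / 3"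
  proof (rule dependent_nat_choice)
    show "\<exists>y. y \<in> S \<and> 0 < d y p" using p(2)[of 1] p(1) K.mdist_pos_less by auto
    fix y and n :: nat assume "y \<in> S \<and> 0 < d y p"
    then obtain z where "z \<in> S" "z \<noteq> p" "d p z < d y p / 3" using p(2)[of "d y p / 3"] by auto
    then show "\<exists>z. (z \<in> S \<and> 0 < d z p) \<and> d z p \<le> d y p / 3"
      using p(1) K.mdist_pos_less K.commute by (intro exI[of _ z]) auto
  qed
  then show thesis using p(1) that by blast
qed

text \<open>\<open>j\<close> draws the sequence as bumps over the distance to \<open>p\<close>, and
  \<open>q\<close> samples a function at the chosen points. Convergence to 0 of the sequence
  corresponds to continuity at \<open>p\<close>.\<close>

lemma c0_unit_ball_section:
  assumes "infinite S"
  obtains j q where "Lipschitz_continuous_map c0_unit_ball CK j" "Lipschitz_continuous_map CK c0_unit_ball q"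
    "\<And>a. a \<in> mspace c0_unit_ball \<Longrightarrow> q (j a) = a"
proof -
  obtain p x where p: "p \<in> S" and x: "\<And>n. x n \<in> S" and pos: "\<And>n. 0 < d (x n) p"
    and decr: "\<And>n::nat. d (x (Suc n)) p \<le> d (x n) p / 3"
    by (rule accumulating_sequence[OF assms]) blast
  define u where "u n = d (x n) p" for n
  note u = pos[folded u_def] decr[folded u_def]
  have u_le: "u n \<le> u 0 * (1 / 3) ^ n" for n
    by (induction n) (use u(2) in \<open>auto intro: order_trans\<close>)
  have "(\<lambda>n. u 0 * (1 / 3) ^ n) \<longlonglongrightarrow> 0" by (intro tendsto_mult_right_zero LIMSEQ_power_zero) simp
  then have u_lim: "u \<longlonglongrightarrow> 0"
    by (rule Lim_null_comparison[rotated]) (use u_le u(1) in \<open>auto simp: less_imp_le\<close>)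
  define j where "j a y = (if y \<in> S then interpolation u a (d y p) else 0)" for a y
  \<comment> \<open>Subtracting \<open>f p\<close> produces a null sequence, and clipping brings it
    into the unit ball. Two values of \<open>f\<close> enter, hence the Lipschitz constant
    2.\<close>
  define q where "q f n = clip 1 (f (x n) - f p)" for f :: "'k \<Rightarrow> real" and n
  have jC: "j a \<in> mspace CK" if a: "a \<in> mspace c0_unit_ball" for a
  proof -
    have "a \<longlonglongrightarrow> 0" using a by (simp add: mspace_c0_unit_ball)
    have "almost_Lipschitz K (j a)"
      unfolding almost_Lipschitz_def
    proof (intro allI impI)
      fix e :: real assume "0 < e"
      then obtain L where L: "0 \<le> L" "\<And>s t. \<bar>interpolation u a s - interpolation u a t\<bar> \<le> L * \<bar>s - t\<bar> + e"
        using interpolation_almost_Lipschitz[where u = u, OF u \<open>a \<longlonglongrightarrow> 0\<close>] by blast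
      have "\<bar>j a y - j a z\<bar> \<le> L * d y z + e" if yz: "y \<in> S" "z \<in> S" for y z
      proof -
        have "\<bar>d y p - d z p\<bar> \<le> d y z"
          using K.mdist_reverse_triangle[of y p z] K.commute p yz by simp
        then have "L * \<bar>d y p - d z p\<bar> \<le> L * d y z" using L(1) by (rule mult_left_mono)
        then show ?thesis using L(2)[of "d y p" "d z p"] yz by (simp add: j_def)
      qed
      then show "\<exists>L\<ge>0. \<forall>y\<in>S. \<forall>z\<in>S. \<bar>j a y - j a z\<bar> \<le> L * d y z + e" using L(1) by blast
    qed
    then show ?thesis by (simp add: CK_iff) (simp add: j_def)
  qed
  have j: "Lipschitz_continuous_map c0_unit_ball CK j"
  proof (rule Lipschitz_continuous_mapI[where B = 1, OF jC])
    fix a b assume ab: "a \<in> mspace c0_unit_ball" "b \<in> mspace c0_unit_ball"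
    have "\<bar>a n - b n\<bar> \<le> mdist c0 a b" for n by (rule c0_dist_upper) (use ab c0_unit_ball_subset in auto)
    then have "\<bar>interpolation u a t - interpolation u b t\<bar> \<le> mdist c0 a b" for t
      by (rule interpolation_diff[where u = u, OF u])
    then show "mdist CK (j a) (j b) \<le> 1 * mdist c0_unit_ball a b"
      unfolding mdist_CK mdist_c0_unit_ball
      by (intro linf_dist_least nonempty CK_linf jC ab) (simp add: j_def)
  qed
  have qB: "q f \<in> mspace c0_unit_ball" if f: "f \<in> mspace CK" for f
    unfolding q_def
  proof (rule clip_in_c0_unit_ball)
    have aL: "almost_Lipschitz K f" using f unfolding CK_iff by (rule conjunct1)
    show "(\<lambda>n. f (x n) - f p) \<longlonglongrightarrow> 0"
    proof (rule LIMSEQ_I)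
      fix e :: real assume e: "0 < e"
      then obtain L where L: "0 \<le> L" "\<And>y z. y \<in> S \<Longrightarrow> z \<in> S \<Longrightarrow> \<bar>f y - f z\<bar> \<le> L * d y z + e / 2"
        using almost_LipschitzD[OF aL, of "e / 2"] by auto
      have "(\<lambda>n. L * u n) \<longlonglongrightarrow> 0" by (rule tendsto_mult_right_zero[OF u_lim])
      then obtain N where "\<And>n. N \<le> n \<Longrightarrow> \<bar>L * u n\<bar> < e / 2" using LIMSEQ_D[of _ 0 "e / 2"] e by fastforce
      then have "\<bar>f (x n) - f p\<bar> < e" if "N \<le> n" for n
        using L(2)[OF x p, of n] that by (fastforce simp: u_def)
      then show "\<exists>N. \<forall>n\<ge>N. norm (f (x n) - f p - 0) < e" by auto
    qed
  qed auto
  have q: "Lipschitz_continuous_map CK c0_unit_ball q"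
  proof (rule Lipschitz_continuous_mapI[where B = 2, OF qB])
    fix f g assume fg: "f \<in> mspace CK" "g \<in> mspace CK"
    have "mdist c0 (q f) (q g) \<le> 2 * mdist CK f g"
    proof (rule c0_dist_least)
      fix n
      have "\<bar>q f n - q g n\<bar> \<le> \<bar>(f (x n) - f p) - (g (x n) - g p)\<bar>"
        using clip_diff[of 1 1 "f (x n) - f p" "g (x n) - g p"] by (simp add: q_def)
      also have "\<dots> \<le> 2 * mdist CK f g"
        using linf_dist_upper[OF CK_linf[OF fg(1)] CK_linf[OF fg(2)] x[of n]]
          linf_dist_upper[OF CK_linf[OF fg(1)] CK_linf[OF fg(2)] p] unfolding mdist_CK by linarith
      finally show "\<bar>q f n - q g n\<bar> \<le> 2 * mdist CK f g" .
    qed (use qB fg c0_unit_ball_subset in blast)+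
    then show "mdist c0_unit_ball (q f) (q g) \<le> 2 * mdist CK f g" by (simp add: mdist_c0_unit_ball)
  qed
  have "q (j a) = a" if a: "a \<in> mspace c0_unit_ball" for a
  proof
    fix n
    have "j a (x n) = a n" using x interpolation_at[where u = u, OF u, of a n] by (simp add: j_def u_def)
    moreover have "j a p = 0" using p interpolation_zero[where u = u, OF u, of a] by (simp add: j_def)
    ultimately show "q (j a) n = a n" using a by (simp add: q_def clip_eq mspace_c0_unit_ball)
  qed
  then show thesis using that j q by blast
qed

end

theorem corollary3p4:
  fixes M :: "'a metric" and K :: "'k metric"
  shows "(separable_space (mtopology_of M) \<and>
          (\<exists>F. Lipschitz_retract M F \<and> Lipschitz_equivalent (submetric M F) c0_unit_ball) \<and>
          absolute_Lipschitz_retract M \<longrightarrow>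
            (\<forall>a \<in> mspace M. \<forall>b \<in> mspace c0. free_isomorphic M a c0 b)) \<and>
         (compact_space (mtopology_of K) \<and> infinite (mspace K) \<longrightarrow>
            (\<forall>a \<in> mspace (continuous_functions K). \<forall>b \<in> mspace c0.
               free_isomorphic (continuous_functions K) a c0 b))"
proof (intro conjI impI ballI)
  fix a b
  assume M: "separable_space (mtopology_of M) \<and>
          (\<exists>F. Lipschitz_retract M F \<and> Lipschitz_equivalent (submetric M F) c0_unit_ball) \<and>
          absolute_Lipschitz_retract M"
    and ab: "a \<in> mspace M" "b \<in> mspace c0"
  then obtain F where F: "Lipschitz_retract M F" "Lipschitz_equivalent (submetric M F) c0_unit_ball" by blast
  show "free_isomorphic M a c0 b"
    by (rule free_isomorphic_c0_if_Lipschitz_retract[OF _ _ ab F]) (use M in simp_all)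
next
  fix a b
  assume K: "compact_space (mtopology_of K) \<and> infinite (mspace K)"
    and ab: "a \<in> mspace (continuous_functions K)" "b \<in> mspace c0"
  interpret compact_metric K by unfold_locales (use K in auto)
  obtain j q where "Lipschitz_continuous_map c0_unit_ball CK j" "Lipschitz_continuous_map CK c0_unit_ball q"
    "\<And>a. a \<in> mspace c0_unit_ball \<Longrightarrow> q (j a) = a"
    using c0_unit_ball_section K by blast
  then show "free_isomorphic CK a c0 b"
    by (rule free_isomorphic_c0[OF separable_CK absolute_Lipschitz_retract_CK ab])
qed

end
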